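(* Let $\Omega$ be an associative $\mathbb{C}$-algebra of finite or countable dimension (possibly not unital) and let $d\ge1$ be an integer. Under the isomorphism of graded algebras $\operatorname{gr}Y_d(\Omega)\simeq\mathcal{S}(\mathrm{M}_d(\Omega))$, where $\mathrm{M}_d(\Omega)=\mathrm{Mat}(d,\mathbb{C})\otimes\mathrm{T}^+(\Omega)$, the canonical Poisson bracket on $\operatorname{gr}Y_d(\Omega)$ coincides with the Poisson bracket $\{-,-\}_{d,\Omega}$ on $\mathcal{S}(\mathrm{M}_d(\Omega))$ determined by $$\begin{aligned}\{p_{ij}(\mathbf{x}),p_{kl}(\mathbf{y})\}_{d,\Omega}&=\sum_{r=1}^m\sum_{q=1}^n p_{kj}(\mathbf{y}^{<q}\otimes\mathbf{x}^{>r})\,p_{il}(\mathbf{x}^{<r}\otimes(x_ry_q)\otimes\mathbf{y}^{>q})\\&\quad-\sum_{r=1}^m\sum_{q=1}^n p_{kj}(\mathbf{y}^{<q}\otimes(y_qx_r)\otimes\mathbf{x}^{>r})\,p_{il}(\mathbf{x}^{<r}\otimes\mathbf{y}^{>q})\end{aligned}$$ for all $i,j,k,l\in\{1,\dots,d\}$ and all decomposable tensors $\mathbf{x}=x_1\otimes\cdots\otimes x_m\in\Omega^{\otimes m}$, $\mathbf{y}=y_1\otimes\cdots\otimes y_n\in\Omega^{\otimes n}$, $m,n\ge1$.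
   Context: Tensor notation. $\mathrm{T}^m(\Omega):=\Omega^{\otimes m}$ (over $\mathbb{C}$), $\mathrm{T}^+(\Omega):=\bigoplus_{m\ge1}\mathrm{T}^m(\Omega)$, $\mathrm{T}(\Omega):=\mathbb{C}\mathbf{1}\oplus\mathrm{T}^+(\Omega)$. $\mathrm{M}_d(\Omega)$ is graded by tensor degree, and $\mathcal{S}(\mathrm{M}_d(\Omega))$ is its symmetric algebra with the extended grading. $p_{ij}(\mathbf{x}):=E_{ij}\otimes\mathbf{x}\in\mathrm{M}_d(\Omega)$ for $\mathbf{x}\in\mathrm{T}^+(\Omega)$, and $p_{ab}(\mathbf{1}):=\delta_{ab}$. For decomposable $\mathbf{x},\mathbf{y}$ as in the claim, $\mathbf{x}^{<r}=x_1\otimes\cdots\otimes x_{r-1}$, $\mathbf{x}^{>r}=x_{r+1}\otimes\cdots\otimes x_m$, $\mathbf{y}^{<q}=y_1\otimes\cdots\otimes y_{q-1}$, $\mathbf{y}^{>q}=y_{q+1}\otimes\cdots\otimes y_n$, where $\mathbf{x}^{<1},\mathbf{x}^{>m},\mathbf{y}^{<1},\mathbf{y}^{>n}$ are interpreted as the unit $\mathbf{1}\in\mathrm{T}(\Omega)$; $x_ry_q$, $y_qx_r$ are products in $\Omega$. The algebra $A_d(\Omega)$. The Lie algebra $\mathfrak{gl}(N,\Omega)=\mathrm{Mat}(N,\mathbb{C})\otimes\Omega$ carries the commutator bracket; with $E_{ij}$ the matrix units and $E_{ij}(x):=E_{ij}\otimes x$, one has $[E_{ij}(x),E_{kl}(y)]=\delta_{kj}E_{il}(xy)-\delta_{il}E_{kj}(yx)$.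 The Lie algebra $\mathfrak{gl}(N,\mathbb{C})$ acts on $\mathfrak{gl}(N,\Omega)$ by $\mathrm{ad}\otimes\mathrm{Id}$, i.e. $[E_{ij},E_{kl}(y)]=\delta_{kj}E_{il}(y)-\delta_{il}E_{kj}(y)$, and this extends to $\mathcal{U}(\mathfrak{gl}(N,\Omega))$ by derivations. For $d\le N$ let $\mathfrak{gl}_d(N,\mathbb{C})$ be the span of the $E_{ij}$ with $d+1\le i,j\le N$, and $A_d(\Omega;N):=\mathcal{U}(\mathfrak{gl}(N,\Omega))^{\mathfrak{gl}_d(N,\mathbb{C})}$ (invariants). Let $I^+(N)$ be the left ideal of $\mathcal{U}(\mathfrak{gl}(N,\Omega))$ generated by all $E_{iN}(x)$ and $I^-(N)$ the right ideal generated by all $E_{Nj}(x)$ ($1\le i,j\le N$, $x\in\Omega$). Let $\mathcal{U}(\mathfrak{gl}(N,\Omega))^{E_{NN}}$ be the subalgebra of elements annihilated by $[E_{NN},-]$. Its intersections with $I^+(N)$ and $I^-(N)$ coincide; the common intersection $L(N)$ is a two-sided ideal in it, and $\mathcal{U}(\mathfrak{gl}(N,\Omega))^{E_{NN}}=\mathcal{U}(\mathfrak{gl}(N-1,\Omega))\oplus L(N)$. Let $\pi_{N,N-1}$ be the projection onto $\mathcal{U}(\mathfrak{gl}(N-1,\Omega))$ along $L(N)$, a homomorphism of filtered algebras mapping $A_d(\Omega;N)$ into $A_d(\Omega;N-1)$ for $N>d$. $A_d(\Omega)$ is the projective limit of $(A_d(\Omega;N),\pi_{N,N-1})$ in the category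 of filtered algebras: its elements are sequences $\mathbf{a}=\{\mathbf{a}(N)\colon N\ge d\}$ with $\mathbf{a}(N)\in A_d(\Omega;N)$, $\pi_{N,N-1}(\mathbf{a}(N))=\mathbf{a}(N-1)$ for $N>d$, and $\deg\mathbf{a}(N)$ (canonical filtration of the enveloping algebra) bounded uniformly in $N$. Its canonical filtration: $\mathbf{a}$ has degree $\le k$ if $\deg\mathbf{a}(N)\le k$ for all $N$. The algebra $Y_d(\Omega)$. Let $W(\Omega):=\bigsqcup_{m\ge1}\Omega^m$, $\ell(\mathbf{x}):=m$ for $\mathbf{x}\in\Omega^m$. For $\mathbf{x}=(x_1,\dots,x_m)$ put $e_{ij}(\mathbf{x};N):=\sum_{a_1,\dots,a_{m-1}=1}^N E_{ia_1}(x_1)E_{a_1a_2}(x_2)\cdots E_{a_{m-1}j}(x_m)$ ($=E_{ij}(x_1)$ if $m=1$). For a composition $\nu=(\nu_1,\dots,\nu_n)\in\mathrm{Comp}(m)$ of $m$, $\mathbf{x}\rhd\nu:=(y_1,\dots,y_n)$, where $y_1=x_1\cdots x_{\nu_1}$, $y_2=x_{\nu_1+1}\cdots x_{\nu_1+\nu_2}$, ..., $y_n=x_{\nu_1+\dots+\nu_{n-1}+1}\cdots x_m$. For $s\in\mathbb{C}$, $t_{ij}(\mathbf{x};N;s):=\sum_{\nu\in\mathrm{Comp}(m)}(-N-s)^{\ell(\mathbf{x})-\ell(\mathbf{x}\rhd\nu)}e_{ij}(\mathbf{x}\rhd\nu;N)$, with $0^0:=1$. For $i,j\in\{1,\dots,d\}$,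 $t_{ij}(\mathbf{x};s)\in A_d(\Omega)$ is the unique element whose $N$th term is $t_{ij}(\mathbf{x};N;s)$ for all $N\ge d$. $Y_d(\Omega)$ is the unital subalgebra of $A_d(\Omega)$ generated by all $t_{ij}(\mathbf{x};s)$, $i,j\in\{1,\dots,d\}$, $\mathbf{x}\in W(\Omega)$, for an arbitrary fixed $s\in\mathbb{C}$ (it does not depend on $s$). It carries the filtration $F_k$ induced from $A_d(\Omega)$, and $\operatorname{gr}Y_d(\Omega)$ is the associated graded algebra, which is commutative. The isomorphism $\operatorname{gr}Y_d(\Omega)\simeq\mathcal{S}(\mathrm{M}_d(\Omega))$ sends the class of $t_{ij}((x_1,\dots,x_m);s)$ in the $m$th graded component to $p_{ij}(x_1\otimes\cdots\otimes x_m)$. The canonical Poisson bracket on $\operatorname{gr}Y_d(\Omega)$ is of degree $-1$: for $a\in F_k$, $b\in F_l$, the bracket of their classes in $F_k/F_{k-1}$ and $F_l/F_{l-1}$ is the class of $ab-ba$ in $F_{k+l-1}/F_{k+l-2}$. *)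

theory Defs
  imports
    Complex_Main
    "HOL-Library.Poly_Mapping"
    "HOL-Library.Countable_Set"
    "HOL-Library.FuncSet"
    "HOL-Algebra.Module"
    "HOL-Algebra.QuotRing"
begin

section \<open>Algebras given by generators and relations\<close>

text \<open>
  With concatenation as addition on lists, \<open>'x list \<Rightarrow>\<^sub>0 complex\<close> is the monoid algebra of the free
  monoid over \<open>'x\<close>, that is, the free unital associative algebra on \<open>'x\<close>.
\<close>

instantiation list :: (type) monoid_add
begin
definition zero_list_def: "0 = []"
definition plus_list_def: "xs + ys = xs @ ys"
instance by standard (simp_all add: zero_list_def plus_list_def)
end

text \<open>
  Complex vector spaces and complex algebras are records of type \<open>(complex, 'b) module\<close>. The fields
  \<^const>\<open>mult\<close> and \<^const>\<open>one\<close> are left \<^const>\<open>undefined\<close> where only the vector space matters.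
\<close>

definition free_algebra :: "'x set \<Rightarrow> (complex, 'x list \<Rightarrow>\<^sub>0 complex) module" where
  "free_algebra X = \<lparr>carrier = {f. Poly_Mapping.keys f \<subseteq> lists X},
     mult = (*), one = 1, zero = 0, add = (+), smult = (\<lambda>c. Poly_Mapping.map ((*) c))\<rparr>"

definition word :: "'x list \<Rightarrow> ('x list \<Rightarrow>\<^sub>0 complex)" where
  "word w = Poly_Mapping.single w 1"

definition quotient_algebra :: "(complex, 'b) module \<Rightarrow> 'b set \<Rightarrow> (complex, 'b set) module" where
  "quotient_algebra A I = ring.extend (A Quot I)
     (module.fields (\<lambda>c X. \<Union>x\<in>X. I +>\<^bsub>A\<^esub> c \<odot>\<^bsub>A\<^esub> x))"

definition linear_relations :: "(complex, 'v) module \<Rightarrow> ('v list \<Rightarrow>\<^sub>0 complex) set" where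
  "linear_relations V =
     {word [x \<oplus>\<^bsub>V\<^esub> y] - word [x] - word [y] | x y. x \<in> carrier V \<and> y \<in> carrier V} \<union>
     {word [c \<odot>\<^bsub>V\<^esub> x] - Poly_Mapping.map ((*) c) (word [x]) | c x. x \<in> carrier V}"

definition tensor_ideal :: "(complex, 'v) module \<Rightarrow> ('v list \<Rightarrow>\<^sub>0 complex) set" where
  "tensor_ideal V = genideal (free_algebra (carrier V)) (linear_relations V)"

definition enveloping_ideal ::
    "(complex, 'v) module \<Rightarrow> ('v \<Rightarrow> 'v \<Rightarrow> 'v) \<Rightarrow> ('v list \<Rightarrow>\<^sub>0 complex) set" where
  "enveloping_ideal V br = genideal (free_algebra (carrier V))
     (linear_relations V \<union>
      {word [x, y] - word [y, x] - word [br x y] | x y. x \<in> carrier V \<and> y \<in> carrier V})"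

definition symmetric_ideal :: "(complex, 'v) module \<Rightarrow> ('v list \<Rightarrow>\<^sub>0 complex) set" where
  "symmetric_ideal V = genideal (free_algebra (carrier V))
     (linear_relations V \<union>
      {word [x, y] - word [y, x] | x y. x \<in> carrier V \<and> y \<in> carrier V})"

definition tensor_algebra :: "(complex, 'v) module \<Rightarrow> (complex, ('v list \<Rightarrow>\<^sub>0 complex) set) module" where
  "tensor_algebra V = quotient_algebra (free_algebra (carrier V)) (tensor_ideal V)"

definition enveloping_algebra ::
    "(complex, 'v) module \<Rightarrow> ('v \<Rightarrow> 'v \<Rightarrow> 'v) \<Rightarrow> (complex, ('v list \<Rightarrow>\<^sub>0 complex) set) module" where
  "enveloping_algebra V br = quotient_algebra (free_algebra (carrier V)) (enveloping_ideal V br)"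

definition symmetric_algebra :: "(complex, 'v) module \<Rightarrow> (complex, ('v list \<Rightarrow>\<^sub>0 complex) set) module" where
  "symmetric_algebra V = quotient_algebra (free_algebra (carrier V)) (symmetric_ideal V)"

text \<open>The image, in the quotient by \<open>I\<close>, of the span of the words over \<open>X\<close> that satisfy \<open>P\<close>.\<close>

definition span_words :: "'x set \<Rightarrow> ('x list \<Rightarrow>\<^sub>0 complex) set \<Rightarrow> ('x list \<Rightarrow> bool) \<Rightarrow>
    ('x list \<Rightarrow>\<^sub>0 complex) set set" where
  "span_words X I P = {I +>\<^bsub>free_algebra X\<^esub> f | f.
     f \<in> carrier (free_algebra X) \<and> (\<forall>w\<in>Poly_Mapping.keys f. P w)}"

text \<open>The derivation of the free algebra that extends the map \<open>\<delta>\<close> on generators.\<close>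

definition free_derivation :: "('x \<Rightarrow> 'x) \<Rightarrow> ('x list \<Rightarrow>\<^sub>0 complex) \<Rightarrow> ('x list \<Rightarrow>\<^sub>0 complex)" where
  "free_derivation \<delta> f =
     (\<Sum>w\<in>Poly_Mapping.keys f. \<Sum>k<length w.
        Poly_Mapping.single (w[k := \<delta> (w ! k)]) (Poly_Mapping.lookup f w))"


section \<open>Generic algebraic notions\<close>

definition left_ideal_generated :: "(complex, 'b) module \<Rightarrow> 'b set \<Rightarrow> 'b set" where
  "left_ideal_generated A S = \<Inter>{J. additive_subgroup J A \<and> S \<subseteq> J \<and>
     (\<forall>a\<in>carrier A. \<forall>x\<in>J. a \<otimes>\<^bsub>A\<^esub> x \<in> J)}"

definition right_ideal_generated :: "(complex, 'b) module \<Rightarrow> 'b set \<Rightarrow> 'b set" where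
  "right_ideal_generated A S = \<Inter>{J. additive_subgroup J A \<and> S \<subseteq> J \<and>
     (\<forall>a\<in>carrier A. \<forall>x\<in>J. x \<otimes>\<^bsub>A\<^esub> a \<in> J)}"

inductive_set subalgebra_generated :: "(complex, 'b) module \<Rightarrow> 'b set \<Rightarrow> 'b set"
  for A :: "(complex, 'b) module" and S :: "'b set" where
  one: "\<one>\<^bsub>A\<^esub> \<in> subalgebra_generated A S"
| gen: "x \<in> S \<Longrightarrow> x \<in> subalgebra_generated A S"
| add: "x \<in> subalgebra_generated A S \<Longrightarrow> y \<in> subalgebra_generated A S \<Longrightarrow>
    x \<oplus>\<^bsub>A\<^esub> y \<in> subalgebra_generated A S"
| mult: "x \<in> subalgebra_generated A S \<Longrightarrow> y \<in> subalgebra_generated A S \<Longrightarrow>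
    x \<otimes>\<^bsub>A\<^esub> y \<in> subalgebra_generated A S"
| smult: "x \<in> subalgebra_generated A S \<Longrightarrow> c \<odot>\<^bsub>A\<^esub> x \<in> subalgebra_generated A S"

definition commutator :: "(complex, 'b) module \<Rightarrow> 'b \<Rightarrow> 'b \<Rightarrow> 'b" where
  "commutator A a b = a \<otimes>\<^bsub>A\<^esub> b \<ominus>\<^bsub>A\<^esub> b \<otimes>\<^bsub>A\<^esub> a"

definition poisson_bracket :: "(complex, 'b) module \<Rightarrow> ('b \<Rightarrow> 'b \<Rightarrow> 'b) \<Rightarrow> bool" where
  "poisson_bracket A B \<longleftrightarrow>
     (\<forall>a\<in>carrier A. \<forall>b\<in>carrier A. B a b \<in> carrier A) \<and>
     (\<forall>a\<in>carrier A. \<forall>b\<in>carrier A. \<forall>c\<in>carrier A.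
        B (a \<oplus>\<^bsub>A\<^esub> b) c = B a c \<oplus>\<^bsub>A\<^esub> B b c \<and> B c (a \<oplus>\<^bsub>A\<^esub> b) = B c a \<oplus>\<^bsub>A\<^esub> B c b) \<and>
     (\<forall>z. \<forall>a\<in>carrier A. \<forall>b\<in>carrier A.
        B (z \<odot>\<^bsub>A\<^esub> a) b = z \<odot>\<^bsub>A\<^esub> B a b \<and> B a (z \<odot>\<^bsub>A\<^esub> b) = z \<odot>\<^bsub>A\<^esub> B a b) \<and>
     (\<forall>a\<in>carrier A. B a a = \<zero>\<^bsub>A\<^esub>) \<and>
     (\<forall>a\<in>carrier A. \<forall>b\<in>carrier A. \<forall>c\<in>carrier A.
        B a (B b c) \<oplus>\<^bsub>A\<^esub> B b (B c a) \<oplus>\<^bsub>A\<^esub> B c (B a b) = \<zero>\<^bsub>A\<^esub>) \<and>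
     (\<forall>a\<in>carrier A. \<forall>b\<in>carrier A. \<forall>c\<in>carrier A.
        B a (b \<otimes>\<^bsub>A\<^esub> c) = B a b \<otimes>\<^bsub>A\<^esub> c \<oplus>\<^bsub>A\<^esub> b \<otimes>\<^bsub>A\<^esub> B a c)"

definition graded_algebra_iso ::
    "(complex, 'b) module \<Rightarrow> (int \<Rightarrow> 'b set) \<Rightarrow> (complex, 'c) module \<Rightarrow> (int \<Rightarrow> 'c set) \<Rightarrow>
     ('b \<Rightarrow> 'c) \<Rightarrow> bool" where
  "graded_algebra_iso A GA B GB \<phi> \<longleftrightarrow>
     \<phi> \<in> ring_iso A B \<and>
     (\<forall>c. \<forall>x\<in>carrier A. \<phi> (c \<odot>\<^bsub>A\<^esub> x) = c \<odot>\<^bsub>B\<^esub> \<phi> x) \<and>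
     (\<forall>k. \<phi> ` GA k = GB k)"


section \<open>The associated graded algebra\<close>

text \<open>
  For an increasing filtration \<open>F\<close> of an algebra \<open>A\<close>, indexed by the integers, \<open>gr A\<close> consists of the
  families \<open>g\<close> with \<open>g k\<close> in \<open>F k / F (k - 1)\<close>, almost all zero (the zero coset being \<open>F (k - 1)\<close>).
\<close>

definition gr_piece :: "(complex, 'b) module \<Rightarrow> (int \<Rightarrow> 'b set) \<Rightarrow> int \<Rightarrow> (complex, 'b set) module" where
  "gr_piece A F k = \<lparr>carrier = {F (k - 1) +>\<^bsub>A\<^esub> a | a. a \<in> F k},
     mult = undefined, one = undefined, zero = F (k - 1), add = set_add A,
     smult = (\<lambda>c X. \<Union>x\<in>X. F (k - 1) +>\<^bsub>A\<^esub> c \<odot>\<^bsub>A\<^esub> x)\<rparr>"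

definition gr_support :: "(int \<Rightarrow> 'b set) \<Rightarrow> (int \<Rightarrow> 'b set) \<Rightarrow> int set" where
  "gr_support F g = {k. g k \<noteq> F (k - 1)}"

text \<open>
  The biadditive extension of the operation that sends the classes of \<open>a \<in> F i\<close> and \<open>b \<in> F j\<close> to the
  class of \<open>f a b\<close> in degree \<open>i + j - e\<close>. The union below is over representatives; it is a single
  coset whenever the operation is well defined.
\<close>

definition gr_operation :: "(complex, 'b) module \<Rightarrow> (int \<Rightarrow> 'b set) \<Rightarrow> int \<Rightarrow> ('b \<Rightarrow> 'b \<Rightarrow> 'b) \<Rightarrow>
    (int \<Rightarrow> 'b set) \<Rightarrow> (int \<Rightarrow> 'b set) \<Rightarrow> (int \<Rightarrow> 'b set)" where
  "gr_operation A F e f g h = (\<lambda>k. \<Oplus>\<^bsub>gr_piece A F k\<^esub>i\<in>gr_support F g.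
     (\<Union>a\<in>g i. \<Union>b\<in>h (k + e - i). F (k - 1) +>\<^bsub>A\<^esub> f a b))"

definition gr_class :: "(complex, 'b) module \<Rightarrow> (int \<Rightarrow> 'b set) \<Rightarrow> int \<Rightarrow> 'b \<Rightarrow> (int \<Rightarrow> 'b set)" where
  "gr_class A F k a = (\<lambda>j. if j = k then F (k - 1) +>\<^bsub>A\<^esub> a else F (j - 1))"

definition assoc_graded ::
    "(complex, 'b) module \<Rightarrow> (int \<Rightarrow> 'b set) \<Rightarrow> (complex, int \<Rightarrow> 'b set) module" where
  "assoc_graded A F =
     \<lparr>carrier = {g. (\<forall>k. g k \<in> carrier (gr_piece A F k)) \<and> finite (gr_support F g)},
      mult = gr_operation A F 0 (mult A),
      one = gr_class A F 0 \<one>\<^bsub>A\<^esub>,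
      zero = (\<lambda>k. F (k - 1)),
      add = (\<lambda>g h k. g k \<oplus>\<^bsub>gr_piece A F k\<^esub> h k),
      smult = (\<lambda>c g k. c \<odot>\<^bsub>gr_piece A F k\<^esub> g k)\<rparr>"

definition gr_component :: "(complex, 'b) module \<Rightarrow> (int \<Rightarrow> 'b set) \<Rightarrow> int \<Rightarrow> (int \<Rightarrow> 'b set) set" where
  "gr_component A F k = {gr_class A F k a | a. a \<in> F k}"

text \<open>The Poisson bracket of degree \<open>-1\<close> that the commutator induces on a commutative \<open>gr A\<close>.\<close>

definition gr_bracket :: "(complex, 'b) module \<Rightarrow> (int \<Rightarrow> 'b set) \<Rightarrow>
    (int \<Rightarrow> 'b set) \<Rightarrow> (int \<Rightarrow> 'b set) \<Rightarrow> (int \<Rightarrow> 'b set)" where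
  "gr_bracket A F = gr_operation A F 1 (commutator A)"


section \<open>Matrices\<close>

text \<open>
  \<open>Mat(n, \<complex>) \<otimes> V\<close>, realised as the space of \<open>n \<times> n\<close> matrices over \<open>V\<close>. A matrix is a function of
  two indices that vanishes unless both lie in \<open>{1..n}\<close>; \<open>E\<^sub>i\<^sub>j \<otimes> x\<close> is \<open>unit_matrix V i j x\<close>.
\<close>

definition matrix_space :: "nat \<Rightarrow> (complex, 'v) module \<Rightarrow> (complex, nat \<Rightarrow> nat \<Rightarrow> 'v) module" where
  "matrix_space n V =
     \<lparr>carrier = {M. (\<forall>i j. M i j \<in> carrier V) \<and>
                    (\<forall>i j. i \<notin> {1..n} \<or> j \<notin> {1..n} \<longrightarrow> M i j = \<zero>\<^bsub>V\<^esub>)},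
      mult = undefined, one = undefined,
      zero = (\<lambda>i j. \<zero>\<^bsub>V\<^esub>),
      add = (\<lambda>M M' i j. M i j \<oplus>\<^bsub>V\<^esub> M' i j),
      smult = (\<lambda>c M i j. c \<odot>\<^bsub>V\<^esub> M i j)\<rparr>"

definition unit_matrix :: "(complex, 'v) module \<Rightarrow> nat \<Rightarrow> nat \<Rightarrow> 'v \<Rightarrow> (nat \<Rightarrow> nat \<Rightarrow> 'v)" where
  "unit_matrix V i j x = (\<lambda>a b. if a = i \<and> b = j then x else \<zero>\<^bsub>V\<^esub>)"


section \<open>The algebra \<open>\<Omega>\<close> and the centralizer construction\<close>

text \<open>
  \<open>\<Omega>\<close> is the type \<open>'a\<close>; the class \<^class>\<open>ring\<close> does not require a unit. Scalar multiplication is \<open>scale\<close>.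
\<close>

locale countable_dim_algebra = vector_space scale
  for scale :: "complex \<Rightarrow> 'a::ring \<Rightarrow> 'a" +
  assumes scale_mult_left: "scale c x * y = scale c (x * y)"
    and scale_mult_right: "x * scale c y = scale c (x * y)"
    and countable_basis: "\<exists>B. countable B \<and> independent B \<and> span B = UNIV"

text \<open>The product of a nonempty list in a ring that need not have a unit.\<close>

definition list_product :: "'a::ring list \<Rightarrow> 'a" where
  "list_product xs = foldl (*) (hd xs) (tl xs)"

definition compositions :: "nat \<Rightarrow> nat list set" where
  "compositions m = {\<nu>. sum_list \<nu> = m \<and> 0 \<notin> set \<nu>}"

primrec coarsen :: "'a::ring list \<Rightarrow> nat list \<Rightarrow> 'a list" where
  "coarsen xs [] = []"
| "coarsen xs (n # \<nu>) = list_product (take n xs) # coarsen (drop n xs) \<nu>"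

context
  fixes scale :: "complex \<Rightarrow> 'a::ring \<Rightarrow> 'a"
begin

definition omega :: "(complex, 'a) module" where
  "omega = \<lparr>carrier = UNIV, mult = (*), one = undefined, zero = 0, add = (+), smult = scale\<rparr>"

subsection \<open>\<open>\<U>(gl(N, \<Omega>))\<close>\<close>

definition gl :: "nat \<Rightarrow> (complex, nat \<Rightarrow> nat \<Rightarrow> 'a) module" where
  "gl N = matrix_space N omega"

definition gl_bracket ::
    "nat \<Rightarrow> (nat \<Rightarrow> nat \<Rightarrow> 'a) \<Rightarrow> (nat \<Rightarrow> nat \<Rightarrow> 'a) \<Rightarrow> (nat \<Rightarrow> nat \<Rightarrow> 'a)" where
  "gl_bracket N M M' = (\<lambda>i j. (\<Sum>a=1..N. M i a * M' a j) - (\<Sum>a=1..N. M' i a * M a j))"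

definition U_gl :: "nat \<Rightarrow> (complex, ((nat \<Rightarrow> nat \<Rightarrow> 'a) list \<Rightarrow>\<^sub>0 complex) set) module" where
  "U_gl N = enveloping_algebra (gl N) (gl_bracket N)"

definition U_ideal :: "nat \<Rightarrow> ((nat \<Rightarrow> nat \<Rightarrow> 'a) list \<Rightarrow>\<^sub>0 complex) set" where
  "U_ideal N = enveloping_ideal (gl N) (gl_bracket N)"

definition E_elem :: "nat \<Rightarrow> nat \<Rightarrow> nat \<Rightarrow> 'a \<Rightarrow> ((nat \<Rightarrow> nat \<Rightarrow> 'a) list \<Rightarrow>\<^sub>0 complex) set" where
  "E_elem N i j x = U_ideal N +>\<^bsub>free_algebra (carrier (gl N))\<^esub> word [unit_matrix omega i j x]"

definition U_filtration :: "nat \<Rightarrow> int \<Rightarrow> ((nat \<Rightarrow> nat \<Rightarrow> 'a) list \<Rightarrow>\<^sub>0 complex) set set" where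
  "U_filtration N k = span_words (carrier (gl N)) (U_ideal N) (\<lambda>w. int (length w) \<le> k)"

text \<open>
  Action of \<open>C \<in> gl(N, \<complex>)\<close> on \<open>gl(N, \<Omega>)\<close> by \<open>ad \<otimes> Id\<close>, and its extension to the enveloping algebra by
  derivations. When \<open>\<Omega>\<close> has no unit, this is not an inner action.
\<close>

definition gl_ad :: "nat \<Rightarrow> (nat \<Rightarrow> nat \<Rightarrow> complex) \<Rightarrow> (nat \<Rightarrow> nat \<Rightarrow> 'a) \<Rightarrow> (nat \<Rightarrow> nat \<Rightarrow> 'a)" where
  "gl_ad N C M =
     (\<lambda>i j. (\<Sum>a=1..N. scale (C i a) (M a j)) - (\<Sum>a=1..N. scale (C a j) (M i a)))"

definition U_action :: "nat \<Rightarrow> (nat \<Rightarrow> nat \<Rightarrow> complex) \<Rightarrow>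
    ((nat \<Rightarrow> nat \<Rightarrow> 'a) list \<Rightarrow>\<^sub>0 complex) set \<Rightarrow> ((nat \<Rightarrow> nat \<Rightarrow> 'a) list \<Rightarrow>\<^sub>0 complex) set" where
  "U_action N C u = (\<Union>f\<in>u. U_ideal N +>\<^bsub>free_algebra (carrier (gl N))\<^esub> free_derivation (gl_ad N C) f)"

definition gl_sub :: "nat \<Rightarrow> nat \<Rightarrow> (nat \<Rightarrow> nat \<Rightarrow> complex) set" where
  "gl_sub d N = {C. \<forall>i j. C i j \<noteq> 0 \<longrightarrow> i \<in> {d+1..N} \<and> j \<in> {d+1..N}}"

definition A_term :: "nat \<Rightarrow> nat \<Rightarrow> ((nat \<Rightarrow> nat \<Rightarrow> 'a) list \<Rightarrow>\<^sub>0 complex) set set" where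
  "A_term d N = {u \<in> carrier (U_gl N). \<forall>C\<in>gl_sub d N. U_action N C u = \<zero>\<^bsub>U_gl N\<^esub>}"

subsection \<open>The projections\<close>

definition U_last_invariants :: "nat \<Rightarrow> ((nat \<Rightarrow> nat \<Rightarrow> 'a) list \<Rightarrow>\<^sub>0 complex) set set" where
  "U_last_invariants N =
     {u \<in> carrier (U_gl N). U_action N (\<lambda>i j. if i = N \<and> j = N then 1 else 0) u = \<zero>\<^bsub>U_gl N\<^esub>}"

definition I_plus :: "nat \<Rightarrow> ((nat \<Rightarrow> nat \<Rightarrow> 'a) list \<Rightarrow>\<^sub>0 complex) set set" where
  "I_plus N = left_ideal_generated (U_gl N) {E_elem N i N x | i x. i \<in> {1..N}}"

definition I_minus :: "nat \<Rightarrow> ((nat \<Rightarrow> nat \<Rightarrow> 'a) list \<Rightarrow>\<^sub>0 complex) set set" where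
  "I_minus N = right_ideal_generated (U_gl N) {E_elem N N j x | j x. j \<in> {1..N}}"

text \<open>
  Within \<^const>\<open>U_last_invariants\<close> the ideals \<^const>\<open>I_plus\<close> and \<^const>\<open>I_minus\<close> have the same trace,
  so either one may be dropped here.
\<close>

definition L_ideal :: "nat \<Rightarrow> ((nat \<Rightarrow> nat \<Rightarrow> 'a) list \<Rightarrow>\<^sub>0 complex) set set" where
  "L_ideal N = U_last_invariants N \<inter> I_plus N \<inter> I_minus N"

text \<open>
  The map \<open>\<U>(gl(N-1, \<Omega>)) \<rightarrow> \<U>(gl(N, \<Omega>))\<close> induced by the inclusion of Lie algebras, which on
  matrices padded with zeros is the identity.
\<close>

definition U_inclusion :: "nat \<Rightarrow> ((nat \<Rightarrow> nat \<Rightarrow> 'a) list \<Rightarrow>\<^sub>0 complex) set \<Rightarrow>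
    ((nat \<Rightarrow> nat \<Rightarrow> 'a) list \<Rightarrow>\<^sub>0 complex) set" where
  "U_inclusion N v = (\<Union>f\<in>v. U_ideal N +>\<^bsub>free_algebra (carrier (gl N))\<^esub> f)"

text \<open>
  The graph of the projection \<open>\<pi>\<^sub>N\<^sub>,\<^sub>N\<^sub>-\<^sub>1\<close> onto \<open>\<U>(gl(N-1, \<Omega>))\<close> along \<open>L(N)\<close>: \<open>v\<close> is the image of \<open>u\<close>.
\<close>

definition projects_to :: "nat \<Rightarrow> ((nat \<Rightarrow> nat \<Rightarrow> 'a) list \<Rightarrow>\<^sub>0 complex) set \<Rightarrow>
    ((nat \<Rightarrow> nat \<Rightarrow> 'a) list \<Rightarrow>\<^sub>0 complex) set \<Rightarrow> bool" where
  "projects_to N u v \<longleftrightarrow> u \<in> U_last_invariants N \<and> v \<in> carrier (U_gl (N - 1)) \<and>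
     u \<ominus>\<^bsub>U_gl N\<^esub> U_inclusion N v \<in> L_ideal N"

subsection \<open>\<open>A\<^sub>d(\<Omega>)\<close> and \<open>Y\<^sub>d(\<Omega>)\<close>\<close>

text \<open>The sequences are indexed by \<open>N \<ge> d\<close> and have the value \<^const>\<open>undefined\<close> below \<open>d\<close>.\<close>

definition A_algebra ::
    "nat \<Rightarrow> (complex, nat \<Rightarrow> ((nat \<Rightarrow> nat \<Rightarrow> 'a) list \<Rightarrow>\<^sub>0 complex) set) module" where
  "A_algebra d =
     \<lparr>carrier = {a \<in> (\<Pi>\<^sub>E N\<in>{d..}. A_term d N).
        (\<forall>N>d. projects_to N (a N) (a (N - 1))) \<and> (\<exists>k. \<forall>N\<ge>d. a N \<in> U_filtration N k)},
      mult = (\<lambda>a b. \<lambda>N\<in>{d..}. a N \<otimes>\<^bsub>U_gl N\<^esub> b N),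
      one = (\<lambda>N\<in>{d..}. \<one>\<^bsub>U_gl N\<^esub>),
      zero = (\<lambda>N\<in>{d..}. \<zero>\<^bsub>U_gl N\<^esub>),
      add = (\<lambda>a b. \<lambda>N\<in>{d..}. a N \<oplus>\<^bsub>U_gl N\<^esub> b N),
      smult = (\<lambda>c a. \<lambda>N\<in>{d..}. c \<odot>\<^bsub>U_gl N\<^esub> a N)\<rparr>"

definition A_filtration ::
    "nat \<Rightarrow> int \<Rightarrow> (nat \<Rightarrow> ((nat \<Rightarrow> nat \<Rightarrow> 'a) list \<Rightarrow>\<^sub>0 complex) set) set" where
  "A_filtration d k = {a \<in> carrier (A_algebra d). \<forall>N\<ge>d. a N \<in> U_filtration N k}"

text \<open>The value at the empty list is irrelevant, as \<open>W(\<Omega>)\<close> consists of nonempty words.\<close>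

fun e_elem :: "nat \<Rightarrow> nat \<Rightarrow> nat \<Rightarrow> 'a list \<Rightarrow> ((nat \<Rightarrow> nat \<Rightarrow> 'a) list \<Rightarrow>\<^sub>0 complex) set" where
  "e_elem N i j [] = \<zero>\<^bsub>U_gl N\<^esub>"
| "e_elem N i j [x] = E_elem N i j x"
| "e_elem N i j (x # y # xs) = (\<Oplus>\<^bsub>U_gl N\<^esub>a\<in>{1..N}. E_elem N i a x \<otimes>\<^bsub>U_gl N\<^esub> e_elem N a j (y # xs))"

definition t_term :: "nat \<Rightarrow> complex \<Rightarrow> nat \<Rightarrow> nat \<Rightarrow> 'a list \<Rightarrow>
    ((nat \<Rightarrow> nat \<Rightarrow> 'a) list \<Rightarrow>\<^sub>0 complex) set" where
  "t_term N s i j xs = (\<Oplus>\<^bsub>U_gl N\<^esub>\<nu>\<in>compositions (length xs).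
     ((- of_nat N - s) ^ (length xs - length (coarsen xs \<nu>))) \<odot>\<^bsub>U_gl N\<^esub> e_elem N i j (coarsen xs \<nu>))"

definition t_elem :: "nat \<Rightarrow> complex \<Rightarrow> nat \<Rightarrow> nat \<Rightarrow> 'a list \<Rightarrow>
    (nat \<Rightarrow> ((nat \<Rightarrow> nat \<Rightarrow> 'a) list \<Rightarrow>\<^sub>0 complex) set)" where
  "t_elem d s i j xs = (\<lambda>N\<in>{d..}. t_term N s i j xs)"

text \<open>As a subset of \<^const>\<open>A_algebra\<close> this does not depend on \<open>s\<close>.\<close>

definition Y_algebra :: "nat \<Rightarrow> complex \<Rightarrow>
    (complex, nat \<Rightarrow> ((nat \<Rightarrow> nat \<Rightarrow> 'a) list \<Rightarrow>\<^sub>0 complex) set) module" where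
  "Y_algebra d s = (A_algebra d)\<lparr>carrier := subalgebra_generated (A_algebra d)
     {t_elem d s i j xs | i j xs. i \<in> {1..d} \<and> j \<in> {1..d} \<and> xs \<noteq> []}\<rparr>"

definition Y_filtration :: "nat \<Rightarrow> complex \<Rightarrow> int \<Rightarrow>
    (nat \<Rightarrow> ((nat \<Rightarrow> nat \<Rightarrow> 'a) list \<Rightarrow>\<^sub>0 complex) set) set" where
  "Y_filtration d s k = carrier (Y_algebra d s) \<inter> A_filtration d k"

subsection \<open>\<open>\<S>(M\<^sub>d(\<Omega>))\<close>\<close>

definition T_plus :: "(complex, ('a list \<Rightarrow>\<^sub>0 complex) set) module" where
  "T_plus = (tensor_algebra omega)\<lparr>carrier := span_words UNIV (tensor_ideal omega) (\<lambda>w. w \<noteq> [])\<rparr>"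

definition T_component :: "nat \<Rightarrow> ('a list \<Rightarrow>\<^sub>0 complex) set set" where
  "T_component m = span_words UNIV (tensor_ideal omega) (\<lambda>w. length w = m)"

definition tensor :: "'a list \<Rightarrow> ('a list \<Rightarrow>\<^sub>0 complex) set" where
  "tensor xs = tensor_ideal omega +>\<^bsub>free_algebra UNIV\<^esub> word xs"

definition M_space :: "nat \<Rightarrow> (complex, nat \<Rightarrow> nat \<Rightarrow> ('a list \<Rightarrow>\<^sub>0 complex) set) module" where
  "M_space d = matrix_space d T_plus"

definition S_algebra :: "nat \<Rightarrow>
    (complex, ((nat \<Rightarrow> nat \<Rightarrow> ('a list \<Rightarrow>\<^sub>0 complex) set) list \<Rightarrow>\<^sub>0 complex) set) module" where
  "S_algebra d = symmetric_algebra (M_space d)"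

text \<open>
  The grading of \<open>\<S>(M\<^sub>d(\<Omega>))\<close> by tensor degree: degree \<open>k\<close> is spanned by the products of homogeneous
  elements of \<open>M\<^sub>d(\<Omega>)\<close> of degrees \<open>ms\<close> with sum \<open>k\<close>.
\<close>

definition S_component :: "nat \<Rightarrow> int \<Rightarrow>
    ((nat \<Rightarrow> nat \<Rightarrow> ('a list \<Rightarrow>\<^sub>0 complex) set) list \<Rightarrow>\<^sub>0 complex) set set" where
  "S_component d k = span_words (carrier (M_space d)) (symmetric_ideal (M_space d))
     (\<lambda>w. \<exists>ms. list_all2 (\<lambda>M m. m \<ge> 1 \<and> (\<forall>i j. M i j \<in> T_component m)) w ms \<and>
               int (sum_list ms) = k)"

text \<open>
  \<open>p_elem d i j xs\<close> is \<open>p\<^sub>i\<^sub>j(x\<^sub>1 \<otimes> \<dots> \<otimes> x\<^sub>m)\<close> for \<open>xs = [x\<^sub>1, \<dots>, x\<^sub>m]\<close>; the empty list stands for the unit of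
  \<open>T(\<Omega>)\<close>.
\<close>

definition p_elem :: "nat \<Rightarrow> nat \<Rightarrow> nat \<Rightarrow> 'a list \<Rightarrow>
    ((nat \<Rightarrow> nat \<Rightarrow> ('a list \<Rightarrow>\<^sub>0 complex) set) list \<Rightarrow>\<^sub>0 complex) set" where
  "p_elem d i j xs =
     (if xs = [] then if i = j then \<one>\<^bsub>S_algebra d\<^esub> else \<zero>\<^bsub>S_algebra d\<^esub>
      else symmetric_ideal (M_space d) +>\<^bsub>free_algebra (carrier (M_space d))\<^esub>
             word [unit_matrix T_plus i j (tensor xs)])"

text \<open>
  In terms of lists, \<open>x\<^sup><\<^sup>r = take (r - 1) xs\<close>, \<open>x\<^sub>r = xs ! (r - 1)\<close> and \<open>x\<^sup>>\<^sup>r = drop r xs\<close>.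
\<close>

definition bracket_formula :: "nat \<Rightarrow> nat \<Rightarrow> nat \<Rightarrow> nat \<Rightarrow> nat \<Rightarrow> 'a list \<Rightarrow> 'a list \<Rightarrow>
    ((nat \<Rightarrow> nat \<Rightarrow> ('a list \<Rightarrow>\<^sub>0 complex) set) list \<Rightarrow>\<^sub>0 complex) set" where
  "bracket_formula d i j k l xs ys =
     (\<Oplus>\<^bsub>S_algebra d\<^esub>r\<in>{1..length xs}. \<Oplus>\<^bsub>S_algebra d\<^esub>q\<in>{1..length ys}.
        p_elem d k j (take (q - 1) ys @ drop r xs) \<otimes>\<^bsub>S_algebra d\<^esub>
        p_elem d i l (take (r - 1) xs @ [xs ! (r - 1) * ys ! (q - 1)] @ drop q ys)) \<ominus>\<^bsub>S_algebra d\<^esub>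
     (\<Oplus>\<^bsub>S_algebra d\<^esub>r\<in>{1..length xs}. \<Oplus>\<^bsub>S_algebra d\<^esub>q\<in>{1..length ys}.
        p_elem d k j (take (q - 1) ys @ [ys ! (q - 1) * xs ! (r - 1)] @ drop r xs) \<otimes>\<^bsub>S_algebra d\<^esub>
        p_elem d i l (take (r - 1) xs @ drop q ys))"

definition satisfies_bracket_formula :: "nat \<Rightarrow>
    (((nat \<Rightarrow> nat \<Rightarrow> ('a list \<Rightarrow>\<^sub>0 complex) set) list \<Rightarrow>\<^sub>0 complex) set \<Rightarrow>
     ((nat \<Rightarrow> nat \<Rightarrow> ('a list \<Rightarrow>\<^sub>0 complex) set) list \<Rightarrow>\<^sub>0 complex) set \<Rightarrow>
     ((nat \<Rightarrow> nat \<Rightarrow> ('a list \<Rightarrow>\<^sub>0 complex) set) list \<Rightarrow>\<^sub>0 complex) set) \<Rightarrow> bool" where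
  "satisfies_bracket_formula d B \<longleftrightarrow>
     (\<forall>i\<in>{1..d}. \<forall>j\<in>{1..d}. \<forall>k\<in>{1..d}. \<forall>l\<in>{1..d}. \<forall>xs ys. xs \<noteq> [] \<and> ys \<noteq> [] \<longrightarrow>
        B (p_elem d i j xs) (p_elem d k l ys) = bracket_formula d i j k l xs ys)"

end

end

theory Submission
  imports Defs
begin

text \<open>
  In the enveloping algebra the commutator of \<open>e\<^sub>i\<^sub>j(x)\<close> and \<open>e\<^sub>k\<^sub>l(y)\<close> is expanded by the Leibniz rule into
  commutators of matrix units. Modulo lower filtration degree the factors may be reordered, and the
  remaining strings of matrix units can be joined along their inner summation indices; this yields
  the right-hand side of the bracket formula for the elements \<open>e\<^sub>i\<^sub>j\<close>. Since \<open>t\<^sub>i\<^sub>j(x)\<close> and \<open>e\<^sub>i\<^sub>j(x)\<close> differ by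
  terms of lower degree, the formula holds for the classes of the \<open>t\<^sub>i\<^sub>j\<close>. The bracket induced by a
  commutator is a Poisson bracket, and two Poisson brackets that agree on algebra generators coincide.

  The classes of the \<open>t\<^sub>i\<^sub>j\<close> are meaningful only because the \<open>t\<^sub>i\<^sub>j\<close> lie in \<open>A\<^sub>d(\<Omega>)\<close>, that is, because they are
  compatible with the projections. Modulo \<open>I\<^sup>+(N)\<close> one has \<open>E\<^sub>i\<^sub>N(x) t\<^sub>N\<^sub>j(y\<^sub>1, y\<^sub>2, \<dots>) = t\<^sub>i\<^sub>j(x y\<^sub>1, y\<^sub>2, \<dots>)\<close>, so
  in the recursion for \<open>t\<^sub>i\<^sub>j\<close> the summand with inner index \<open>N\<close> raises the parameter \<open>-N-s\<close> by one, which
  is the passage from \<open>N\<close> to \<open>N-1\<close>; the same holds modulo \<open>I\<^sup>-(N)\<close>. All computations are carried out in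
  the free algebra, modulo the defining ideal.
\<close>

subsection \<open>Free algebras and their quotients\<close>

text \<open>The given \<open>\<phi>\<close> absorbs every question of independence: each estimate
  below is an upper bound on a degree or a membership in an ideal. Nor is the Poisson bracket built
  from the formula. The commutator bracket is transported along \<open>\<phi>\<close>, so the Jacobi
  identity comes from associativity and only the values on generators are computed. Two families of
  lifts are in play because their virtues differ. The \<open>e_poly\<close> are multiplicative under
  concatenation and suit commutators, but in general they are not compatible with the projections;
  the \<open>t_poly\<close> are compatible, but mix degrees. Compatibility must also survive
  products. I+(N) is defined as a left ideal and I-(N) as a right ideal, and the missing side is
  supplied by multiplication with elements of the enveloping algebra of gl(N-1, \<Omega>) only; this
  suffices because a projection has its values there. Every product in the formula has total length
  m + n - 1, since x_r and y_q merge, so errors of degree m + n - 2 are invisible. Its factors may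
  be empty words, which is why the lifts are Kronecker deltas at the empty list.\<close>

abbreviation scal :: "complex \<Rightarrow> ('x list \<Rightarrow>\<^sub>0 complex)" where
  "scal \<equiv> Poly_Mapping.single []"

text \<open>Scalars are treated as multiples of the empty word: scalar multiplication becomes ring
  multiplication, and the laws of rings apply to it.\<close>

lemma map_times_conv_mult:
  "Poly_Mapping.map ((*) c) f = scal c * (f :: 'x list \<Rightarrow>\<^sub>0 complex)"
  using mult_map_scale_conv_mult[of c f] by (simp add: zero_list_def)

lemma word_mult: "word u * word v = word (u @ v)"
  by (simp add: word_def mult_single plus_list_def)

lemma word_Nil: "word [] = 1"
  by (simp add: word_def zero_list_def[symmetric])

lemma single_eq_word: "Poly_Mapping.single w c = scal c * word w"
  by (simp add: word_def mult_single plus_list_def)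

lemma poly_mapping_eq_sum_words:
  "f = (\<Sum>w\<in>Poly_Mapping.keys f. scal (Poly_Mapping.lookup f w) * word w)"
proof -
  have "f = (\<Sum>w\<in>Poly_Mapping.keys f. Poly_Mapping.single w (Poly_Mapping.lookup f w))"
    by (rule poly_mapping_eqI)
       (auto simp: lookup_sum lookup_single when_def sum.delta in_keys_iff)
  then show ?thesis by (simp add: single_eq_word[symmetric])
qed

lemma scal_commute:
  "f * scal c = scal c * (f :: 'x list \<Rightarrow>\<^sub>0 complex)"
proof -
  have "scal a * word w * scal c =
      scal c * (scal a * word w)" for a and w :: "'x list"
    by (simp add: word_def mult_single plus_list_def mult.commute)
  then have "(\<Sum>w\<in>A. scal (r w) * word w) * scal c =
      scal c * (\<Sum>w\<in>A. scal (r w) * word w)"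
    for A and r :: "'x list \<Rightarrow> complex"
    by (simp only: sum_distrib_left sum_distrib_right)
  from this[of "Poly_Mapping.lookup f" "Poly_Mapping.keys f"] show ?thesis
    by (simp only: poly_mapping_eq_sum_words[of f, symmetric])
qed

lemma mult_scal_left:
  "f * (scal c * g) = scal c * (f * (g :: 'x list \<Rightarrow>\<^sub>0 complex))"
  by (metis mult.assoc scal_commute)

text \<open>Only the left factor is expanded; the right one is reached by exchanging the factors and
  changing the sign.\<close>

lemma commutator_sum_words:
  fixes f g :: "'x list \<Rightarrow>\<^sub>0 complex"
  shows "f * g - g * f = (\<Sum>w\<in>Poly_Mapping.keys f.
    scal (Poly_Mapping.lookup f w) * (word w * g - g * word w))"
proof -
  have "(\<Sum>w\<in>A. scal (r w) * word w) * g - g * (\<Sum>w\<in>A. scal (r w) * word w) =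
      (\<Sum>w\<in>A. scal (r w) * (word w * g - g * word w))" for A and r :: "'x list \<Rightarrow> complex"
    by (simp add: sum_distrib_left sum_distrib_right sum_subtractf mult_scal_left right_diff_distrib mult.assoc)
  from this[of "Poly_Mapping.lookup f" "Poly_Mapping.keys f"] show ?thesis
    by (simp only: poly_mapping_eq_sum_words[of f, symmetric])
qed

lemma scal_one: "scal 1 = (1 :: 'x list \<Rightarrow>\<^sub>0 complex)"
  by (simp add: zero_list_def[symmetric])

lemma scal_times:
  "scal (c * a) = (scal c * scal a :: 'x list \<Rightarrow>\<^sub>0 complex)"
  by (simp add: mult_single plus_list_def)

lemma lookup_scal_mult:
  "Poly_Mapping.lookup (scal c * f) w = c * Poly_Mapping.lookup (f :: 'x list \<Rightarrow>\<^sub>0 complex) w"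
  by (simp add: map_times_conv_mult[symmetric] map.rep_eq when_def)

lemma scal_add_one: "scal (c + 1) * f = scal c * f + (f :: 'x list \<Rightarrow>\<^sub>0 complex)"
  by (simp add: single_add scal_one distrib_right)

lemma scal_minus_one: "scal (- 1) * f = - (f :: 'x list \<Rightarrow>\<^sub>0 complex)"
  by (simp add: single_uminus scal_one)

lemma sum_delta_left:
  fixes f :: "nat \<Rightarrow> 'r::ring_1"
  shows "i \<in> {1..N} \<Longrightarrow> (\<Sum>a=1..N. (if i = a then 1 else 0) * f a) = f i"
    "i \<in> {1..N} \<Longrightarrow> (\<Sum>a=1..N. f a * (if a = i then 1 else 0)) = f i"
  by (simp_all add: if_distrib[of "\<lambda>x. x * _"] if_distrib[of "\<lambda>x. _ * x"] sum.delta cong: if_cong)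

lemma sum_split_last: "1 \<le> N \<Longrightarrow> sum f {1..N} = sum f {1..N - 1} + (f (N::nat) :: 'b::comm_monoid_add)"
  by (cases N) (auto simp: add.commute)

lemma sum_lessThan_add:
  fixes f :: "nat \<Rightarrow> 'b::comm_monoid_add"
  shows "(\<Sum>k<m + n. f k) = (\<Sum>k<m. f k) + (\<Sum>k<n. f (m + k))"
  by (induction n) (simp_all add: add.assoc)

text \<open>Used with \<open>s\<close> the scalar c + 1 and \<open>u\<close> equal to c times
  \<open>t\<close>. The single \<open>t\<close> subtracted from \<open>B\<close> is the one by which
  (c + 1) t exceeds c t.\<close>

lemma regroup_stable:
  fixes A B C C' s t :: "'r::ring"
  assumes "s * t = u + t"
  shows "(A - A') + (B - t) + (s * t - s * t') = A + B + u - (A' + s * t')"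
  by (simp add: assms algebra_simps)

lemma keys_times_subset_lists:
  assumes "Poly_Mapping.keys f \<subseteq> lists X" "Poly_Mapping.keys g \<subseteq> lists X"
  shows "Poly_Mapping.keys (f * g :: 'x list \<Rightarrow>\<^sub>0 complex) \<subseteq> lists X"
  using keys_mult[of f g] assms by (fastforce simp: plus_list_def)

lemma carrier_free_algebra: "carrier (free_algebra X) = {f. Poly_Mapping.keys f \<subseteq> lists X}"
  by (simp add: free_algebra_def)

lemma free_algebra_simps:
  "mult (free_algebra X) = (*)" "one (free_algebra X) = 1"
  "zero (free_algebra X) = 0" "add (free_algebra X) = (+)"
  "smult (free_algebra X) c f = scal c * f"
  by (simp_all add: free_algebra_def map_times_conv_mult)

lemma free_carrier_closed [simp, intro]:
  "0 \<in> carrier (free_algebra X)" "1 \<in> carrier (free_algebra X)"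
  "f \<in> carrier (free_algebra X) \<Longrightarrow> g \<in> carrier (free_algebra X) \<Longrightarrow> f + g \<in> carrier (free_algebra X)"
  "f \<in> carrier (free_algebra X) \<Longrightarrow> g \<in> carrier (free_algebra X) \<Longrightarrow> f - g \<in> carrier (free_algebra X)"
  "f \<in> carrier (free_algebra X) \<Longrightarrow> g \<in> carrier (free_algebra X) \<Longrightarrow> f * g \<in> carrier (free_algebra X)"
  "f \<in> carrier (free_algebra X) \<Longrightarrow> - f \<in> carrier (free_algebra X)"
  "scal c \<in> carrier (free_algebra X)"
  using keys_add[of f g] keys_diff[of f g] keys_times_subset_lists[of f X g]
  by (auto simp: carrier_free_algebra zero_list_def)

lemma word_in_carrier [simp]: "word w \<in> carrier (free_algebra X) \<longleftrightarrow> set w \<subseteq> X"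
  by (auto simp: carrier_free_algebra word_def)

lemma sum_in_carrier [intro]:
  "(\<And>i. i \<in> A \<Longrightarrow> f i \<in> carrier (free_algebra X)) \<Longrightarrow> sum f A \<in> carrier (free_algebra X)"
  by (induction A rule: infinite_finite_induct) auto

lemma free_carrier_mono:
  "X \<subseteq> Y \<Longrightarrow> f \<in> carrier (free_algebra X) \<Longrightarrow> f \<in> carrier (free_algebra Y)"
  by (auto simp: carrier_free_algebra)

lemma ring_free_algebra: "ring (free_algebra X)"
proof (rule ringI)
  show "abelian_group (free_algebra X)"
    by (rule abelian_groupI)
       (auto simp: free_algebra_simps algebra_simps intro: bexI[of _ "- x" for x])
  show "Group.monoid (free_algebra X)"
    by (rule monoidI) (auto simp: free_algebra_simps algebra_simps)
qed (auto simp: free_algebra_simps algebra_simps)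

lemma free_algebra_a_inv:
  assumes "f \<in> carrier (free_algebra X)"
  shows "\<ominus>\<^bsub>free_algebra X\<^esub> f = - f"
proof -
  interpret ring "free_algebra X" by (rule ring_free_algebra)
  show ?thesis
    using assms by (intro minus_equality) (auto simp: free_algebra_simps)
qed

lemma free_words_induct [consumes 1, case_names word add smult]:
  assumes f: "f \<in> carrier (free_algebra X)"
    and word: "\<And>w. set w \<subseteq> X \<Longrightarrow> P (word w)"
    and add: "\<And>f g. f \<in> carrier (free_algebra X) \<Longrightarrow> g \<in> carrier (free_algebra X) \<Longrightarrow>
      P f \<Longrightarrow> P g \<Longrightarrow> P (f + g)"
    and smult: "\<And>c f. f \<in> carrier (free_algebra X) \<Longrightarrow> P f \<Longrightarrow> P (scal c * f)"
  shows "P f"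
proof -
  have P0: "P 0"
    using smult[of "word []" 0] word[of "[]"] by simp
  have "P (\<Sum>w\<in>A. scal (Poly_Mapping.lookup f w) * word w)"
    if "finite A" "A \<subseteq> Poly_Mapping.keys f" for A
    using that
  proof (induction A rule: finite_induct)
    case empty
    then show ?case using P0 by simp
  next
    case (insert w A)
    have "set w \<subseteq> X" "\<And>v. v \<in> A \<Longrightarrow> set v \<subseteq> X"
      using insert f by (auto simp: carrier_free_algebra)
    with insert show ?case
      by (auto intro!: add smult word sum_in_carrier)
  qed
  from this[OF finite_keys subset_refl] show ?thesis
    by (subst poly_mapping_eq_sum_words)
qed

text \<open>Covers the enveloping, tensor and symmetric algebras at once. Elements of the quotient
  are written \<open>cls f\<close>, and equalities in it become memberships of \<open>f - g\<close>
  in \<open>I\<close>.\<close>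

locale free_quotient =
  fixes X :: "'x set" and I :: "('x list \<Rightarrow>\<^sub>0 complex) set"
  assumes ideal_I: "ideal I (free_algebra X)"
begin

abbreviation "C \<equiv> carrier (free_algebra X)"
abbreviation "Q \<equiv> quotient_algebra (free_algebra X) I"

definition cls :: "('x list \<Rightarrow>\<^sub>0 complex) \<Rightarrow> ('x list \<Rightarrow>\<^sub>0 complex) set" where
  "cls f = I +>\<^bsub>free_algebra X\<^esub> f"

lemma I_subset: "f \<in> I \<Longrightarrow> f \<in> C"
  using ideal.Icarr[OF ideal_I] .

lemma I_zero [simp, intro]: "0 \<in> I"
  using additive_subgroup.zero_closed[OF ideal.axioms(1)[OF ideal_I]] by (simp add: free_algebra_simps)

lemma I_add [intro]: "f \<in> I \<Longrightarrow> g \<in> I \<Longrightarrow> f + g \<in> I"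
  using additive_subgroup.a_closed[OF ideal.axioms(1)[OF ideal_I]] by (simp add: free_algebra_simps)

lemma I_lmult [intro]: "f \<in> I \<Longrightarrow> a \<in> C \<Longrightarrow> a * f \<in> I"
  using ideal.I_l_closed[OF ideal_I] by (simp add: free_algebra_simps)

lemma I_rmult [intro]: "f \<in> I \<Longrightarrow> a \<in> C \<Longrightarrow> f * a \<in> I"
  using ideal.I_r_closed[OF ideal_I] by (simp add: free_algebra_simps)

lemma I_minus [intro]: "f \<in> I \<Longrightarrow> - f \<in> I"
  using I_lmult[of f "- 1"] by auto

lemma I_diff [intro]: "f \<in> I \<Longrightarrow> g \<in> I \<Longrightarrow> f - g \<in> I"
  using I_add[of f "- g"] by auto

lemma I_sum [intro]: "(\<And>i. i \<in> A \<Longrightarrow> f i \<in> I) \<Longrightarrow> sum f A \<in> I"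
  by (induction A rule: infinite_finite_induct) auto

lemma I_trans: "f - g \<in> I \<Longrightarrow> g - h \<in> I \<Longrightarrow> f - h \<in> I"
  using I_add[of "f - g" "g - h"] by simp

lemma I_sum_diff: "(\<And>i. i \<in> A \<Longrightarrow> f i - g i \<in> I) \<Longrightarrow> sum f A - sum g A \<in> I"
  by (simp add: sum_subtractf[symmetric] I_sum)

lemma I_mult_diff:
  assumes "f - f' \<in> I" "g - g' \<in> I" "f \<in> C" "g' \<in> C"
  shows "f * g - f' * g' \<in> I"
proof -
  have "f * g - f' * g' = f * (g - g') + (f - f') * g'"
    by (simp add: algebra_simps)
  then show ?thesis using assms by auto
qed

lemma cls_conv: "cls f = {g. g - f \<in> I}"
proof -
  have "g \<in> (\<lambda>h. h + f) ` I \<longleftrightarrow> g - f \<in> I" for g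
    by (auto intro: image_eqI[of _ _ "g - f"])
  then show ?thesis
    by (auto simp: cls_def a_r_coset_def' free_algebra_simps)
qed

lemma cls_self: "f \<in> cls f"
  by (simp add: cls_conv)

lemma cls_eq_iff: "cls f = cls g \<longleftrightarrow> f - g \<in> I"
proof
  assume "cls f = cls g"
  then have "f \<in> cls g" using cls_self by blast
  then show "f - g \<in> I" by (simp add: cls_conv)
next
  assume fg: "f - g \<in> I"
  have "h - f \<in> I \<longleftrightarrow> h - g \<in> I" for h
    using I_add[OF _ fg, of "h - f"] I_diff[OF _ fg, of "h - g"] by auto
  then show "cls f = cls g" by (simp add: cls_conv)
qed

lemma cls_zero: "cls 0 = I"
  by (simp add: cls_conv)

lemma Q_simps:
  "carrier Q = cls ` C" "one Q = cls 1" "zero Q = cls 0"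
  "mult Q = rcoset_mult (free_algebra X) I" "add Q = set_add (free_algebra X)"
  "smult Q = (\<lambda>c A. \<Union>x\<in>A. cls (scal c * x))"
  by (auto simp: quotient_algebra_def ring.defs module.defs FactRing_def A_RCOSETS_def' cls_def
      free_algebra_simps cls_zero[unfolded cls_def] a_r_coset_def')

lemma Q_mult [simp]: "f \<in> C \<Longrightarrow> g \<in> C \<Longrightarrow> cls f \<otimes>\<^bsub>Q\<^esub> cls g = cls (f * g)"
  using ideal.rcoset_mult_add[OF ideal_I, of f g] by (simp add: Q_simps cls_def free_algebra_simps)

lemma Q_add [simp]: "cls f \<oplus>\<^bsub>Q\<^esub> cls g = cls (f + g)"
proof -
  have "(\<exists>f'. f' - f \<in> I \<and> (\<exists>g'. g' - g \<in> I \<and> h = f' + g')) \<longleftrightarrow> h - (f + g) \<in> I" for h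
  proof
    assume *: "h - (f + g) \<in> I"
    have "h = (h - g) + g" "(h - g) - f \<in> I" using * by (auto simp: algebra_simps)
    then show "\<exists>f'. f' - f \<in> I \<and> (\<exists>g'. g' - g \<in> I \<and> h = f' + g')"
      using I_zero by (metis diff_self)
  next
    assume "\<exists>f'. f' - f \<in> I \<and> (\<exists>g'. g' - g \<in> I \<and> h = f' + g')"
    then obtain f' g' where "f' - f \<in> I" "g' - g \<in> I" "h = f' + g'" by blast
    then show "h - (f + g) \<in> I"
      using I_add[of "f' - f" "g' - g"] by (simp add: algebra_simps)
  qed
  then show ?thesis
    by (simp add: Q_simps set_add_def set_mult_def cls_conv free_algebra_simps set_eq_iff Bex_def)
qed

lemma Q_smult [simp]: "c \<odot>\<^bsub>Q\<^esub> cls f = cls (scal c * f)"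
proof -
  have "cls (scal c * g) = cls (scal c * f)" if "g \<in> cls f" for g
    using that I_lmult[of "g - f" "scal c"]
    by (simp add: cls_eq_iff cls_conv[of f] right_diff_distrib)
  then have "(\<Union>g\<in>cls f. cls (scal c * g)) = cls (scal c * f)"
    using cls_self[of f] by blast
  then show ?thesis by (simp add: Q_simps)
qed

lemma Q_zero: "\<zero>\<^bsub>Q\<^esub> = cls 0" and Q_one: "\<one>\<^bsub>Q\<^esub> = cls 1"
  by (simp_all add: Q_simps)

lemma cls_in_Q [simp, intro]: "f \<in> C \<Longrightarrow> cls f \<in> carrier Q"
  by (simp add: Q_simps)

lemma Q_cases: 
  assumes "u \<in> carrier Q"
  obtains f where "f \<in> C" "u = cls f"
  using assms by (auto simp: Q_simps)

lemma ring_Q: "ring Q"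
proof (rule ringI)
  show "abelian_group Q"
  proof (rule abelian_groupI)
    fix x assume "x \<in> carrier Q"
    then obtain f where "f \<in> C" "x = cls f" by (rule Q_cases)
    then show "\<exists>y\<in>carrier Q. y \<oplus>\<^bsub>Q\<^esub> x = \<zero>\<^bsub>Q\<^esub>"
      by (intro bexI[of _ "cls (- f)"]) (auto simp: Q_zero)
  qed (auto elim!: Q_cases simp: Q_zero algebra_simps)
  show "Group.monoid Q"
    by (rule monoidI) (auto elim!: Q_cases simp: Q_one algebra_simps)
qed (auto elim!: Q_cases simp: algebra_simps)

lemma Q_uminus [simp]: "f \<in> C \<Longrightarrow> \<ominus>\<^bsub>Q\<^esub> cls f = cls (- f)"
proof -
  interpret ring Q by (rule ring_Q)
  assume "f \<in> C"
  then show ?thesis by (intro minus_equality) (auto simp: Q_zero)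
qed

lemma Q_minus [simp]: "f \<in> C \<Longrightarrow> g \<in> C \<Longrightarrow> cls f \<ominus>\<^bsub>Q\<^esub> cls g = cls (f - g)"
  by (simp add: a_minus_def)

lemma Q_smult_closed [intro]: "u \<in> carrier Q \<Longrightarrow> c \<odot>\<^bsub>Q\<^esub> u \<in> carrier Q"
  by (auto elim!: Q_cases)

lemma Q_finsum:
  assumes "finite A" "\<And>i. i \<in> A \<Longrightarrow> f i \<in> C"
  shows "(\<Oplus>\<^bsub>Q\<^esub>i\<in>A. cls (f i)) = cls (sum f A)"
proof -
  interpret ring Q by (rule ring_Q)
  show ?thesis
    using assms
  proof (induction A rule: finite_induct)
    case (insert i A)
    then have "(\<Oplus>\<^bsub>Q\<^esub>i\<in>insert i A. cls (f i)) = cls (f i) \<oplus>\<^bsub>Q\<^esub> (\<Oplus>\<^bsub>Q\<^esub>i\<in>A. cls (f i))"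
      by (intro finsum_insert) auto
    also have "\<dots> = cls (sum f (insert i A))" using insert by simp
    finally show ?case .
  qed (simp add: Q_zero)
qed

end

lemma genideal_generators: 
  assumes "S \<subseteq> carrier (free_algebra X)" "x \<in> S"
  shows "x \<in> genideal (free_algebra X) S"
  using ring.genideal_self[OF ring_free_algebra assms(1)] assms(2) by blast

text \<open>Closure under negation comes from multiplication by \<open>- 1\<close>, which lies in
  every free algebra.\<close>

lemma ideal_free_algebraI:
  assumes "I \<subseteq> carrier (free_algebra X)" "0 \<in> I" 
    and "\<And>f g. f \<in> I \<Longrightarrow> g \<in> I \<Longrightarrow> f + g \<in> I"
    and "\<And>a f. a \<in> carrier (free_algebra X) \<Longrightarrow> f \<in> I \<Longrightarrow> a * f \<in> I"
    and "\<And>a f. a \<in> carrier (free_algebra X) \<Longrightarrow> f \<in> I \<Longrightarrow> f * a \<in> I"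
  shows "ideal I (free_algebra X)"
proof (rule idealI[OF ring_free_algebra])
  interpret R: ring "free_algebra X" by (rule ring_free_algebra)
  show "subgroup I (add_monoid (free_algebra X))"
  proof (rule R.add.subgroupI)
    fix a assume a: "a \<in> I"
    with assms(4)[of "- 1" a] have "- a \<in> I" by auto
    with a assms(1) show "\<ominus>\<^bsub>free_algebra X\<^esub> a \<in> I" by (subst free_algebra_a_inv) auto
  qed (use assms in \<open>auto simp: free_algebra_simps\<close>)
qed (use assms in \<open>auto simp: free_algebra_simps\<close>)

text \<open>Serves as induction over the generated ideal: \<open>J\<close> is chosen as the set of
  elements with the desired property.\<close>

lemma genideal_least:
  assumes "ideal J (free_algebra X)" "S \<subseteq> J"
  shows "genideal (free_algebra X) S \<subseteq> J"
  using assms by (auto simp: genideal_def)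

subsection \<open>Spaces of matrices and the enveloping algebra\<close>

text \<open>The letters of the free algebra are all vectors of \<open>V\<close> and not the members
  of a basis, so linearity in a letter holds only modulo the ideal.\<close>

locale linear_quotient = free_quotient "carrier V" I
  for V :: "(complex, 'v) module" and I +
  assumes linear_relations_subset: "linear_relations V \<subseteq> I"

context linear_quotient
begin

lemma word_add: "x \<in> carrier V \<Longrightarrow> y \<in> carrier V \<Longrightarrow> word [x \<oplus>\<^bsub>V\<^esub> y] - (word [x] + word [y]) \<in> I"
  using linear_relations_subset unfolding linear_relations_def
  by (simp add: diff_diff_eq[symmetric]) blast

lemma word_smult: "x \<in> carrier V \<Longrightarrow> word [c \<odot>\<^bsub>V\<^esub> x] - scal c * word [x] \<in> I"
  using linear_relations_subset unfolding linear_relations_def map_times_conv_mult by blast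

text \<open>At 0 + 0 the additivity relation reads w - (w + w), where w is the word of the zero
  vector.\<close>

lemma word_zero:
  assumes "\<zero>\<^bsub>V\<^esub> \<in> carrier V" "\<zero>\<^bsub>V\<^esub> \<oplus>\<^bsub>V\<^esub> \<zero>\<^bsub>V\<^esub> = \<zero>\<^bsub>V\<^esub>"
  shows "word [\<zero>\<^bsub>V\<^esub>] \<in> I"
  using I_minus[OF word_add[OF assms(1,1)]] by (simp add: assms(2))

end

text \<open>Reduces arbitrary matrices as letters to matrix units, both for gl(N, \<Omega>) and for
  the matrices over the tensor algebra.\<close>

lemma word_matrix_decomp:
  fixes V :: "(complex, 'v) module"
  assumes lq: "linear_quotient (matrix_space n V) I"
    and V: "abelian_monoid V"
    and M: "M \<in> carrier (matrix_space n V)"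
  shows "word [M] - (\<Sum>i=1..n. \<Sum>j=1..n. word [unit_matrix V i j (M i j)]) \<in> I"
proof -
  interpret linear_quotient "matrix_space n V" I by fact
  interpret V: abelian_monoid V by fact
  have MV: "M i j \<in> carrier V" for i j using M by (simp add: matrix_space_def)
  \<comment> \<open>\<open>R P\<close> keeps the entries of \<open>M\<close> at the positions in
    \<open>P\<close>, so that an induction on \<open>P\<close> adds one matrix unit at a
    time.\<close>
  define R where "R P = (\<lambda>i j. if (i, j) \<in> P then M i j else \<zero>\<^bsub>V\<^esub>)" for P
  have R: "R P \<in> carrier (matrix_space n V)" for P
    using M by (auto simp: R_def matrix_space_def)
  have "word [R P] - (\<Sum>p\<in>P. word [unit_matrix V (fst p) (snd p) (M (fst p) (snd p))]) \<in> I"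
    if "finite P" "P \<subseteq> {1..n} \<times> {1..n}" for P
    using that
  proof (induction P rule: finite_induct)
    case empty
    have "R {} = \<zero>\<^bsub>matrix_space n V\<^esub>" by (simp add: R_def matrix_space_def)
    moreover have "word [\<zero>\<^bsub>matrix_space n V\<^esub>] \<in> I"
      by (rule word_zero) (auto simp: matrix_space_def)
    ultimately show ?case by simp
  next
    case (insert p P)
    obtain i j where p: "p = (i, j)" by fastforce
    have u: "unit_matrix V i j (M i j) \<in> carrier (matrix_space n V)"
      using insert p MV by (auto simp: matrix_space_def unit_matrix_def)
    have "R (insert p P) = unit_matrix V i j (M i j) \<oplus>\<^bsub>matrix_space n V\<^esub> R P"
      using insert p MV by (auto simp: R_def matrix_space_def unit_matrix_def fun_eq_iff)
    then have "word [R (insert p P)] - (word [unit_matrix V i j (M i j)] + word [R P]) \<in> I"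
      using word_add[OF u R] by simp
    from I_add[OF this insert.IH] insert p show ?case
      by (simp add: algebra_simps)
  qed
  note decomp = this[of "{1..n} \<times> {1..n}"]
  have "R ({1..n} \<times> {1..n}) = M"
    using M by (auto simp: R_def matrix_space_def fun_eq_iff)
  with decomp show ?thesis
    by (simp add: sum.cartesian_product split_def)
qed

context countable_dim_algebra
begin

abbreviation "\<U> N \<equiv> U_gl scale N"
abbreviation "\<I> N \<equiv> U_ideal scale N"
abbreviation "\<G> N \<equiv> carrier (gl scale N)"
abbreviation "\<A> d \<equiv> A_algebra scale d"
abbreviation "\<Y> d s \<equiv> Y_algebra scale d s"
abbreviation "\<F> d s \<equiv> Y_filtration scale d s"
abbreviation "\<M> d \<equiv> M_space scale d"
abbreviation "\<S> d \<equiv> S_algebra scale d"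

section \<open>The Lie algebra gl(N, \<Omega>) and its matrix units\<close>

lemma omega_simps [simp]:
  "carrier (omega scale) = UNIV" "zero (omega scale) = 0" "add (omega scale) = (+)"
  "smult (omega scale) = scale"
  by (simp_all add: omega_def)

lemma abelian_monoid_omega: "abelian_monoid (omega scale)"
  by (rule abelian_monoidI) (auto simp: algebra_simps)

lemma carrier_gl: "\<G> N = {M. \<forall>i j. i \<notin> {1..N} \<or> j \<notin> {1..N} \<longrightarrow> M i j = 0}"
  by (simp add: gl_def matrix_space_def)

lemma gl_simps:
  "zero (gl scale N) = (\<lambda>i j. 0)" "add (gl scale N) = (\<lambda>M M' i j. M i j + M' i j)"
  "smult (gl scale N) = (\<lambda>c M i j. scale c (M i j))"
  by (simp_all add: gl_def matrix_space_def)

lemma gl_bracket_closed: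
  "M \<in> \<G> N \<Longrightarrow> M' \<in> \<G> N \<Longrightarrow> gl_bracket N M M' \<in> \<G> N"
  by (auto simp: carrier_gl gl_bracket_def)

lemma U_relations_subset:
  "linear_relations (gl scale N) \<union> {word [x, y] - word [y, x] - word [gl_bracket N x y] | x y.
     x \<in> \<G> N \<and> y \<in> \<G> N} \<subseteq> carrier (free_algebra (\<G> N))"
  using gl_bracket_closed
  by (auto simp: linear_relations_def map_times_conv_mult carrier_gl gl_simps intro!: free_carrier_closed)

lemma linear_quotient_U: "linear_quotient (gl scale N) (\<I> N)"
  unfolding U_ideal_def enveloping_ideal_def
  using U_relations_subset[of N] ring.genideal_self[OF ring_free_algebra U_relations_subset[of N]]
  by (intro linear_quotient.intro free_quotient.intro linear_quotient_axioms.intro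
      ring.genideal_ideal[OF ring_free_algebra]) auto

sublocale U: linear_quotient "gl scale N" "\<I> N"
  rewrites "quotient_algebra (free_algebra (\<G> N)) (\<I> N) = \<U> N"
  for N
  by (rule linear_quotient_U) (simp add: U_gl_def enveloping_algebra_def U_ideal_def)

lemma U_bracket:
  assumes "x \<in> \<G> N" "y \<in> \<G> N"
  shows "word [x] * word [y] - word [y] * word [x] - word [gl_bracket N x y] \<in> \<I> N"
  using assms unfolding U_ideal_def enveloping_ideal_def word_mult append_Cons append_Nil
  by (intro genideal_generators[OF U_relations_subset]) blast

text \<open>Carries no \<open>N\<close>: matrices are padded with zeros, so one and the same word
  represents E_ij(x) for every admissible N, and the inclusion of gl(N-1, \<Omega>) is the identity
  on lifts.\<close>

definition Ew :: "nat \<Rightarrow> nat \<Rightarrow> 'a \<Rightarrow> ((nat \<Rightarrow> nat \<Rightarrow> 'a) list \<Rightarrow>\<^sub>0 complex)" where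
  "Ew i j x = word [unit_matrix (omega scale) i j x]"

lemma unit_matrix_in_gl [simp]:
  "i \<in> {1..N} \<Longrightarrow> j \<in> {1..N} \<Longrightarrow> unit_matrix (omega scale) i j x \<in> \<G> N"
  by (auto simp: carrier_gl unit_matrix_def)

lemma Ew_in_C [simp, intro]: "i \<in> {1..N} \<Longrightarrow> j \<in> {1..N} \<Longrightarrow> Ew i j x \<in> U.C N"
  by (simp add: Ew_def)

lemma word_gl_zero: "word [\<lambda>i j. 0] \<in> \<I> N"
  using U.word_zero[of N] by (simp add: gl_simps carrier_gl)

lemma word_gl_decomp:
  "M \<in> \<G> N \<Longrightarrow>
    word [M] - (\<Sum>i=1..N. \<Sum>j=1..N. Ew i j (M i j)) \<in> \<I> N"
  using word_matrix_decomp[OF _ abelian_monoid_omega] linear_quotient_U[of N] 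
  unfolding gl_def Ew_def by blast

lemma Ew_bracket:
  assumes "i \<in> {1..N}" "j \<in> {1..N}" "k \<in> {1..N}" "l \<in> {1..N}"
  shows "Ew i j x * Ew k l y - Ew k l y * Ew i j x -
    ((if k = j then Ew i l (x * y) else 0) - (if i = l then Ew k j (y * x) else 0)) \<in> \<I> N"
proof -
  let ?u = "unit_matrix (omega scale)"
  let ?A = "if k = j then ?u i l (x * y) else (\<lambda>_ _. 0)" 
  let ?B = "if i = l then ?u k j (y * x) else (\<lambda>_ _. 0)"
  have A: "?A \<in> \<G> N" and B: "?B \<in> \<G> N"
    using assms by (auto simp: carrier_gl unit_matrix_def)
  have mat: "(\<Sum>c=1..N. ?u i j x a c * ?u k l y c b) = (if k = j then ?u i l (x * y) a b else 0)"
    if "j \<in> {1..N}" for i j k l a b x y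
  proof -
    have "(\<Sum>c=1..N. ?u i j x a c * ?u k l y c b) =
        (\<Sum>c=1..N. if c = j then ?u i j x a j * ?u k l y j b else 0)"
      by (intro sum.cong) (auto simp: unit_matrix_def)
    also have "\<dots> = ?u i j x a j * ?u k l y j b"
      using that by simp
    finally show ?thesis by (simp add: unit_matrix_def)
  qed
  \<comment> \<open>The bracket is the difference of \<open>?A\<close> and \<open>?B\<close>; it is
    written as a sum because the relations of the ideal concern sums.\<close>
  have AB: "?A = gl_bracket N (?u i j x) (?u k l y) \<oplus>\<^bsub>gl scale N\<^esub> ?B"
    using mat[OF assms(2), of i x _ k l y] mat[OF assms(4), of k y _ i j x]
    by (auto simp: gl_bracket_def gl_simps fun_eq_iff)
  have brc: "gl_bracket N (?u i j x) (?u k l y) \<in> \<G> N"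
    using assms by (intro gl_bracket_closed) auto
  have h1: "word [?A] - (if k = j then Ew i l (x * y) else 0) \<in> \<I> N"
    and h2: "word [?B] - (if i = l then Ew k j (y * x) else 0) \<in> \<I> N"
    using word_gl_zero[of N] by (auto simp: Ew_def)
  have h3: "Ew i j x * Ew k l y - Ew k l y * Ew i j x - word [gl_bracket N (?u i j x) (?u k l y)]
      \<in> \<I> N"
    unfolding Ew_def using assms by (intro U_bracket) auto
  have h4: "word [?A] - (word [gl_bracket N (?u i j x) (?u k l y)] + word [?B]) \<in> \<I> N"
    by (subst AB) (rule U.word_add[OF brc B])
  from U.I_diff[OF U.I_add[OF U.I_diff[OF h3 h4] h1] h2] show ?thesis
    by (simp add: algebra_simps)
qed

subsection \<open>The canonical filtration\<close>

text \<open>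
  The preimage in the free algebra of the part of degree at most \<open>k\<close> of \<open>\<U>(gl(N, \<Omega>))\<close>.
\<close>

definition U_filt :: "nat \<Rightarrow> int \<Rightarrow> ((nat \<Rightarrow> nat \<Rightarrow> 'a) list \<Rightarrow>\<^sub>0 complex) set" where
  "U_filt N k = {f \<in> U.C N. \<exists>g\<in>U.C N. (\<forall>w\<in>Poly_Mapping.keys g. int (length w) \<le> k) \<and> f - g \<in> \<I> N}"

lemma U_filt_I:
  "f \<in> U.C N \<Longrightarrow> g \<in> U.C N \<Longrightarrow> (\<And>w. w \<in> Poly_Mapping.keys g \<Longrightarrow> int (length w) \<le> k) \<Longrightarrow>
    f - g \<in> \<I> N \<Longrightarrow> f \<in> U_filt N k"
  by (auto simp: U_filt_def)

lemma U_filt_E: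
  assumes "f \<in> U_filt N k"
  obtains g where "g \<in> U.C N" "\<forall>w\<in>Poly_Mapping.keys g. int (length w) \<le> k"
    "f - g \<in> \<I> N"
  using assms by (auto simp: U_filt_def)

lemma U_filt_C: "f \<in> U_filt N k \<Longrightarrow> f \<in> U.C N"
  by (simp add: U_filt_def)

lemma U_filt_ideal: "f \<in> \<I> N \<Longrightarrow> f \<in> U_filt N k"
  by (rule U_filt_I[of _ _ 0]) (auto dest: U.I_subset)

lemma U_filt_mono: "f \<in> U_filt N k \<Longrightarrow> k \<le> k' \<Longrightarrow> f \<in> U_filt N k'"
  unfolding U_filt_def by fastforce

lemma U_filt_add:
  assumes "f \<in> U_filt N k" "g \<in> U_filt N k"
  shows "f + g \<in> U_filt N k"
proof -
  obtain f' where f': "f' \<in> U.C N" "\<forall>w\<in>Poly_Mapping.keys f'. int (length w) \<le> k"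
    "f - f' \<in> \<I> N" using assms(1) by (rule U_filt_E)
  obtain g' where g': "g' \<in> U.C N" "\<forall>w\<in>Poly_Mapping.keys g'. int (length w) \<le> k"
    "g - g' \<in> \<I> N" using assms(2) by (rule U_filt_E)
  show ?thesis
  proof (rule U_filt_I[of _ _ "f' + g'"])
    show "f + g - (f' + g') \<in> \<I> N"
      using U.I_add[OF f'(3) g'(3)] by (simp add: algebra_simps)
  qed (use assms f' g' keys_add[of f' g'] in \<open>auto dest: U_filt_C\<close>)
qed

lemma U_filt_mult:
  assumes "f \<in> U_filt N k" "g \<in> U_filt N l"
  shows "f * g \<in> U_filt N (k + l)"
proof -
  obtain f' where f': "f' \<in> U.C N" "\<forall>w\<in>Poly_Mapping.keys f'. int (length w) \<le> k"
    "f - f' \<in> \<I> N" using assms(1) by (rule U_filt_E)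
  obtain g' where g': "g' \<in> U.C N" "\<forall>w\<in>Poly_Mapping.keys g'. int (length w) \<le> l"
    "g - g' \<in> \<I> N" using assms(2) by (rule U_filt_E)
  show ?thesis
  proof (rule U_filt_I[of _ _ "f' * g'"])
    show "f * g - f' * g' \<in> \<I> N"
      using U.I_mult_diff[OF f'(3) g'(3)] assms g' by (auto dest: U_filt_C)
    show "int (length w) \<le> k + l" if "w \<in> Poly_Mapping.keys (f' * g')" for w
      using that keys_mult[of f' g'] f'(2) g'(2) by (fastforce simp: plus_list_def)
  qed (use assms f' g' in \<open>auto dest: U_filt_C\<close>)
qed

lemma U_filt_word: "set w \<subseteq> \<G> N \<Longrightarrow> int (length w) \<le> k \<Longrightarrow> word w \<in> U_filt N k"
  by (rule U_filt_I[of _ _ "word w"]) (auto simp: word_def carrier_free_algebra)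

lemma U_filt_const: "0 \<le> k \<Longrightarrow> scal c \<in> U_filt N k"
  by (rule U_filt_I[of _ _ "scal c"]) (auto split: if_splits)

lemma U_filt_smult: "f \<in> U_filt N k \<Longrightarrow> scal c * f \<in> U_filt N k"
  using U_filt_mult[OF U_filt_const[of 0 c N], of f k] by simp

lemma U_filt_zero: "0 \<in> U_filt N k"
  by (rule U_filt_ideal) auto

lemma U_filt_one: "0 \<le> k \<Longrightarrow> 1 \<in> U_filt N k"
  using U_filt_word[of "[]" N k] by (simp add: word_Nil)

lemma U_filt_minus: "f \<in> U_filt N k \<Longrightarrow> - f \<in> U_filt N k"
  using U_filt_smult[of f N k "- 1"]
  by (simp add: single_uminus zero_list_def[symmetric])

lemma U_filt_diff: "f \<in> U_filt N k \<Longrightarrow> g \<in> U_filt N k \<Longrightarrow> f - g \<in> U_filt N k"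
  using U_filt_add[of f N k "- g"] U_filt_minus[of g] by simp

lemma U_filt_sum: "(\<And>i. i \<in> A \<Longrightarrow> f i \<in> U_filt N k) \<Longrightarrow> sum f A \<in> U_filt N k"
  by (induction A rule: infinite_finite_induct) (auto intro: U_filt_add U_filt_zero)

lemma U_filt_sum_diff: "(\<And>i. i \<in> A \<Longrightarrow> f i - g i \<in> U_filt N k) \<Longrightarrow> sum f A - sum g A \<in> U_filt N k"
  by (simp add: sum_subtractf[symmetric] U_filt_sum)

text \<open>Exchanging two adjacent letters costs their bracket, which is a single letter, so the
  correction is shorter by one. The Leibniz rule spreads this over \<open>v\<close> first and then
  over \<open>u\<close>.\<close>

lemma U_filt_word_commute:
  assumes "set u \<subseteq> \<G> N" "set v \<subseteq> \<G> N"
  shows "word u * word v - word v * word u \<in> U_filt N (int (length u) + int (length v) - 1)"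
proof -
  have single: "word [x] * word v - word v * word [x] \<in> U_filt N (int (length v))"
    if "x \<in> \<G> N" "set v \<subseteq> \<G> N" for x v
    using that(2)
  proof (induction v)
    case Nil
    then show ?case by (simp add: word_Nil U_filt_zero)
  next
    case (Cons y v)
    have "word [x] * word [y] - word [y] * word [x] \<in> U_filt N 1"
      using U_filt_add[OF U_filt_ideal[OF U_bracket[of x N y]] U_filt_word[of "[gl_bracket N x y]" N 1]] that Cons.prems
        gl_bracket_closed[of x N y] by simp
    from U_filt_mult[OF this U_filt_word[of v N "length v"]] Cons.prems
    have "(word [x] * word [y] - word [y] * word [x]) * word v \<in> U_filt N (1 + int (length v))" by simp
    moreover have "word [y] * (word [x] * word v - word v * word [x]) \<in> U_filt N (1 + int (length v))"
      using U_filt_mult[OF U_filt_word[of "[y]" N 1] Cons.IH] Cons.prems by simp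
    moreover have "word [x] * word (y # v) - word (y # v) * word [x] =
        (word [x] * word [y] - word [y] * word [x]) * word v + word [y] * (word [x] * word v - word v * word [x])"
      by (simp add: algebra_simps word_mult)
    ultimately show ?case by (auto intro: U_filt_add)
  qed
  show ?thesis
    using assms(1)
  proof (induction u)
    case Nil
    then show ?case by (simp add: word_Nil U_filt_zero)
  next
    case (Cons x u)
    have "word [x] * (word u * word v - word v * word u) \<in> U_filt N (int (length (x # u)) + int (length v) - 1)"
      using U_filt_mult[OF U_filt_word[of "[x]" N 1] Cons.IH] Cons.prems by simp
    moreover have "(word [x] * word v - word v * word [x]) * word u \<in> U_filt N (int (length (x # u)) + int (length v) - 1)"
      using U_filt_mult[OF single[of x v] U_filt_word[of u N "length u"]] Cons.prems assms(2) by (simp add: add.commute)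
    moreover have "word (x # u) * word v - word v * word (x # u) =
        word [x] * (word u * word v - word v * word u) + (word [x] * word v - word v * word [x]) * word u"
      by (simp add: algebra_simps word_mult)
    ultimately show ?case by (auto intro: U_filt_add)
  qed
qed

lemma U_filt_commute:
  assumes "f \<in> U_filt N k" "g \<in> U_filt N l" "k + l - 1 \<le> m"
  shows "f * g - g * f \<in> U_filt N m"
proof -
  obtain f' where f': "f' \<in> U.C N" "\<forall>w\<in>Poly_Mapping.keys f'. int (length w) \<le> k"
    "f - f' \<in> \<I> N" using assms(1) by (rule U_filt_E)
  obtain g' where g': "g' \<in> U.C N" "\<forall>w\<in>Poly_Mapping.keys g'. int (length w) \<le> l"
    "g - g' \<in> \<I> N" using assms(2) by (rule U_filt_E)
  have sets: "set u \<subseteq> \<G> N"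
    if "u \<in> Poly_Mapping.keys f' \<or> u \<in> Poly_Mapping.keys g'" for u
    using f'(1) g'(1) that by (auto simp: carrier_free_algebra)
  have ww: "word u * word v - word v * word u \<in> U_filt N m"
    if "u \<in> Poly_Mapping.keys f'" "v \<in> Poly_Mapping.keys g'" for u v
    using U_filt_mono[OF U_filt_word_commute[of u N v], of m] that sets f'(2) g'(2) assms(3)
    by fastforce
  have "word u * g' - g' * word u \<in> U_filt N m" if "u \<in> Poly_Mapping.keys f'" for u
  proof -
    have "g' * word u - word u * g' \<in> U_filt N m"
      using U_filt_minus[OF ww[OF that]] by (subst commutator_sum_words) (auto intro!: U_filt_sum U_filt_smult)
    then show ?thesis using U_filt_minus by fastforce
  qed
  then have "f' * g' - g' * f' \<in> U_filt N m"
    by (subst commutator_sum_words) (auto intro!: U_filt_sum U_filt_smult)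
  moreover have "f * g - f' * g' \<in> \<I> N" "g * f - g' * f' \<in> \<I> N"
    using U.I_mult_diff[OF f'(3) g'(3)] U.I_mult_diff[OF g'(3) f'(3)] assms f'(1) g'(1)
    by (auto dest: U_filt_C)
  ultimately have "(f * g - f' * g') - (g * f - g' * f') + (f' * g' - g' * f') \<in> U_filt N m"
    using U_filt_add U_filt_ideal U.I_diff by blast
  then show ?thesis by (simp add: algebra_simps)
qed

subsection \<open>Leading terms of commutators\<close>

text \<open>
  A lift of \<open>e\<^sub>i\<^sub>j\<close> to the free algebra. The value at the empty list makes \<open>e_poly\<close> multiplicative under
  concatenation.
\<close>

fun e_poly :: "nat \<Rightarrow> nat \<Rightarrow> nat \<Rightarrow> 'a list \<Rightarrow> ((nat \<Rightarrow> nat \<Rightarrow> 'a) list \<Rightarrow>\<^sub>0 complex)" where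
  "e_poly N i j [] = (if i = j then 1 else 0)"
| "e_poly N i j (x # xs) = (\<Sum>a=1..N. Ew i a x * e_poly N a j xs)"

lemma Ew_in_U_filt: "i \<in> {1..N} \<Longrightarrow> j \<in> {1..N} \<Longrightarrow> Ew i j x \<in> U_filt N 1"
  by (auto simp: Ew_def intro!: U_filt_word)

lemma e_poly_in_U_filt: "i \<in> {1..N} \<Longrightarrow> j \<in> {1..N} \<Longrightarrow> e_poly N i j xs \<in> U_filt N (int (length xs))"
proof (induction xs arbitrary: i)
  case Nil
  then show ?case by (auto intro: U_filt_one U_filt_zero)
next
  case (Cons x xs)
  then show ?case
    using U_filt_mult[OF Ew_in_U_filt Cons.IH] by (auto intro!: U_filt_sum)
qed

lemma e_poly_in_C [simp, intro]: "i \<in> {1..N} \<Longrightarrow> j \<in> {1..N} \<Longrightarrow> e_poly N i j xs \<in> U.C N"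
  using U_filt_C[OF e_poly_in_U_filt] .

lemma e_poly_append:
  "i \<in> {1..N} \<Longrightarrow> e_poly N i j (xs @ ys) = (\<Sum>a=1..N. e_poly N i a xs * e_poly N a j ys)"
proof (induction xs arbitrary: i)
  case Nil
  then show ?case by (simp only: append_Nil e_poly.simps sum_delta_left)
next
  case (Cons x xs)
  have "e_poly N i j ((x # xs) @ ys) = (\<Sum>b=1..N. \<Sum>a=1..N. Ew i b x * e_poly N b a xs * e_poly N a j ys)"
    using Cons.IH by (simp add: sum_distrib_left mult.assoc)
  also have "\<dots> = (\<Sum>a=1..N. \<Sum>b=1..N. Ew i b x * e_poly N b a xs * e_poly N a j ys)"
    by (rule sum.swap)
  finally show ?case by (simp add: sum_distrib_right)
qed

lemma e_poly_singleton: "j \<in> {1..N} \<Longrightarrow> e_poly N i j [x] = Ew i j x"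
  by (simp only: e_poly.simps sum_delta_left)

text \<open>By the Leibniz rule E_ab(x) meets every factor E_pc(y_q) in turn. The two Kronecker
  deltas of the bracket cut the chain of inner indices into a chain that ends in \<open>b\<close>
  and one that starts in \<open>a\<close>. No factors are reordered, so the identity holds in the
  enveloping algebra without lower terms.\<close>

lemma Ew_e_poly_commutator:
  assumes "a \<in> {1..N}" "b \<in> {1..N}" "k \<in> {1..N}" "l \<in> {1..N}"
  shows "Ew a b x * e_poly N k l ys - e_poly N k l ys * Ew a b x - (\<Sum>q<length ys.
    e_poly N k b (take q ys) * e_poly N a l (x * ys ! q # drop (Suc q) ys) -
    e_poly N k b (take q ys @ [ys ! q * x]) * e_poly N a l (drop (Suc q) ys)) \<in> \<I> N"
  using assms(3)
proof (induction ys arbitrary: k)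
  case Nil
  then show ?case by auto
next
  case (Cons y ys)
  define Z where "Z q = e_poly N a l (x * ys ! q # drop (Suc q) ys)" for q
  define W where "W q = e_poly N a l (drop (Suc q) ys)" for q
  define R where "R c = (\<Sum>q<length ys. e_poly N c b (take q ys) * Z q -
    e_poly N c b (take q ys @ [ys ! q * x]) * W q)" for c
  \<comment> \<open>\<open>D c\<close> is the bracket with the first factor \<open>Ew k c y\<close>.
    It yields the summand \<open>q = 0\<close>, and the sums \<open>R c\<close> yield the summands
    whose \<open>q\<close> is raised by one.\<close>
  define D where "D c = (if k = b then Ew a c (x * y) else 0) - (if a = c then Ew k b (y * x) else 0)" for c
  have IH: "Ew a b x * e_poly N c l ys - e_poly N c l ys * Ew a b x - R c \<in> \<I> N" if "c \<in> {1..N}" for c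
    using Cons.IH[OF that] by (simp add: R_def Z_def W_def)
  have br: "Ew a b x * Ew k c y - Ew k c y * Ew a b x - D c \<in> \<I> N" if "c \<in> {1..N}" for c
    unfolding D_def using Ew_bracket[of a N b k c x y] assms that Cons.prems by simp
  have "(Ew a b x * Ew k c y - Ew k c y * Ew a b x - D c) * e_poly N c l ys +
      Ew k c y * (Ew a b x * e_poly N c l ys - e_poly N c l ys * Ew a b x - R c) \<in> \<I> N"
    if "c \<in> {1..N}" for c
    using U.I_add[OF U.I_rmult[OF br[OF that]] U.I_lmult[OF IH[OF that]]] that assms Cons.prems by blast
  then have "(\<Sum>c=1..N. (Ew a b x * Ew k c y - Ew k c y * Ew a b x - D c) * e_poly N c l ys +
      Ew k c y * (Ew a b x * e_poly N c l ys - e_poly N c l ys * Ew a b x - R c)) \<in> \<I> N"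
    by (rule U.I_sum)
  moreover have "(\<Sum>c=1..N. (Ew a b x * Ew k c y - Ew k c y * Ew a b x - D c) * e_poly N c l ys +
      Ew k c y * (Ew a b x * e_poly N c l ys - e_poly N c l ys * Ew a b x - R c)) =
      Ew a b x * e_poly N k l (y # ys) - e_poly N k l (y # ys) * Ew a b x -
        ((\<Sum>c=1..N. D c * e_poly N c l ys) + (\<Sum>c=1..N. Ew k c y * R c))"
    by (simp add: sum_distrib_left sum_distrib_right sum_subtractf[symmetric] sum.distrib[symmetric] algebra_simps)
  moreover have "(\<Sum>c=1..N. D c * e_poly N c l ys) =
      e_poly N k b [] * e_poly N a l (x * y # ys) - e_poly N k b [y * x] * e_poly N a l ys"
  proof -
    have "(\<Sum>c=1..N. D c * e_poly N c l ys) = (\<Sum>c=1..N. (if k = b then Ew a c (x * y) else 0) * e_poly N c l ys) -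
       (\<Sum>c=1..N. if a = c then Ew k b (y * x) * e_poly N a l ys else 0)"
      unfolding D_def sum_subtractf[symmetric] by (intro sum.cong) (auto simp: algebra_simps)
    then show ?thesis
      using assms by (simp add: e_poly_singleton del: e_poly.simps(2)) auto
  qed
  moreover have "(\<Sum>c=1..N. Ew k c y * R c) = (\<Sum>q<length ys.
      e_poly N k b (y # take q ys) * Z q - e_poly N k b (y # take q ys @ [ys ! q * x]) * W q)"
  proof -
    have "(\<Sum>c=1..N. Ew k c y * R c) = (\<Sum>c=1..N. \<Sum>q<length ys. Ew k c y * (e_poly N c b (take q ys) * Z q -
        e_poly N c b (take q ys @ [ys ! q * x]) * W q))"
      by (simp add: R_def sum_distrib_left)
    also have "\<dots> = (\<Sum>q<length ys. \<Sum>c=1..N. Ew k c y * (e_poly N c b (take q ys) * Z q -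
        e_poly N c b (take q ys @ [ys ! q * x]) * W q))"
      by (rule sum.swap)
    also have "\<dots> = (\<Sum>q<length ys. e_poly N k b (y # take q ys) * Z q - e_poly N k b (y # take q ys @ [ys ! q * x]) * W q)"
      by (simp add: sum_distrib_right right_diff_distrib sum_subtractf mult.assoc)
    finally show ?thesis .
  qed
  ultimately show ?case
    by (simp add: sum.lessThan_Suc_shift Z_def W_def del: e_poly.simps sum.lessThan_Suc)
qed

end

text \<open>
  The right-hand side of the bracket formula for a family \<open>f\<close> in place of \<open>p\<close>, with \<open>r\<close> and \<open>q\<close>
  counted from \<open>0\<close>.
\<close>

definition leading_bracket :: "(nat \<Rightarrow> nat \<Rightarrow> 'a::ring list \<Rightarrow> 'r::ring_1) \<Rightarrow> nat \<Rightarrow> nat \<Rightarrow> nat \<Rightarrow> nat \<Rightarrow>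
    'a list \<Rightarrow> 'a list \<Rightarrow> 'r" where
  "leading_bracket f i j k l xs ys = (\<Sum>r<length xs. \<Sum>q<length ys.
     f k j (take q ys @ drop (Suc r) xs) * f i l (take r xs @ xs ! r * ys ! q # drop (Suc q) ys) -
     f k j (take q ys @ ys ! q * xs ! r # drop (Suc r) xs) * f i l (take r xs @ drop (Suc q) ys))"

context countable_dim_algebra
begin

text \<open>
  In the induction step \<open>S a\<close> comes from the commutator with the first factor \<open>Ew i a x\<close> and \<open>L a\<close> from
  the induction hypothesis; the primed versions are reordered so that the summation over the inner
  index \<open>a\<close> can be carried out.
\<close>

lemma e_poly_commutator:
  assumes "i \<in> {1..N}" "j \<in> {1..N}" "k \<in> {1..N}" "l \<in> {1..N}"
  shows "e_poly N i j xs * e_poly N k l ys - e_poly N k l ys * e_poly N i j xs - leading_bracket (e_poly N) i j k l xs ys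
    \<in> U_filt N (int (length xs) + int (length ys) - 2)"
  using assms(1)
proof (induction xs arbitrary: i)
  case Nil
  then show ?case by (auto simp: leading_bracket_def U_filt_zero)
next
  case (Cons x xs)
  let ?n = "length ys"
  \<comment> \<open>This is the bound of the claim for \<open>x # xs\<close>: the extra letter turns
    the 2 into a 1.\<close>
  define K where "K = int (length xs) + int ?n - 1"
  define Y where "Y = e_poly N k l ys"
  define A where "A a = e_poly N a j xs" for a
  define Z where "Z q = e_poly N i l (x * ys ! q # drop (Suc q) ys)" for q
  define W where "W q = e_poly N i l (drop (Suc q) ys)" for q
  define S where "S a = (\<Sum>q<?n. e_poly N k a (take q ys) * Z q - e_poly N k a (take q ys @ [ys ! q * x]) * W q)" for a
  define S' where "S' a = (\<Sum>q<?n. e_poly N k a (take q ys) * A a * Z q - e_poly N k a (take q ys @ [ys ! q * x]) * A a * W q)" for a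
  define P where "P r q = e_poly N k j (take q ys @ drop (Suc r) xs)" for r q
  define P' where "P' r q = e_poly N k j (take q ys @ ys ! q * xs ! r # drop (Suc r) xs)" for r q
  define B where "B a r q = e_poly N a l (take r xs @ xs ! r * ys ! q # drop (Suc q) ys)" for a r q
  define B' where "B' a r q = e_poly N a l (take r xs @ drop (Suc q) ys)" for a r q
  define L where "L a = (\<Sum>r<length xs. \<Sum>q<?n. P r q * B a r q - P' r q * B' a r q)" for a
  define L' where "L' a = (\<Sum>r<length xs. \<Sum>q<?n. P r q * (Ew i a x * B a r q) - P' r q * (Ew i a x * B' a r q))" for a
  have AG: "A a \<in> U_filt N (length xs)" if "a \<in> {1..N}" for a
    unfolding A_def using that assms by (intro e_poly_in_U_filt) auto
  have ZG: "Z q \<in> U_filt N (int ?n - int q)" if "q < ?n" for q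
    unfolding Z_def using that assms Cons.prems by (intro U_filt_mono[OF e_poly_in_U_filt]) auto
  have WG: "W q \<in> U_filt N (int ?n - int q - 1)" if "q < ?n" for q
    unfolding W_def using that assms Cons.prems by (intro U_filt_mono[OF e_poly_in_U_filt]) auto
  have h1: "(Ew i a x * Y - Y * Ew i a x) * A a - S a * A a \<in> U_filt N K" if "a \<in> {1..N}" for a
  proof -
    have "Ew i a x * Y - Y * Ew i a x - S a \<in> \<I> N"
      unfolding Y_def S_def Z_def W_def using assms Cons.prems that by (intro Ew_e_poly_commutator)
    from U.I_rmult[OF this U_filt_C[OF AG[OF that]]] show ?thesis
      by (intro U_filt_ideal) (simp add: algebra_simps)
  qed
  have h2: "S a * A a - S' a \<in> U_filt N K" if a: "a \<in> {1..N}" for a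
  proof -
    have "e_poly N k a (take q ys) * (Z q * A a - A a * Z q) \<in> U_filt N K"
        "e_poly N k a (take q ys @ [ys ! q * x]) * (W q * A a - A a * W q) \<in> U_filt N K" if q: "q < ?n" for q
    proof -
      show "e_poly N k a (take q ys) * (Z q * A a - A a * Z q) \<in> U_filt N K"
        using q assms a
        by (intro U_filt_mono[OF U_filt_mult[OF e_poly_in_U_filt U_filt_commute[OF ZG[OF q] AG[OF a] order_refl]]]) (auto simp: K_def)
      show "e_poly N k a (take q ys @ [ys ! q * x]) * (W q * A a - A a * W q) \<in> U_filt N K"
        using q assms a
        by (intro U_filt_mono[OF U_filt_mult[OF e_poly_in_U_filt U_filt_commute[OF WG[OF q] AG[OF a] order_refl]]]) (auto simp: K_def)
    qed
    then have "(\<Sum>q<?n. e_poly N k a (take q ys) * (Z q * A a - A a * Z q) -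
        e_poly N k a (take q ys @ [ys ! q * x]) * (W q * A a - A a * W q)) \<in> U_filt N K" (is "?t \<in> _")
      by (intro U_filt_sum U_filt_diff) auto
    also have "?t = S a * A a - S' a"
      unfolding S_def S'_def sum_distrib_right sum_subtractf[symmetric]
      by (intro sum.cong) (simp_all add: algebra_simps)
    finally show ?thesis .
  qed
  have h3: "Ew i a x * (A a * Y - Y * A a) - Ew i a x * L a \<in> U_filt N K" if a: "a \<in> {1..N}" for a
  proof -
    have "A a * Y - Y * A a - L a \<in> U_filt N (int (length xs) + int ?n - 2)"
      using Cons.IH[OF a] by (simp add: A_def Y_def L_def leading_bracket_def P_def P'_def B_def B'_def)
    from U_filt_mult[OF Ew_in_U_filt this, of i a x] a Cons.prems show ?thesis
      by (simp add: K_def right_diff_distrib)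
  qed
  have h4: "Ew i a x * L a - L' a \<in> U_filt N K" if a: "a \<in> {1..N}" for a
  proof -
    have "(Ew i a x * P r q - P r q * Ew i a x) * B a r q \<in> U_filt N K"
         "(Ew i a x * P' r q - P' r q * Ew i a x) * B' a r q \<in> U_filt N K" if r: "r < length xs" "q < ?n" for r q
    proof -
      have EG: "Ew i a x \<in> U_filt N 1" using a Cons.prems by (rule Ew_in_U_filt[rotated])
      have "P r q \<in> U_filt N (int q + (int (length xs) - int r - 1))"
        unfolding P_def using r assms by (intro U_filt_mono[OF e_poly_in_U_filt]) auto
      moreover have "P' r q \<in> U_filt N (int q + (int (length xs) - int r))"
        unfolding P'_def using r assms by (intro U_filt_mono[OF e_poly_in_U_filt]) auto
      moreover have "B a r q \<in> U_filt N (int r + int ?n - int q)"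
        unfolding B_def using r assms a by (intro U_filt_mono[OF e_poly_in_U_filt]) auto
      moreover have "B' a r q \<in> U_filt N (int r + int ?n - int q - 1)"
        unfolding B'_def using r assms a by (intro U_filt_mono[OF e_poly_in_U_filt]) auto
      ultimately show "(Ew i a x * P r q - P r q * Ew i a x) * B a r q \<in> U_filt N K"
         "(Ew i a x * P' r q - P' r q * Ew i a x) * B' a r q \<in> U_filt N K"
        by (auto intro!: U_filt_mono[OF U_filt_mult[OF U_filt_commute[OF EG _ order_refl]]] simp: K_def)
    qed
    then have "(\<Sum>r<length xs. \<Sum>q<?n. (Ew i a x * P r q - P r q * Ew i a x) * B a r q -
        (Ew i a x * P' r q - P' r q * Ew i a x) * B' a r q) \<in> U_filt N K" (is "?t \<in> _")
      by (intro U_filt_sum U_filt_diff) auto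
    also have "?t = Ew i a x * L a - L' a"
      unfolding L_def L'_def sum_distrib_left sum_subtractf[symmetric]
      by (intro sum.cong) (simp_all add: algebra_simps)
    finally show ?thesis .
  qed
  have "(\<Sum>a=1..N. ((Ew i a x * Y - Y * Ew i a x) * A a - S a * A a) + (S a * A a - S' a) +
      (Ew i a x * (A a * Y - Y * A a) - Ew i a x * L a) + (Ew i a x * L a - L' a)) \<in> U_filt N K"
    by (intro U_filt_sum U_filt_add h1 h2 h3 h4)
  also have "(\<Sum>a=1..N. ((Ew i a x * Y - Y * Ew i a x) * A a - S a * A a) + (S a * A a - S' a) +
      (Ew i a x * (A a * Y - Y * A a) - Ew i a x * L a) + (Ew i a x * L a - L' a)) =
      e_poly N i j (x # xs) * Y - Y * e_poly N i j (x # xs) - (sum S' {1..N} + sum L' {1..N})"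
    by (simp add: A_def[symmetric] sum_distrib_left sum_distrib_right sum_subtractf[symmetric]
        sum.distrib[symmetric] algebra_simps)
  \<comment> \<open>Summation over \<open>a\<close> joins the left chain to \<open>xs\<close>. These
    are the summands with \<open>r = 0\<close>.\<close>
  also have "sum S' {1..N} = (\<Sum>q<?n. e_poly N k j (take q ys @ xs) * Z q - e_poly N k j (take q ys @ ys ! q * x # xs) * W q)"
  proof -
    have "sum S' {1..N} = (\<Sum>q<?n. \<Sum>a=1..N. e_poly N k a (take q ys) * A a * Z q - e_poly N k a (take q ys @ [ys ! q * x]) * A a * W q)"
      unfolding S'_def by (rule sum.swap)
    also have "\<dots> = (\<Sum>q<?n. e_poly N k j (take q ys @ xs) * Z q - e_poly N k j ((take q ys @ [ys ! q * x]) @ xs) * W q)"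
      unfolding sum_subtractf sum_distrib_right[symmetric] A_def
      by (subst (1 2) e_poly_append[OF assms(3), of j _ xs]) simp
    finally show ?thesis by simp
  qed
  \<comment> \<open>Summation over \<open>a\<close> prefixes \<open>x\<close> to the second factor.
    These are the summands whose \<open>r\<close> is raised by one.\<close>
  also have "sum L' {1..N} = (\<Sum>r<length xs. \<Sum>q<?n. P r q * e_poly N i l (x # take r xs @ xs ! r * ys ! q # drop (Suc q) ys)
       - P' r q * e_poly N i l (x # take r xs @ drop (Suc q) ys))"
  proof -
    have "sum L' {1..N} = (\<Sum>r<length xs. \<Sum>q<?n. \<Sum>a=1..N. P r q * (Ew i a x * B a r q) - P' r q * (Ew i a x * B' a r q))"
      unfolding L'_def by (simp add: sum.swap[of _ _ "{Suc 0..N}"])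
    then show ?thesis
      by (simp add: sum_subtractf sum_distrib_left[symmetric] B_def B'_def)
  qed
  finally show ?case
    by (simp add: leading_bracket_def Y_def Z_def W_def P_def P'_def K_def sum.lessThan_Suc_shift del: sum.lessThan_Suc e_poly.simps)
qed

text \<open>
  A lift of \<open>t\<^sub>i\<^sub>j\<close> with \<open>c\<close> in place of \<open>-N-s\<close>. The two terms of the recursion collect the compositions
  whose first part is \<open>1\<close> and those whose first part is larger.
\<close>

fun t_poly :: "complex \<Rightarrow> nat \<Rightarrow> nat \<Rightarrow> nat \<Rightarrow> 'a list \<Rightarrow> ((nat \<Rightarrow> nat \<Rightarrow> 'a) list \<Rightarrow>\<^sub>0 complex)" where
  "t_poly c N i j [] = (if i = j then 1 else 0)"
| "t_poly c N i j [x] = Ew i j x"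
| "t_poly c N i j (x # y # xs) = (\<Sum>a=1..N. Ew i a x * t_poly c N a j (y # xs)) + scal c * t_poly c N i j (x * y # xs)"

lemma t_poly_in_U_filt: "i \<in> {1..N} \<Longrightarrow> j \<in> {1..N} \<Longrightarrow> t_poly c N i j xs \<in> U_filt N (int (length xs))"
proof (induction c N i j xs rule: t_poly.induct)
  case (3 c N i j x y xs)
  have "scal c * t_poly c N i j (x * y # xs) \<in> U_filt N (int (length (x # y # xs)))"
    using 3 by (intro U_filt_mono[OF U_filt_smult[OF "3.IH"(2)]]) auto
  moreover have "Ew i a x * t_poly c N a j (y # xs) \<in> U_filt N (int (length (x # y # xs)))" if "a \<in> {1..N}" for a
    using U_filt_mult[OF Ew_in_U_filt "3.IH"(1), of i a a x] that 3 by simp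
  ultimately show ?case by (auto intro!: U_filt_add U_filt_sum simp del: t_poly.simps(2))
qed (auto intro: U_filt_one U_filt_zero Ew_in_U_filt)

lemma t_poly_in_C [simp, intro]: "i \<in> {1..N} \<Longrightarrow> j \<in> {1..N} \<Longrightarrow> t_poly c N i j xs \<in> U.C N"
  using U_filt_C[OF t_poly_in_U_filt] .

text \<open>The summand of the recursion that carries \<open>c\<close> merges two letters into one
  and so has smaller degree.\<close>

lemma t_poly_e_poly: "i \<in> {1..N} \<Longrightarrow> j \<in> {1..N} \<Longrightarrow> t_poly c N i j xs - e_poly N i j xs \<in> U_filt N (int (length xs) - 1)"
proof (induction c N i j xs rule: t_poly.induct)
  case (3 c N i j x y xs)
  have "scal c * t_poly c N i j (x * y # xs) \<in> U_filt N (int (length (x # y # xs)) - 1)"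
    using 3 by (intro U_filt_mono[OF U_filt_smult[OF t_poly_in_U_filt]]) auto
  moreover have "Ew i a x * (t_poly c N a j (y # xs) - e_poly N a j (y # xs)) \<in> U_filt N (int (length (x # y # xs)) - 1)"
    if "a \<in> {1..N}" for a
    using U_filt_mult[OF Ew_in_U_filt "3.IH"(1), of i a a x] that 3 by simp
  ultimately have "(\<Sum>a=1..N. Ew i a x * (t_poly c N a j (y # xs) - e_poly N a j (y # xs))) + scal c * t_poly c N i j (x * y # xs)
       \<in> U_filt N (int (length (x # y # xs)) - 1)" by (intro U_filt_add U_filt_sum)
  also have "(\<Sum>a=1..N. Ew i a x * (t_poly c N a j (y # xs) - e_poly N a j (y # xs))) + scal c * t_poly c N i j (x * y # xs) =
      t_poly c N i j (x # y # xs) - e_poly N i j (x # y # xs)"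
    by (simp add: e_poly.simps(2)[of N i j x "y # xs"] right_diff_distrib sum_subtractf
        del: t_poly.simps(2) e_poly.simps)
  finally show ?case .
qed (simp_all add: U_filt_zero e_poly_singleton del: e_poly.simps(2))

lemma leading_bracket_t_poly_e_poly:
  assumes "i \<in> {1..N}" "j \<in> {1..N}" "k \<in> {1..N}" "l \<in> {1..N}"
  shows "leading_bracket (t_poly c N) i j k l xs ys - leading_bracket (e_poly N) i j k l xs ys \<in> U_filt N (int (length xs) + int (length ys) - 2)"
proof -
  \<comment> \<open>Every product in the formula has this total length, as x_r and y_q merge into
    one letter. The condition \<open>0 < length xs\<close> makes the truncated subtraction
    exact.\<close>
  have prod: "t_poly c N k j u * t_poly c N i l v - e_poly N k j u * e_poly N i l v \<in> U_filt N (int (length xs) + int (length ys) - 2)"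
    if "length u + length v = length xs + length ys - 1" "0 < length xs" for u v
  proof -
    have len: "int (length u) + int (length v) = int (length xs) + int (length ys) - 1" using that by linarith
    have "t_poly c N k j u * (t_poly c N i l v - e_poly N i l v) \<in> U_filt N (int (length u) + (int (length v) - 1))"
      using assms by (intro U_filt_mult t_poly_in_U_filt t_poly_e_poly)
    moreover have "(t_poly c N k j u - e_poly N k j u) * e_poly N i l v \<in> U_filt N ((int (length u) - 1) + int (length v))"
      using assms by (intro U_filt_mult e_poly_in_U_filt t_poly_e_poly)
    ultimately show ?thesis
      using U_filt_add[of "t_poly c N k j u * (t_poly c N i l v - e_poly N i l v)" N "int (length xs) + int (length ys) - 2"
          "(t_poly c N k j u - e_poly N k j u) * e_poly N i l v"] len
      by (simp add: algebra_simps)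
  qed
  show ?thesis
    unfolding leading_bracket_def
  proof (intro U_filt_sum_diff)
    fix r q assume "r \<in> {..<length xs}" "q \<in> {..<length ys}"
    then have "(t_poly c N k j (take q ys @ drop (Suc r) xs) * t_poly c N i l (take r xs @ xs ! r * ys ! q # drop (Suc q) ys) -
        e_poly N k j (take q ys @ drop (Suc r) xs) * e_poly N i l (take r xs @ xs ! r * ys ! q # drop (Suc q) ys)) -
        (t_poly c N k j (take q ys @ ys ! q * xs ! r # drop (Suc r) xs) * t_poly c N i l (take r xs @ drop (Suc q) ys) -
        e_poly N k j (take q ys @ ys ! q * xs ! r # drop (Suc r) xs) * e_poly N i l (take r xs @ drop (Suc q) ys))
        \<in> U_filt N (int (length xs) + int (length ys) - 2)"
      by (intro U_filt_diff prod) auto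
    then show "t_poly c N k j (take q ys @ drop (Suc r) xs) * t_poly c N i l (take r xs @ xs ! r * ys ! q # drop (Suc q) ys) -
        t_poly c N k j (take q ys @ ys ! q * xs ! r # drop (Suc r) xs) * t_poly c N i l (take r xs @ drop (Suc q) ys) -
        (e_poly N k j (take q ys @ drop (Suc r) xs) * e_poly N i l (take r xs @ xs ! r * ys ! q # drop (Suc q) ys) -
        e_poly N k j (take q ys @ ys ! q * xs ! r # drop (Suc r) xs) * e_poly N i l (take r xs @ drop (Suc q) ys))
        \<in> U_filt N (int (length xs) + int (length ys) - 2)"
      by (simp add: algebra_simps)
  qed
qed

text \<open>The arguments are replaced by \<open>e_poly\<close> one at a time. A commutator with a
  factor that has lost one degree falls below the degree of the leading term.\<close>

lemma t_poly_commutator: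
  assumes "i \<in> {1..N}" "j \<in> {1..N}" "k \<in> {1..N}" "l \<in> {1..N}"
  shows "t_poly c N i j xs * t_poly c N k l ys - t_poly c N k l ys * t_poly c N i j xs - leading_bracket (t_poly c N) i j k l xs ys
    \<in> U_filt N (int (length xs) + int (length ys) - 2)" (is "_ \<in> U_filt N ?K")
proof -
  have u: "t_poly c N i j xs - e_poly N i j xs \<in> U_filt N (int (length xs) - 1)"
    and v: "t_poly c N k l ys - e_poly N k l ys \<in> U_filt N (int (length ys) - 1)"
    using assms by (auto intro!: t_poly_e_poly)
  have "(t_poly c N i j xs - e_poly N i j xs) * t_poly c N k l ys - t_poly c N k l ys * (t_poly c N i j xs - e_poly N i j xs) \<in> U_filt N ?K"
    by (rule U_filt_commute[OF u t_poly_in_U_filt]) (use assms in auto)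
  moreover have "e_poly N i j xs * (t_poly c N k l ys - e_poly N k l ys) - (t_poly c N k l ys - e_poly N k l ys) * e_poly N i j xs \<in> U_filt N ?K"
    by (rule U_filt_commute[OF e_poly_in_U_filt v]) (use assms in auto)
  ultimately have "(((t_poly c N i j xs - e_poly N i j xs) * t_poly c N k l ys - t_poly c N k l ys * (t_poly c N i j xs - e_poly N i j xs)) +
     (e_poly N i j xs * (t_poly c N k l ys - e_poly N k l ys) - (t_poly c N k l ys - e_poly N k l ys) * e_poly N i j xs)) +
     (e_poly N i j xs * e_poly N k l ys - e_poly N k l ys * e_poly N i j xs - leading_bracket (e_poly N) i j k l xs ys) -
     (leading_bracket (t_poly c N) i j k l xs ys - leading_bracket (e_poly N) i j k l xs ys) \<in> U_filt N ?K"
    using assms by (intro U_filt_add[OF U_filt_add] U_filt_diff[OF U_filt_add[OF U_filt_add]] e_poly_commutator leading_bracket_t_poly_e_poly) 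
  then show ?thesis by (simp add: algebra_simps)
qed

end

subsection \<open>Derivations\<close>

abbreviation derive_word :: "('x \<Rightarrow> 'x) \<Rightarrow> 'x list \<Rightarrow> ('x list \<Rightarrow>\<^sub>0 complex)" where
  "derive_word \<delta> w \<equiv> (\<Sum>k<length w. word (w[k := \<delta> (w ! k)]))"

text \<open>The definition sums over the support of \<open>f\<close>, which changes under addition;
  a larger index set can be shared by several polynomials.\<close>

lemma free_derivation_superset:
  assumes "finite A" "Poly_Mapping.keys f \<subseteq> A"
  shows "free_derivation \<delta> f =
    (\<Sum>w\<in>A. scal (Poly_Mapping.lookup f w) * derive_word \<delta> w)"
proof -
  have "free_derivation \<delta> f =
      (\<Sum>w\<in>Poly_Mapping.keys f. scal (Poly_Mapping.lookup f w) * derive_word \<delta> w)"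
    by (simp add: free_derivation_def single_eq_word[of "_[_ := _]"] sum_distrib_left)
  also have "\<dots> = (\<Sum>w\<in>A. scal (Poly_Mapping.lookup f w) * derive_word \<delta> w)"
    using assms by (intro sum.mono_neutral_left) (auto simp: in_keys_iff)
  finally show ?thesis .
qed

lemma free_derivation_add: "free_derivation \<delta> (f + g) = free_derivation \<delta> f + free_derivation \<delta> g"
proof -
  let ?A = "Poly_Mapping.keys f \<union> Poly_Mapping.keys g"
  have "finite ?A" "Poly_Mapping.keys (f + g) \<subseteq> ?A" by (auto simp: keys_add)
  then show ?thesis
    by (simp add: free_derivation_superset[of ?A] lookup_add single_add distrib_right sum.distrib)
qed

lemma free_derivation_zero: "free_derivation \<delta> 0 = 0"
  by (simp add: free_derivation_def)

lemma free_derivation_sum: "free_derivation \<delta> (sum f A) = (\<Sum>i\<in>A. free_derivation \<delta> (f i))"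
  by (induction A rule: infinite_finite_induct) (simp_all add: free_derivation_zero free_derivation_add)

lemma free_derivation_word: "free_derivation \<delta> (word w) = derive_word \<delta> w"
  using free_derivation_superset[of "{w}" "word w" \<delta>]
  by (simp add: word_def scal_one)

lemma free_derivation_smult:
  "free_derivation \<delta> (scal c * f) = scal c * free_derivation \<delta> f"
proof -
  have "Poly_Mapping.keys (scal c * f) \<subseteq> Poly_Mapping.keys f"
    by (auto simp: in_keys_iff lookup_scal_mult)
  then have "free_derivation \<delta> (scal c * f) = (\<Sum>w\<in>Poly_Mapping.keys f.
     scal (c * Poly_Mapping.lookup f w) * derive_word \<delta> w)"
    by (simp add: free_derivation_superset[of "Poly_Mapping.keys f"] lookup_scal_mult)
  then show ?thesis
    by (simp add: free_derivation_superset[of "Poly_Mapping.keys f" f] scal_times sum_distrib_left mult.assoc)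
qed

lemma free_derivation_minus: "free_derivation \<delta> (- f) = - free_derivation \<delta> f"
  using free_derivation_add[of \<delta> f "- f"] by (simp add: free_derivation_zero eq_neg_iff_add_eq_0 add.commute)

lemma free_derivation_diff: "free_derivation \<delta> (f - g) = free_derivation \<delta> f - free_derivation \<delta> g"
  using free_derivation_add[of \<delta> f "- g"] by (simp add: free_derivation_minus)

lemma free_UNIV_induct [case_names word add smult]:
  assumes "\<And>w. P (word w)" "\<And>f g. P f \<Longrightarrow> P g \<Longrightarrow> P (f + g)"
    "\<And>c f. P f \<Longrightarrow> P (scal c * f)"
  shows "P f"
  using free_words_induct[of f UNIV P] assms by (auto simp: carrier_free_algebra)

text \<open>By linearity in both factors it suffices to take words, where the positions of a
  concatenation split into those of its two parts.\<close>

lemma free_derivation_mult: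
  "free_derivation \<delta> (f * g) = free_derivation \<delta> f * g + f * free_derivation \<delta> g"
proof (induction f rule: free_UNIV_induct)
  case (word u)
  show ?case
  proof (induction g rule: free_UNIV_induct)
    case (word v)
    show ?case
      by (simp add: word_mult free_derivation_word sum_distrib_left sum_distrib_right
          list_update_append nth_append sum_lessThan_add)
  next
    case (add f g)
    then show ?case by (simp add: free_derivation_add algebra_simps)
  next
    case (smult c f)
    then show ?case by (simp add: free_derivation_smult mult_scal_left distrib_left)
  qed
next
  case (add f g)
  then show ?case by (simp add: free_derivation_add algebra_simps)
next
  case (smult c f)
  then show ?case by (simp add: free_derivation_smult mult.assoc distrib_left)
qed

lemma free_derivation_one: "free_derivation \<delta> 1 = 0"
  using free_derivation_word[of \<delta> "[]"] by (simp add: word_Nil)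

lemma free_derivation_const: "free_derivation \<delta> (scal c) = 0"
  using free_derivation_smult[of \<delta> c 1] by (simp add: free_derivation_one)

section \<open>The action of gl(N, C) on the enveloping algebra\<close>

context countable_dim_algebra
begin

text \<open>\<open>gl_sub 0 N\<close> is all of gl(N, C). General facts on the action are proved
  there and then apply both to the matrices that define the invariants and to E_NN.\<close>

lemma gl_sub_mono: "d \<le> d' \<Longrightarrow> gl_sub d' N \<subseteq> gl_sub d N"
  by (fastforce simp: gl_sub_def)

lemma gl_sub_outside: "C \<in> gl_sub 0 N \<Longrightarrow> i \<notin> {1..N} \<or> j \<notin> {1..N} \<Longrightarrow> C i j = 0"
  by (force simp: gl_sub_def)

lemma gl_ad_closed:
  "C \<in> gl_sub 0 N \<Longrightarrow> M \<in> \<G> N \<Longrightarrow> gl_ad scale N C M \<in> \<G> N"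
  using gl_sub_outside[of C N] by (auto simp: carrier_gl gl_ad_def)

lemma gl_ad_add: "gl_ad scale N C (x \<oplus>\<^bsub>gl scale N\<^esub> y) = gl_ad scale N C x \<oplus>\<^bsub>gl scale N\<^esub> gl_ad scale N C y"
  by (simp add: gl_ad_def gl_simps fun_eq_iff scale_right_distrib sum.distrib)

lemma gl_ad_smult: "gl_ad scale N C (c \<odot>\<^bsub>gl scale N\<^esub> x) = c \<odot>\<^bsub>gl scale N\<^esub> gl_ad scale N C x"
  by (simp add: gl_ad_def gl_simps fun_eq_iff scale_right_diff_distrib scale_sum_right mult.commute)

text \<open>Without a unit in \<Omega> the action is not a bracket inside gl(N, \<Omega>), so the
  Jacobi identity is replaced by matrix products: on the right the terms x C y and y C x occur with
  both signs.\<close>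

lemma gl_ad_bracket:
  "gl_ad scale N C (gl_bracket N x y) =
   gl_bracket N (gl_ad scale N C x) y \<oplus>\<^bsub>gl scale N\<^esub> gl_bracket N x (gl_ad scale N C y)"
proof (intro ext)
  fix i j :: nat
  define I where "I = {1..N}"
  have *: "(\<Sum>a\<in>I. scale (C i a) (\<Sum>b\<in>I. x a b * y b j)) = (\<Sum>b\<in>I. (\<Sum>a\<in>I. scale (C i a) (x a b)) * y b j)"
    for x y :: "nat \<Rightarrow> nat \<Rightarrow> 'a"
    by (simp add: scale_sum_right sum_distrib_right scale_mult_left) (rule sum.swap)
  have **: "(\<Sum>a\<in>I. scale (C a j) (\<Sum>b\<in>I. x i b * y b a)) = (\<Sum>b\<in>I. x i b * (\<Sum>a\<in>I. scale (C a j) (y b a)))"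
    for x y :: "nat \<Rightarrow> nat \<Rightarrow> 'a"
    by (simp add: scale_sum_right sum_distrib_left scale_mult_right) (rule sum.swap)
  have ***: "(\<Sum>b\<in>I. (\<Sum>a\<in>I. scale (C a b) (x i a)) * y b j) = (\<Sum>b\<in>I. x i b * (\<Sum>a\<in>I. scale (C b a) (y a j)))"
    for x y :: "nat \<Rightarrow> nat \<Rightarrow> 'a"
    by (simp add: sum_distrib_left sum_distrib_right scale_mult_left scale_mult_right) (rule sum.swap)
  show "gl_ad scale N C (gl_bracket N x y) i j =
   (gl_bracket N (gl_ad scale N C x) y \<oplus>\<^bsub>gl scale N\<^esub> gl_bracket N x (gl_ad scale N C y)) i j"
    unfolding gl_simps gl_ad_def gl_bracket_def I_def[symmetric]
    by (simp add: scale_right_diff_distrib left_diff_distrib right_diff_distrib sum_subtractf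
        * ** ***)
qed

definition gl_act :: "nat \<Rightarrow> (nat \<Rightarrow> nat \<Rightarrow> complex) \<Rightarrow> ((nat \<Rightarrow> nat \<Rightarrow> 'a) list \<Rightarrow>\<^sub>0 complex) \<Rightarrow> _" where
  "gl_act N C = free_derivation (gl_ad scale N C)"

lemma gl_act_word1: "gl_act N C (word [x]) = word [gl_ad scale N C x]"
  by (simp add: gl_act_def free_derivation_word)

lemmas gl_act_add = free_derivation_add[of "gl_ad scale N C" for N C, folded gl_act_def]
  and gl_act_diff = free_derivation_diff[of "gl_ad scale N C" for N C, folded gl_act_def]
  and gl_act_sum = free_derivation_sum[of "gl_ad scale N C" for N C, folded gl_act_def]
  and gl_act_const = free_derivation_const[of "gl_ad scale N C" for N C, folded gl_act_def]
  and gl_act_mult = free_derivation_mult[of "gl_ad scale N C" for N C, folded gl_act_def]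

lemma gl_act_in_C:
  assumes "C \<in> gl_sub 0 N" "f \<in> U.C N"
  shows "gl_act N C f \<in> U.C N"
  using assms(2)
proof (induction rule: free_words_induct)
  case (word w)
  have "set (w[k := gl_ad scale N C (w ! k)]) \<subseteq> \<G> N" if "k < length w" for k
    using word that gl_ad_closed[OF assms(1), of "w ! k"] set_update_subset_insert[of w k "gl_ad scale N C (w ! k)"]
      nth_mem[OF that] by blast
  then show ?case
    by (auto simp: gl_act_def free_derivation_word)
qed (auto simp: gl_act_def free_derivation_add free_derivation_smult)

text \<open>A derivation preserves the ideal once it does so on generators. It maps linear relations
  to linear relations, and the bracket relation of x and y to the sum of those of (C x, y) and (x, C
  y), up to additivity.\<close>

lemma gl_act_ideal:
  assumes C: "C \<in> gl_sub 0 N" and f: "f \<in> \<I> N"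
  shows "gl_act N C f \<in> \<I> N"
proof -
  let ?\<delta> = "gl_ad scale N C"
  \<comment> \<open>Membership of \<open>f\<close> itself is kept because the derivative of
    \<open>a * f\<close> contains the derivative of \<open>a\<close> times \<open>f\<close>.\<close>
  let ?J = "{f \<in> \<I> N. gl_act N C f \<in> \<I> N}"
  note gen = genideal_generators[OF U_relations_subset, of _ N]
  have eq: "\<I> N = genideal (free_algebra (\<G> N))
    (linear_relations (gl scale N) \<union> {word [x, y] - word [y, x] - word [gl_bracket N x y] | x y.
     x \<in> \<G> N \<and> y \<in> \<G> N})"
    by (simp add: U_ideal_def enveloping_ideal_def)
  have "genideal (free_algebra (\<G> N))
    (linear_relations (gl scale N) \<union> {word [x, y] - word [y, x] - word [gl_bracket N x y] | x y.
     x \<in> \<G> N \<and> y \<in> \<G> N}) \<subseteq> ?J"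
  proof (rule genideal_least)
    show "ideal ?J (free_algebra (\<G> N))"
    proof (rule ideal_free_algebraI)
      fix a f assume a: "a \<in> U.C N" and f: "f \<in> ?J"
      then show "a * f \<in> ?J" "f * a \<in> ?J"
        using gl_act_in_C[OF C a] U.I_subset[of f N]
        by (auto simp: gl_act_def free_derivation_mult)
    qed (auto simp: gl_act_def free_derivation_zero free_derivation_add dest: U.I_subset)
    have lin: "gl_act N C f \<in> \<I> N" if f: "f \<in> linear_relations (gl scale N)" for f
    proof -
      consider x y where "x \<in> \<G> N" "y \<in> \<G> N"
          "f = word [x \<oplus>\<^bsub>gl scale N\<^esub> y] - word [x] - word [y]"
        | c x where "x \<in> \<G> N"
          "f = word [c \<odot>\<^bsub>gl scale N\<^esub> x] - scal c * word [x]"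
        using f unfolding linear_relations_def map_times_conv_mult by blast
      then show ?thesis
      proof cases
        case 1
        then show ?thesis
          using U.word_add[of "?\<delta> x" N "?\<delta> y"] gl_ad_closed[OF C]
          by (simp add: gl_act_def free_derivation_diff free_derivation_add free_derivation_word gl_ad_add diff_diff_eq)
      next
        case 2
        then show ?thesis
          using U.word_smult[of "?\<delta> x" N c] gl_ad_closed[OF C]
          by (simp add: gl_act_def free_derivation_diff free_derivation_smult free_derivation_word gl_ad_smult)
      qed
    qed
    have br: "gl_act N C (word [x, y] - word [y, x] - word [gl_bracket N x y]) \<in> \<I> N"
      if "x \<in> \<G> N" "y \<in> \<G> N" for x y
    proof -
      have c: "?\<delta> x \<in> \<G> N" "?\<delta> y \<in> \<G> N"
        using that gl_ad_closed[OF C] by auto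
      have "(word [?\<delta> x] * word [y] - word [y] * word [?\<delta> x] - word [gl_bracket N (?\<delta> x) y]) +
         (word [x] * word [?\<delta> y] - word [?\<delta> y] * word [x] - word [gl_bracket N x (?\<delta> y)]) -
         (word [gl_bracket N (?\<delta> x) y \<oplus>\<^bsub>gl scale N\<^esub> gl_bracket N x (?\<delta> y)] -
          (word [gl_bracket N (?\<delta> x) y] + word [gl_bracket N x (?\<delta> y)])) \<in> \<I> N"
        using that c by (intro U.I_diff[OF U.I_add] U_bracket U.word_add gl_bracket_closed)
      then show ?thesis
        by (simp add: gl_act_def free_derivation_diff free_derivation_add free_derivation_word word_mult gl_ad_bracket
            lessThan_Suc algebra_simps)
    qed
    show "linear_relations (gl scale N) \<union> {word [x, y] - word [y, x] - word [gl_bracket N x y] | x y.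
     x \<in> \<G> N \<and> y \<in> \<G> N} \<subseteq> ?J"
      using lin br gen unfolding eq by blast
  qed
  with f show ?thesis by (auto simp: eq)
qed

lemma U_action_cls:
  assumes "C \<in> gl_sub 0 N"
  shows "U_action scale N C (U.cls N f) = U.cls N (gl_act N C f)"
proof -
  have "U.cls N (gl_act N C g) = U.cls N (gl_act N C f)" if "g \<in> U.cls N f" for g
    using gl_act_ideal[OF assms, of "g - f"] that
    by (simp add: U.cls_eq_iff U.cls_conv[of N f] gl_act_def free_derivation_diff)
  then have "(\<Union>g\<in>U.cls N f. U.cls N (gl_act N C g)) = U.cls N (gl_act N C f)"
    using U.cls_self[of f N] by blast
  then show ?thesis
    by (simp add: U_action_def U.cls_def[symmetric] gl_act_def)
qed

lemma Ew_diff: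
  assumes "i \<in> {1..N}" "j \<in> {1..N}"
  shows "Ew i j (x - y) - (Ew i j x - Ew i j y) \<in> \<I> N"
proof -
  have "unit_matrix (omega scale) i j x =
      unit_matrix (omega scale) i j (x - y) \<oplus>\<^bsub>gl scale N\<^esub> unit_matrix (omega scale) i j y"
    by (auto simp: unit_matrix_def gl_simps fun_eq_iff)
  then have "word [unit_matrix (omega scale) i j x] -
    (word [unit_matrix (omega scale) i j (x - y)] + word [unit_matrix (omega scale) i j y]) \<in> \<I> N"
    using U.word_add[of "unit_matrix (omega scale) i j (x - y)" N "unit_matrix (omega scale) i j y"] assms
    by simp
  from U.I_minus[OF this] show ?thesis by (simp add: Ew_def algebra_simps)
qed

lemma Ew_scale:
  assumes "i \<in> {1..N}" "j \<in> {1..N}"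
  shows "Ew i j (scale c x) - scal c * Ew i j x \<in> \<I> N"
proof -
  have "unit_matrix (omega scale) i j (scale c x) = c \<odot>\<^bsub>gl scale N\<^esub> unit_matrix (omega scale) i j x"
    by (auto simp: unit_matrix_def gl_simps fun_eq_iff)
  then show ?thesis
    using U.word_smult[of "unit_matrix (omega scale) i j x" N c] assms by (simp add: Ew_def)
qed

lemma Ew_zero: "Ew i j 0 \<in> \<I> N"
  using word_gl_zero[of N] by (simp add: Ew_def unit_matrix_def if_distrib cong: if_cong)

lemma gl_act_Ew:
  assumes "C \<in> gl_sub 0 N" "i \<in> {1..N}" "j \<in> {1..N}"
  shows "gl_act N C (Ew i j x) - ((\<Sum>a=1..N. scal (C a i) * Ew a j x) - (\<Sum>a=1..N. scal (C j a) * Ew i a x))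
    \<in> \<I> N"
proof -
  let ?M = "gl_ad scale N C (unit_matrix (omega scale) i j x)"
  \<comment> \<open>Left multiplication of the unit matrix by \<open>C\<close> fills column
    \<open>j\<close>, right multiplication fills row \<open>i\<close>; \<open>A\<close> and
    \<open>B\<close> collect these entries.\<close>
  define A where "A p q = (if q = j then scal (C p i) * Ew p j x else 0)" for p q
  define B where "B p q = (if p = i then scal (C j q) * Ew i q x else 0)" for p q
  have M: "?M p q = (if q = j then scale (C p i) x else 0) - (if p = i then scale (C j q) x else 0)"
    if "p \<in> {1..N}" "q \<in> {1..N}" for p q
  proof -
    have "(\<Sum>a=1..N. scale (C p a) (unit_matrix (omega scale) i j x a q)) =
       (\<Sum>a=1..N. if a = i then (if q = j then scale (C p i) x else 0) else 0)"
      by (intro sum.cong) (auto simp: unit_matrix_def)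
    moreover have "(\<Sum>a=1..N. scale (C a q) (unit_matrix (omega scale) i j x p a)) =
       (\<Sum>a=1..N. if a = j then (if p = i then scale (C j q) x else 0) else 0)"
      by (intro sum.cong) (auto simp: unit_matrix_def)
    ultimately show ?thesis using assms by (simp add: gl_ad_def)
  qed
  have entry: "Ew p q (?M p q) - (A p q - B p q) \<in> \<I> N" if "p \<in> {1..N}" "q \<in> {1..N}" for p q
  proof -
    have 1: "Ew p q (if q = j then scale (C p i) x else 0) - A p q \<in> \<I> N"
      using Ew_scale[OF that] Ew_zero by (auto simp: A_def)
    have 2: "Ew p q (if p = i then scale (C j q) x else 0) - B p q \<in> \<I> N"
      using Ew_scale[OF that] Ew_zero by (auto simp: B_def)
    show ?thesis
      using U.I_add[OF Ew_diff[OF that, of "if q = j then scale (C p i) x else 0" "if p = i then scale (C j q) x else 0"] U.I_diff[OF 1 2]]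
      by (simp add: M[OF that] algebra_simps del: if_distrib)
  qed
  have "word [?M] - (\<Sum>p=1..N. \<Sum>q=1..N. Ew p q (?M p q)) \<in> \<I> N"
    using assms by (intro word_gl_decomp gl_ad_closed) auto
  moreover have "(\<Sum>p=1..N. \<Sum>q=1..N. Ew p q (?M p q)) - (\<Sum>p=1..N. \<Sum>q=1..N. A p q - B p q) \<in> \<I> N"
    by (intro U.I_sum_diff entry)
  ultimately have "word [?M] - (\<Sum>p=1..N. \<Sum>q=1..N. A p q - B p q) \<in> \<I> N"
    by (rule U.I_trans)
  moreover have "(\<Sum>p=1..N. \<Sum>q=1..N. A p q - B p q) =
    (\<Sum>a=1..N. scal (C a i) * Ew a j x) - (\<Sum>a=1..N. scal (C j a) * Ew i a x)"
  proof -
    have "(\<Sum>p=1..N. \<Sum>q=1..N. A p q) = (\<Sum>a=1..N. scal (C a i) * Ew a j x)"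
      unfolding A_def using assms by simp
    moreover have "(\<Sum>p=1..N. \<Sum>q=1..N. B p q) = (\<Sum>a=1..N. scal (C j a) * Ew i a x)"
      unfolding B_def by (subst sum.swap) (use assms in simp)
    ultimately show ?thesis by (simp add: sum_subtractf)
  qed
  ultimately show ?thesis by (simp add: Ew_def[of i j] gl_act_word1)
qed

text \<open>Row \<open>j\<close> of \<open>C\<close> is assumed to vanish, which removes the
  contribution of the right end. The left index stays general, because in the induction it runs
  through all inner indices.\<close>

lemma gl_act_t_poly:
  assumes C: "C \<in> gl_sub 0 N" and Cj: "\<And>a. C j a = 0" and j: "j \<in> {1..N}" and "i \<in> {1..N}"
  shows "gl_act N C (t_poly c N i j xs) - (\<Sum>a=1..N. scal (C a i) * t_poly c N a j xs) \<in> \<I> N"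
  using assms
proof (induction c N i j xs rule: t_poly.induct)
  case (1 c N i j)
  have "(\<Sum>a=1..N. scal (C a i) * t_poly c N a j []) = 0"
    by (intro sum.neutral) (auto simp: 1)
  then show ?case
    by (auto simp: gl_act_def free_derivation_zero free_derivation_one)
next
  case (2 c N i j x)
  then show ?case using gl_act_Ew[OF 2(1) 2(4) 2(3), of x] by simp
next
  case (3 c N i j x y xs)
  define T where "T a = t_poly c N a j (y # xs)" for a
  define T' where "T' a = t_poly c N a j (x * y # xs)" for a
  have IH: "gl_act N C (T a) - (\<Sum>b=1..N. scal (C b a) * T b) \<in> \<I> N" if "a \<in> {1..N}" for a
    using "3.IH"(1)[of a] 3 that by (simp add: T_def)
  have IH': "gl_act N C (T' i) - (\<Sum>b=1..N. scal (C b i) * T' b) \<in> \<I> N"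
    using "3.IH"(2) 3 by (simp add: T'_def)
  have TC: "T a \<in> U.C N" if "a \<in> {1..N}" for a
    using that 3 by (auto simp: T_def)
  have e: "gl_act N C (Ew i a x) - ((\<Sum>b=1..N. scal (C b i) * Ew b a x) - (\<Sum>b=1..N. scal (C a b) * Ew i b x))
    \<in> \<I> N" if "a \<in> {1..N}" for a
    using gl_act_Ew[of C N i a x] that 3 by simp
  have "(gl_act N C (Ew i a x) - ((\<Sum>b=1..N. scal (C b i) * Ew b a x) - (\<Sum>b=1..N. scal (C a b) * Ew i b x))) * T a
     + Ew i a x * (gl_act N C (T a) - (\<Sum>b=1..N. scal (C b a) * T b)) \<in> \<I> N"
    if "a \<in> {1..N}" for a
    using U.I_add[OF U.I_rmult[OF e[OF that] TC[OF that]] U.I_lmult[OF IH[OF that]]] that 3 by blast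
  then have total: "(\<Sum>a=1..N. (gl_act N C (Ew i a x) - ((\<Sum>b=1..N. scal (C b i) * Ew b a x) - (\<Sum>b=1..N. scal (C a b) * Ew i b x))) * T a
     + Ew i a x * (gl_act N C (T a) - (\<Sum>b=1..N. scal (C b a) * T b)))
     + scal c * (gl_act N C (T' i) - (\<Sum>b=1..N. scal (C b i) * T' b)) \<in> \<I> N"
    by (rule U.I_add[OF U.I_sum U.I_lmult[OF IH']]) auto
  \<comment> \<open>At an inner index the factors on its two sides contribute the same double sum
    with opposite signs.\<close>
  have e1: "(\<Sum>a=1..N. (\<Sum>b=1..N. scal (C a b) * Ew i b x) * T a) =
      (\<Sum>a=1..N. Ew i a x * (\<Sum>b=1..N. scal (C b a) * T b))"
    by (simp add: sum_distrib_left sum_distrib_right mult_scal_left mult.assoc) (rule sum.swap)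
  have e2: "(\<Sum>a=1..N. (\<Sum>b=1..N. scal (C b i) * Ew b a x) * T a) + scal c * (\<Sum>b=1..N. scal (C b i) * T' b)
     = (\<Sum>b=1..N. scal (C b i) * t_poly c N b j (x # y # xs))"
  proof -
    have "(\<Sum>a=1..N. (\<Sum>b=1..N. scal (C b i) * Ew b a x) * T a) =
       (\<Sum>b=1..N. scal (C b i) * (\<Sum>a=1..N. Ew b a x * T a))"
      by (simp add: sum_distrib_left sum_distrib_right mult.assoc) (rule sum.swap)
    moreover have "scal c * (\<Sum>b=1..N. scal (C b i) * T' b) = (\<Sum>b=1..N. scal (C b i) * (scal c * T' b))"
      unfolding sum_distrib_left by (intro sum.cong refl mult_scal_left)
    ultimately show ?thesis
      by (simp only: t_poly.simps(3) T_def[symmetric] T'_def[symmetric] distrib_left sum.distrib)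
  qed
  have e3: "gl_act N C (t_poly c N i j (x # y # xs)) =
     (\<Sum>a=1..N. gl_act N C (Ew i a x) * T a + Ew i a x * gl_act N C (T a)) + scal c * gl_act N C (T' i)"
    by (simp only: t_poly.simps(3) T_def T'_def gl_act_add gl_act_sum gl_act_const gl_act_mult mult_zero_left add_0_left)
  have regroup: "s1 - (p - q) + (s2 - r) + (u - v) = (s1 + s2) + u - (p + v)"
    if "q = r" for s1 s2 p q r u v :: "(nat \<Rightarrow> nat \<Rightarrow> 'a) list \<Rightarrow>\<^sub>0 complex"
    using that by simp
  from total show ?case
    unfolding left_diff_distrib right_diff_distrib sum.distrib sum_subtractf regroup[OF e1] e2 e3 .
qed

lemma gl_act_t_poly_invariant:
  assumes "C \<in> gl_sub d N" "i \<in> {1..d}" "j \<in> {1..d}" "d \<le> N"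
  shows "gl_act N C (t_poly c N i j xs) \<in> \<I> N"
proof -
  have "C j a = 0" "C a i = 0" for a
    using assms by (force simp: gl_sub_def)+
  moreover have "C \<in> gl_sub 0 N" using assms gl_sub_mono[of 0 d N] by auto
  ultimately show ?thesis
    using gl_act_t_poly[of C N j i c xs] assms by simp
qed

end

subsection \<open>The projections\<close>

lemma left_ideal_generated_props:
  shows left_ideal_generated_gen: "x \<in> S \<Longrightarrow> x \<in> left_ideal_generated A S"
    and left_ideal_generated_add: "x \<in> left_ideal_generated A S \<Longrightarrow> y \<in> left_ideal_generated A S \<Longrightarrow>
      x \<oplus>\<^bsub>A\<^esub> y \<in> left_ideal_generated A S"
    and left_ideal_generated_zero: "\<zero>\<^bsub>A\<^esub> \<in> left_ideal_generated A S"
    and left_ideal_generated_mult: "a \<in> carrier A \<Longrightarrow> x \<in> left_ideal_generated A S \<Longrightarrow>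
      a \<otimes>\<^bsub>A\<^esub> x \<in> left_ideal_generated A S"
  by (auto simp: left_ideal_generated_def intro: additive_subgroup.a_closed additive_subgroup.zero_closed)

lemma right_ideal_generated_props:
  shows right_ideal_generated_gen: "x \<in> S \<Longrightarrow> x \<in> right_ideal_generated A S"
    and right_ideal_generated_add: "x \<in> right_ideal_generated A S \<Longrightarrow> y \<in> right_ideal_generated A S \<Longrightarrow>
      x \<oplus>\<^bsub>A\<^esub> y \<in> right_ideal_generated A S"
    and right_ideal_generated_zero: "\<zero>\<^bsub>A\<^esub> \<in> right_ideal_generated A S"
    and right_ideal_generated_mult: "a \<in> carrier A \<Longrightarrow> x \<in> right_ideal_generated A S \<Longrightarrow>
      x \<otimes>\<^bsub>A\<^esub> a \<in> right_ideal_generated A S"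
  by (auto simp: right_ideal_generated_def intro: additive_subgroup.a_closed additive_subgroup.zero_closed)

lemma left_ideal_generated_least:
  assumes "additive_subgroup J A" "S \<subseteq> J" "\<And>a x. a \<in> carrier A \<Longrightarrow> x \<in> J \<Longrightarrow> a \<otimes>\<^bsub>A\<^esub> x \<in> J"
  shows "left_ideal_generated A S \<subseteq> J"
  using assms by (auto simp: left_ideal_generated_def)

lemma right_ideal_generated_least:
  assumes "additive_subgroup J A" "S \<subseteq> J" "\<And>a x. a \<in> carrier A \<Longrightarrow> x \<in> J \<Longrightarrow> x \<otimes>\<^bsub>A\<^esub> a \<in> J"
  shows "right_ideal_generated A S \<subseteq> J"
  using assms by (auto simp: right_ideal_generated_def)

context countable_dim_algebra
begin

section \<open>Lifts of the ideals I+(N) and I-(N)\<close>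

lemma E_elem_cls: "E_elem scale N i j x = U.cls N (Ew i j x)"
  by (simp add: E_elem_def U.cls_def Ew_def)

definition Iplus :: "nat \<Rightarrow> ((nat \<Rightarrow> nat \<Rightarrow> 'a) list \<Rightarrow>\<^sub>0 complex) set" where
  "Iplus N = {f \<in> U.C N. U.cls N f \<in> I_plus scale N}"

definition Iminus :: "nat \<Rightarrow> ((nat \<Rightarrow> nat \<Rightarrow> 'a) list \<Rightarrow>\<^sub>0 complex) set" where
  "Iminus N = {f \<in> U.C N. U.cls N f \<in> I_minus scale N}"

lemma Iplus_C: "f \<in> Iplus N \<Longrightarrow> f \<in> U.C N" and Iminus_C: "f \<in> Iminus N \<Longrightarrow> f \<in> U.C N"
  by (simp_all add: Iplus_def Iminus_def)

lemma Iplus_ideal: "f \<in> \<I> N \<Longrightarrow> f \<in> Iplus N" and Iminus_ideal: "f \<in> \<I> N \<Longrightarrow> f \<in> Iminus N"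
  using left_ideal_generated_zero[of "\<U> N"] right_ideal_generated_zero[of "\<U> N"]
    U.cls_eq_iff[of N f 0] U.I_subset[of f N]
  by (auto simp: Iplus_def Iminus_def I_plus_def I_minus_def U.Q_zero)

lemma Iplus_add: "f \<in> Iplus N \<Longrightarrow> g \<in> Iplus N \<Longrightarrow> f + g \<in> Iplus N"
  using left_ideal_generated_add[of "U.cls N f" "\<U> N" _ "U.cls N g"]
  by (auto simp: Iplus_def I_plus_def)

lemma Iminus_add: "f \<in> Iminus N \<Longrightarrow> g \<in> Iminus N \<Longrightarrow> f + g \<in> Iminus N"
  using right_ideal_generated_add[of "U.cls N f" "\<U> N" _ "U.cls N g"]
  by (auto simp: Iminus_def I_minus_def)

lemma Iplus_mult: "a \<in> U.C N \<Longrightarrow> f \<in> Iplus N \<Longrightarrow> a * f \<in> Iplus N"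
  using left_ideal_generated_mult[of "U.cls N a" "\<U> N" "U.cls N f"]
  by (auto simp: Iplus_def I_plus_def)

lemma Iminus_mult: "a \<in> U.C N \<Longrightarrow> f \<in> Iminus N \<Longrightarrow> f * a \<in> Iminus N"
  using right_ideal_generated_mult[of "U.cls N a" "\<U> N" "U.cls N f"]
  by (auto simp: Iminus_def I_minus_def)

lemma Iplus_zero: "0 \<in> Iplus N" and Iminus_zero: "0 \<in> Iminus N"
  by (auto intro: Iplus_ideal Iminus_ideal)

lemma Iplus_diff: "f \<in> Iplus N \<Longrightarrow> g \<in> Iplus N \<Longrightarrow> f - g \<in> Iplus N"
  using Iplus_add[of f N "- g"] Iplus_mult[of "- 1" N g] by auto

lemma Iminus_diff: "f \<in> Iminus N \<Longrightarrow> g \<in> Iminus N \<Longrightarrow> f - g \<in> Iminus N"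
  using Iminus_add[of f N "- g"] Iminus_mult[of "- 1" N g] by auto

lemma Iplus_smult: "f \<in> Iplus N \<Longrightarrow> scal c * f \<in> Iplus N" and Iminus_smult: "f \<in> Iminus N \<Longrightarrow> scal c * f \<in> Iminus N"
  using Iplus_mult[of "scal c" N f] Iminus_mult[of "scal c" N f] by (auto simp: scal_commute)

lemma Iplus_sum: "(\<And>i. i \<in> A \<Longrightarrow> f i \<in> Iplus N) \<Longrightarrow> sum f A \<in> Iplus N"
  by (induction A rule: infinite_finite_induct) (auto intro: Iplus_add Iplus_zero)

lemma Iminus_sum: "(\<And>i. i \<in> A \<Longrightarrow> f i \<in> Iminus N) \<Longrightarrow> sum f A \<in> Iminus N"
  by (induction A rule: infinite_finite_induct) (auto intro: Iminus_add Iminus_zero)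

lemma Ew_in_Iplus: "i \<in> {1..N} \<Longrightarrow> Ew i N x \<in> Iplus N"
proof -
  assume i: "i \<in> {1..N}"
  then have "E_elem scale N i N x \<in> I_plus scale N"
    unfolding I_plus_def by (intro left_ideal_generated_gen) blast
  then show "Ew i N x \<in> Iplus N" using i by (auto simp: Iplus_def E_elem_cls)
qed

lemma Ew_in_Iminus: "i \<in> {1..N} \<Longrightarrow> Ew N i x \<in> Iminus N"
proof -
  assume i: "i \<in> {1..N}"
  then have "E_elem scale N N i x \<in> I_minus scale N"
    unfolding I_minus_def by (intro right_ideal_generated_gen) blast
  then show "Ew N i x \<in> Iminus N" using i by (auto simp: Iminus_def E_elem_cls)
qed

lemma carrier_gl_pred: "M \<in> \<G> (N - 1) \<Longrightarrow> M \<in> \<G> N"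
  unfolding carrier_gl mem_Collect_eq
  by (metis atLeastAtMost_iff diff_le_self order_trans)

lemma C_pred: "f \<in> U.C (N - 1) \<Longrightarrow> f \<in> U.C N"
  using free_carrier_mono[of "\<G> (N - 1)" "\<G> N" f] carrier_gl_pred by blast

text \<open>The bracket of E_iN(x) with a matrix from gl(N-1, \<Omega>) is supported in column
  \<open>N\<close>. Hence E_iN(x) can be moved through \<open>w\<close> to the right end, and all
  corrections are again of this kind.\<close>

lemma Ew_Iplus_word:
  assumes "set w \<subseteq> \<G> (N - 1)" "i \<in> {1..N}"
  shows "Ew i N x * word w \<in> Iplus N"
  using assms
proof (induction w arbitrary: i x)
  case Nil
  then show ?case by (simp add: word_Nil Ew_in_Iplus)
next
  case (Cons M w)
  let ?u = "unit_matrix (omega scale) i N x"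
  have M: "M \<in> \<G> (N - 1)" and MN: "M \<in> \<G> N"
    using Cons.prems carrier_gl_pred by auto
  have w: "word w \<in> U.C N" using Cons.prems carrier_gl_pred by auto
  have u: "?u \<in> \<G> N" using Cons.prems by simp
  have zero: "gl_bracket N ?u M p q = 0" if "q \<noteq> N" for p q
  proof -
    have "M N q = 0" using M by (cases N) (auto simp: carrier_gl)
    then have "?u p a * M a q = 0" "M p a * ?u a q = 0" for a
      using that by (auto simp: unit_matrix_def)
    then show ?thesis by (simp add: gl_bracket_def)
  qed
  have "word [gl_bracket N ?u M] - (\<Sum>p=1..N. \<Sum>q=1..N. Ew p q (gl_bracket N ?u M p q)) \<in> \<I> N"
    by (intro word_gl_decomp gl_bracket_closed u MN)
  from U.I_rmult[OF this w] have "word [gl_bracket N ?u M] * word w -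
     (\<Sum>p=1..N. \<Sum>q=1..N. Ew p q (gl_bracket N ?u M p q)) * word w \<in> Iplus N"
    by (intro Iplus_ideal) (simp add: left_diff_distrib)
  moreover have "(\<Sum>p=1..N. \<Sum>q=1..N. Ew p q (gl_bracket N ?u M p q)) * word w \<in> Iplus N"
  proof -
    have "Ew p q (gl_bracket N ?u M p q) * word w \<in> Iplus N" if "p \<in> {1..N}" "q \<in> {1..N}" for p q
    proof (cases "q = N")
      case True
      then show ?thesis using Cons.IH[of p] Cons.prems that by simp
    next
      case False
      then show ?thesis using U.I_rmult[OF Ew_zero w] by (simp add: zero Iplus_ideal)
    qed
    then show ?thesis by (simp only: sum_distrib_right) (intro Iplus_sum)
  qed
  ultimately have br: "word [gl_bracket N ?u M] * word w \<in> Iplus N"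
    using Iplus_add by fastforce
  have "(Ew i N x * word [M] - word [M] * Ew i N x - word [gl_bracket N ?u M]) * word w \<in> Iplus N"
    using U.I_rmult[OF U_bracket[OF u MN] w] by (intro Iplus_ideal) (simp add: Ew_def)
  moreover have "word [M] * (Ew i N x * word w) \<in> Iplus N"
    using Cons.prems MN by (intro Iplus_mult Cons.IH) auto
  ultimately have "(Ew i N x * word [M] - word [M] * Ew i N x - word [gl_bracket N ?u M]) * word w +
     word [gl_bracket N ?u M] * word w + word [M] * (Ew i N x * word w) \<in> Iplus N"
    using br by (intro Iplus_add)
  then show ?case by (simp add: algebra_simps word_mult)
qed

text \<open>Mirror image of \<open>Ew_Iplus_word\<close>: the brackets are supported in row
  \<open>N\<close>, and the letters of \<open>w\<close> are passed from its right end.\<close>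

lemma word_Ew_Iminus:
  assumes "set w \<subseteq> \<G> (N - 1)" "j \<in> {1..N}"
  shows "word w * Ew N j x \<in> Iminus N"
  using assms
proof (induction w arbitrary: j x rule: rev_induct)
  case Nil
  then show ?case by (simp add: word_Nil Ew_in_Iminus)
next
  case (snoc M w)
  let ?u = "unit_matrix (omega scale) N j x"
  have M: "M \<in> \<G> (N - 1)" and MN: "M \<in> \<G> N"
    using snoc.prems carrier_gl_pred by auto
  have w: "word w \<in> U.C N" using snoc.prems carrier_gl_pred by auto
  have u: "?u \<in> \<G> N" using snoc.prems by simp
  have zero: "gl_bracket N M ?u p q = 0" if "p \<noteq> N" for p q
  proof -
    have "M p N = 0" using M by (cases N) (auto simp: carrier_gl)
    then have "?u p a * M a q = 0" "M p a * ?u a q = 0" for a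
      using that by (auto simp: unit_matrix_def)
    then show ?thesis by (simp add: gl_bracket_def)
  qed
  have "word [gl_bracket N M ?u] - (\<Sum>p=1..N. \<Sum>q=1..N. Ew p q (gl_bracket N M ?u p q)) \<in> \<I> N"
    by (intro word_gl_decomp gl_bracket_closed u MN)
  from U.I_lmult[OF this w] have "word w * word [gl_bracket N M ?u] -
     word w * (\<Sum>p=1..N. \<Sum>q=1..N. Ew p q (gl_bracket N M ?u p q)) \<in> Iminus N"
    by (intro Iminus_ideal) (simp add: right_diff_distrib)
  moreover have "word w * (\<Sum>p=1..N. \<Sum>q=1..N. Ew p q (gl_bracket N M ?u p q)) \<in> Iminus N"
  proof -
    have "word w * Ew p q (gl_bracket N M ?u p q) \<in> Iminus N" if "p \<in> {1..N}" "q \<in> {1..N}" for p q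
    proof (cases "p = N")
      case True
      then show ?thesis using snoc.IH[of q] snoc.prems that by simp
    next
      case False
      then show ?thesis using U.I_lmult[OF Ew_zero w] by (simp add: zero Iminus_ideal)
    qed
    then show ?thesis by (simp only: sum_distrib_left) (intro Iminus_sum)
  qed
  ultimately have br: "word w * word [gl_bracket N M ?u] \<in> Iminus N"
    using Iminus_add by fastforce
  have "word w * (word [M] * Ew N j x - Ew N j x * word [M] - word [gl_bracket N M ?u]) \<in> Iminus N"
    using U.I_lmult[OF U_bracket[OF MN u] w] by (intro Iminus_ideal) (simp add: Ew_def)
  moreover have "(word w * Ew N j x) * word [M] \<in> Iminus N"
    using snoc.prems MN by (intro Iminus_mult snoc.IH) auto
  ultimately have "word w * (word [M] * Ew N j x - Ew N j x * word [M] - word [gl_bracket N M ?u]) +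
     word w * word [gl_bracket N M ?u] + (word w * Ew N j x) * word [M] \<in> Iminus N"
    using br by (intro Iminus_add)
  then show ?case by (simp add: algebra_simps word_mult[symmetric, of w])
qed

lemma Ew_Iplus_C:
  assumes "g \<in> U.C (N - 1)" "i \<in> {1..N}"
  shows "Ew i N x * g \<in> Iplus N"
  using assms(1)
proof (induction rule: free_words_induct)
  case (word w)
  then show ?case using assms(2) by (rule Ew_Iplus_word)
qed (auto simp: distrib_left mult_scal_left intro: Iplus_add Iplus_smult)

lemma Iminus_Ew_C:
  assumes "g \<in> U.C (N - 1)" "i \<in> {1..N}"
  shows "g * Ew N i x \<in> Iminus N"
  using assms(1)
proof (induction rule: free_words_induct)
  case (word w)
  then show ?case using assms(2) by (rule word_Ew_Iminus)
qed (auto simp: distrib_right mult.assoc intro: Iminus_add Iminus_smult)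

lemma additive_subgroup_U:
  assumes "J \<subseteq> carrier (\<U> N)" "\<zero>\<^bsub>\<U> N\<^esub> \<in> J"
    "\<And>x y. x \<in> J \<Longrightarrow> y \<in> J \<Longrightarrow> x \<oplus>\<^bsub>\<U> N\<^esub> y \<in> J"
    "\<And>x. x \<in> J \<Longrightarrow> \<ominus>\<^bsub>\<U> N\<^esub> x \<in> J"
  shows "additive_subgroup J (\<U> N)"
proof -
  interpret ring "\<U> N" by (rule U.ring_Q)
  show ?thesis
    by (intro additive_subgroup.intro add.subgroupI) (use assms in \<open>auto simp: a_inv_def[symmetric]\<close>)
qed

text \<open>The elements whose right multiples by the enveloping algebra of gl(N-1, \<Omega>) stay
  in I+(N) form a left ideal, and by \<open>Ew_Iplus_C\<close> it contains the generators. This is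
  what makes the projection multiplicative.\<close>

lemma Iplus_rmult:
  assumes "f \<in> Iplus N" "g \<in> U.C (N - 1)"
  shows "f * g \<in> Iplus N"
proof -
  let ?U = "\<U> N"
  interpret ring ?U by (rule U.ring_Q)
  let ?J = "{u \<in> carrier ?U. \<forall>h\<in>U.C (N - 1). u \<otimes>\<^bsub>?U\<^esub> U.cls N h \<in> I_plus scale N}"
  have conv: "U.cls N h \<in> ?J \<longleftrightarrow> (\<forall>g\<in>U.C (N - 1). h * g \<in> Iplus N)" if "h \<in> U.C N" for h
    using that C_pred by (auto simp: Iplus_def)
  have "left_ideal_generated ?U {E_elem scale N i N x |i x. i \<in> {1..N}} \<subseteq> ?J"
  proof (rule left_ideal_generated_least)
    show "additive_subgroup ?J ?U"
    proof (rule additive_subgroup_U)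
      show "\<zero>\<^bsub>?U\<^esub> \<in> ?J" unfolding U.Q_zero by (subst conv) (auto intro: Iplus_zero)
      fix u v assume uv: "u \<in> ?J" "v \<in> ?J"
      then obtain a b where "a \<in> U.C N" "b \<in> U.C N" "u = U.cls N a" "v = U.cls N b"
        by (auto elim!: U.Q_cases)
      with uv show "u \<oplus>\<^bsub>?U\<^esub> v \<in> ?J"
        by (simp only: U.Q_add conv free_carrier_closed) (simp add: distrib_right Iplus_add)
    next
      fix u assume u: "u \<in> ?J"
      then obtain a where "a \<in> U.C N" "u = U.cls N a"
        by (auto elim!: U.Q_cases)
      with u show "\<ominus>\<^bsub>?U\<^esub> u \<in> ?J"
        using Iplus_diff[OF Iplus_zero] by (simp only: U.Q_uminus conv free_carrier_closed) simp
    qed auto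
    show "{E_elem scale N i N x |i x. i \<in> {1..N}} \<subseteq> ?J"
    proof
      fix u assume "u \<in> {E_elem scale N i N x |i x. i \<in> {1..N}}"
      then obtain i x where i: "i \<in> {1..N}" and u: "u = U.cls N (Ew i N x)"
        by (auto simp: E_elem_cls)
      have "Ew i N x \<in> U.C N" using i by auto
      then show "u \<in> ?J" using Ew_Iplus_C[OF _ i] unfolding u conv[OF \<open>Ew i N x \<in> U.C N\<close>] by blast
    qed
    fix a u assume a: "a \<in> carrier ?U" and u: "u \<in> ?J"
    then obtain a' u' where *: "a' \<in> U.C N" "u' \<in> U.C N" "a = U.cls N a'" "u = U.cls N u'"
      by (auto elim!: U.Q_cases)
    have "a' * u' * g \<in> Iplus N" if "g \<in> U.C (N - 1)" for g
      using u that Iplus_mult[of a' N "u' * g"] * conv by (simp add: mult.assoc)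
    then show "a \<otimes>\<^bsub>?U\<^esub> u \<in> ?J" using * by (simp only: U.Q_mult conv free_carrier_closed) simp
  qed
  then have "U.cls N f \<in> ?J" using assms(1) by (auto simp: Iplus_def I_plus_def)
  then show ?thesis using assms(2) conv[OF Iplus_C[OF assms(1)]] by blast
qed

text \<open>Mirror image of \<open>Iplus_rmult\<close>, with a right ideal and left
  multiples.\<close>

lemma Iminus_lmult:
  assumes "f \<in> Iminus N" "g \<in> U.C (N - 1)"
  shows "g * f \<in> Iminus N"
proof -
  let ?U = "\<U> N"
  interpret ring ?U by (rule U.ring_Q)
  let ?J = "{u \<in> carrier ?U. \<forall>h\<in>U.C (N - 1). U.cls N h \<otimes>\<^bsub>?U\<^esub> u \<in> I_minus scale N}"
  have conv: "U.cls N h \<in> ?J \<longleftrightarrow> (\<forall>g\<in>U.C (N - 1). g * h \<in> Iminus N)" if "h \<in> U.C N" for h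
    using that C_pred by (auto simp: Iminus_def)
  have "right_ideal_generated ?U {E_elem scale N N i x |i x. i \<in> {1..N}} \<subseteq> ?J"
  proof (rule right_ideal_generated_least)
    show "additive_subgroup ?J ?U"
    proof (rule additive_subgroup_U)
      show "\<zero>\<^bsub>?U\<^esub> \<in> ?J" unfolding U.Q_zero by (subst conv) (auto intro: Iminus_zero)
      fix u v assume uv: "u \<in> ?J" "v \<in> ?J"
      then obtain a b where "a \<in> U.C N" "b \<in> U.C N" "u = U.cls N a" "v = U.cls N b"
        by (auto elim!: U.Q_cases)
      with uv show "u \<oplus>\<^bsub>?U\<^esub> v \<in> ?J"
        by (simp only: U.Q_add conv free_carrier_closed) (simp add: distrib_left Iminus_add)
    next
      fix u assume u: "u \<in> ?J"
      then obtain a where "a \<in> U.C N" "u = U.cls N a"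
        by (auto elim!: U.Q_cases)
      with u show "\<ominus>\<^bsub>?U\<^esub> u \<in> ?J"
        using Iminus_diff[OF Iminus_zero] by (simp only: U.Q_uminus conv free_carrier_closed) simp
    qed auto
    show "{E_elem scale N N i x |i x. i \<in> {1..N}} \<subseteq> ?J"
    proof
      fix u assume "u \<in> {E_elem scale N N i x |i x. i \<in> {1..N}}"
      then obtain i x where i: "i \<in> {1..N}" and u: "u = U.cls N (Ew N i x)"
        by (auto simp: E_elem_cls)
      have "Ew N i x \<in> U.C N" using i by auto
      then show "u \<in> ?J" using Iminus_Ew_C[OF _ i] unfolding u conv[OF \<open>Ew N i x \<in> U.C N\<close>] by blast
    qed
    fix a u assume a: "a \<in> carrier ?U" and u: "u \<in> ?J"
    then obtain a' u' where *: "a' \<in> U.C N" "u' \<in> U.C N" "a = U.cls N a'" "u = U.cls N u'"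
      by (auto elim!: U.Q_cases)
    have "g * (u' * a') \<in> Iminus N" if "g \<in> U.C (N - 1)" for g
      using u that Iminus_mult[of a' N "g * u'"] * conv by (simp add: mult.assoc)
    then show "u \<otimes>\<^bsub>?U\<^esub> a \<in> ?J" using * by (simp only: U.Q_mult conv free_carrier_closed) simp
  qed
  then have "U.cls N f \<in> ?J" using assms(1) by (auto simp: Iminus_def I_minus_def)
  then show ?thesis using assms(2) conv[OF Iminus_C[OF assms(1)]] by blast
qed

text \<open>All values of \<open>a\<close> are treated together, as the induction passes through
  every inner index. Moving E_iN(x) past E_ab(y) leaves the merged letter x y if
  \<open>a = N\<close>, and a term E_aN(y x) if \<open>b = i\<close>.\<close>

lemma Ew_t_poly_Iplus:
  assumes j: "j \<in> {1..N - 1}" and "i \<in> {1..N}" "a \<in> {1..N}"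
  shows "Ew i N x * t_poly c N a j (y # zs) - (if a = N then t_poly c N i j (x * y # zs) else 0) \<in> Iplus N"
  using assms(2,3)
proof (induction zs arbitrary: i a x y)
  case Nil
  have "Ew i N x * Ew a j y - Ew a j y * Ew i N x -
      ((if a = N then Ew i j (x * y) else 0) - (if i = j then Ew a N (y * x) else 0)) \<in> Iplus N"
    using Nil j by (intro Iplus_ideal Ew_bracket) auto
  moreover have "Ew a j y * Ew i N x \<in> Iplus N" "(if i = j then Ew a N (y * x) else 0) \<in> Iplus N"
    using Nil j by (auto intro!: Iplus_mult Ew_in_Iplus Iplus_zero)
  ultimately have "(Ew i N x * Ew a j y - Ew a j y * Ew i N x -
      ((if a = N then Ew i j (x * y) else 0) - (if i = j then Ew a N (y * x) else 0))) +
      Ew a j y * Ew i N x - (if i = j then Ew a N (y * x) else 0) \<in> Iplus N"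
    by (intro Iplus_add Iplus_diff[OF Iplus_add])
  then show ?case by (cases "a = N") (simp_all add: algebra_simps)
next
  case (Cons z zs)
  define T where "T b = t_poly c N b j (z # zs)" for b
  define S where "S = t_poly c N i j (x * z # zs)"
  \<comment> \<open>Two stray terms reduce to \<open>R\<close> by the induction hypothesis, one from
    E_aN(y) with the list starting in x z, one from E_aN(y x) with the list starting in z. By
    associativity they agree, and they cancel.\<close>
  define R where "R = (if i = N then t_poly c N a j (y * x * z # zs) else 0)"
  \<comment> \<open>The case distinction on \<open>a\<close> is turned into a factor that can be
    taken out of sums.\<close>
  define \<delta> where "\<delta> = (if a = N then 1 else 0 :: (nat \<Rightarrow> nat \<Rightarrow> 'a) list \<Rightarrow>\<^sub>0 complex)"
  note pr = Cons.prems j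
  have NN: "N \<in> {1..N}" using pr by auto
  have TC: "T b \<in> U.C N" if "b \<in> {1..N}" for b using that j unfolding T_def by auto
  have 1: "Ew a b y * (Ew i N x * T b - (if b = N then S else 0)) \<in> Iplus N" if "b \<in> {1..N}" for b
    unfolding T_def S_def using Cons.IH[of i b x z] that pr by (intro Iplus_mult) auto
  have 2: "Ew a N y * S - R \<in> Iplus N"
    unfolding S_def R_def using Cons.IH[of a i y "x * z"] pr by (auto simp: mult.assoc)
  have 3: "Ew a N (y * x) * T i - R \<in> Iplus N"
    unfolding T_def R_def using Cons.IH[of a i "y * x" z] pr by simp
  have 4: "(Ew i N x * Ew a b y - Ew a b y * Ew i N x -
      ((if a = N then Ew i b (x * y) else 0) - (if i = b then Ew a N (y * x) else 0))) * T b \<in> Iplus N"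
    if "b \<in> {1..N}" for b
    using U.I_rmult[OF Ew_bracket TC[OF that], of i N a b x y] NN that pr by (intro Iplus_ideal) simp
  have 5: "scal c * (Ew i N x * t_poly c N a j (y * z # zs) - (if a = N then t_poly c N i j (x * (y * z) # zs) else 0)) \<in> Iplus N"
    using Cons.IH[of i a x "y * z"] pr by (intro Iplus_smult)
  have "(\<Sum>b=1..N. (Ew i N x * Ew a b y - Ew a b y * Ew i N x -
      ((if a = N then Ew i b (x * y) else 0) - (if i = b then Ew a N (y * x) else 0))) * T b +
      Ew a b y * (Ew i N x * T b - (if b = N then S else 0))) + (Ew a N y * S - R) - (Ew a N (y * x) * T i - R) +
      scal c * (Ew i N x * t_poly c N a j (y * z # zs) - (if a = N then t_poly c N i j (x * (y * z) # zs) else 0)) \<in> Iplus N"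
      (is "?s + ?u - ?v + ?w \<in> _")
    by (intro Iplus_add Iplus_diff[OF Iplus_add] Iplus_sum 1 2 3 4 5)
  also have "?s =
      (\<Sum>b=1..N. Ew i N x * (Ew a b y * T b) - \<delta> * (Ew i b (x * y) * T b) +
        (if i = b then Ew a N (y * x) * T i else 0) - (if b = N then Ew a N y * S else 0))"
    by (intro sum.cong) (auto simp: \<delta>_def algebra_simps)
  also have "\<dots> = Ew i N x * (\<Sum>b=1..N. Ew a b y * T b) - \<delta> * (\<Sum>b=1..N. Ew i b (x * y) * T b) +
      Ew a N (y * x) * T i - Ew a N y * S"
    using pr NN by (simp add: sum.distrib sum_subtractf sum_distrib_left)
  also have "\<dots> + ?u - ?v + ?w =
      Ew i N x * t_poly c N a j (y # z # zs) - \<delta> * t_poly c N i j (x * y # z # zs)"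
    by (simp add: T_def[symmetric] \<delta>_def algebra_simps mult_scal_left)
  finally show ?case by (simp add: \<delta>_def del: t_poly.simps split: if_splits)
qed

text \<open>The recursion read from the right: compositions are split according to whether their
  last part is 1. It is needed because elements of I-(N) may only be multiplied freely from the
  right.\<close>

lemma t_poly_snoc:
  "t_poly c N i j (zs @ [z, y]) = (\<Sum>b=1..N. t_poly c N i b (zs @ [z]) * Ew b j y) + scal c * t_poly c N i j (zs @ [z * y])"
proof (induction c N i j zs rule: t_poly.induct)
  case (2 c N i j x)
  have "t_poly c N i j ([x] @ [z, y]) = (\<Sum>a=1..N. Ew i a x * ((\<Sum>b=1..N. Ew a b z * Ew b j y) + scal c * Ew a j (z * y))) +
     scal c * ((\<Sum>b=1..N. Ew i b (x * z) * Ew b j y) + scal c * Ew i j (x * z * y))"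
    by simp
  also have "(\<Sum>a=1..N. Ew i a x * ((\<Sum>b=1..N. Ew a b z * Ew b j y) + scal c * Ew a j (z * y))) =
      (\<Sum>b=1..N. \<Sum>a=1..N. Ew i a x * Ew a b z * Ew b j y) + scal c * (\<Sum>a=1..N. Ew i a x * Ew a j (z * y))"
    by (simp add: distrib_left sum.distrib sum_distrib_left mult.assoc mult_scal_left) (rule sum.swap)
  finally show ?case
    by (simp add: sum_distrib_left sum_distrib_right distrib_left distrib_right sum.distrib mult.assoc)
next
  case (3 c N i j x w zs)
  have "t_poly c N i j ((x # w # zs) @ [z, y]) =
     (\<Sum>a=1..N. Ew i a x * ((\<Sum>b=1..N. t_poly c N a b (w # zs @ [z]) * Ew b j y) + scal c * t_poly c N a j (w # zs @ [z * y]))) +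
     scal c * ((\<Sum>b=1..N. t_poly c N i b (x * w # zs @ [z]) * Ew b j y) + scal c * t_poly c N i j (x * w # zs @ [z * y]))"
    using 3 by simp
  also have "(\<Sum>a=1..N. Ew i a x * ((\<Sum>b=1..N. t_poly c N a b (w # zs @ [z]) * Ew b j y) + scal c * t_poly c N a j (w # zs @ [z * y]))) =
      (\<Sum>b=1..N. \<Sum>a=1..N. Ew i a x * t_poly c N a b (w # zs @ [z]) * Ew b j y) +
       scal c * (\<Sum>a=1..N. Ew i a x * t_poly c N a j (w # zs @ [z * y]))"
    by (simp add: distrib_left sum.distrib sum_distrib_left mult.assoc mult_scal_left) (rule sum.swap)
  finally show ?case
    by (simp add: sum_distrib_left sum_distrib_right distrib_left distrib_right sum.distrib mult.assoc)
qed simp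

text \<open>Mirror image of \<open>Ew_t_poly_Iplus\<close>, with \<open>t_poly_snoc\<close> in the
  role of the defining recursion.\<close>

lemma t_poly_Ew_Iminus:
  assumes i: "i \<in> {1..N - 1}" and "j \<in> {1..N}" "a \<in> {1..N}"
  shows "t_poly c N i a (zs @ [y]) * Ew N j x - (if a = N then t_poly c N i j (zs @ [y * x]) else 0) \<in> Iminus N"
  using assms(2,3)
proof (induction zs arbitrary: j a x y rule: rev_induct)
  case Nil
  have "Ew i a y * Ew N j x - Ew N j x * Ew i a y -
      ((if N = a then Ew i j (y * x) else 0) - (if i = j then Ew N a (x * y) else 0)) \<in> Iminus N"
    using Nil i by (intro Iminus_ideal Ew_bracket) auto
  moreover have "Ew N j x * Ew i a y \<in> Iminus N" "(if i = j then Ew N a (x * y) else 0) \<in> Iminus N"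
    using Nil i by (auto intro!: Iminus_mult Ew_in_Iminus Iminus_zero)
  ultimately have "(Ew i a y * Ew N j x - Ew N j x * Ew i a y -
      ((if N = a then Ew i j (y * x) else 0) - (if i = j then Ew N a (x * y) else 0))) +
      Ew N j x * Ew i a y - (if i = j then Ew N a (x * y) else 0) \<in> Iminus N"
    by (intro Iminus_add Iminus_diff[OF Iminus_add])
  then show ?case by (auto simp: algebra_simps)
next
  case (snoc z zs)
  define T where "T b = t_poly c N i b (zs @ [z])" for b
  define S where "S = t_poly c N i j (zs @ [z * x])"
  define R where "R = (if j = N then t_poly c N i a (zs @ [z * x * y]) else 0)"
  define \<delta> where "\<delta> = (if a = N then 1 else 0 :: (nat \<Rightarrow> nat \<Rightarrow> 'a) list \<Rightarrow>\<^sub>0 complex)"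
  note pr = snoc.prems i
  have NN: "N \<in> {1..N}" using pr by auto
  have TC: "T b \<in> U.C N" if "b \<in> {1..N}" for b using that i unfolding T_def by auto
  have 1: "(T b * Ew N j x - (if b = N then S else 0)) * Ew b a y \<in> Iminus N" if "b \<in> {1..N}" for b
    unfolding T_def S_def using snoc.IH[of j b z x] that pr by (intro Iminus_mult) auto
  have 2: "S * Ew N a y - R \<in> Iminus N"
    unfolding S_def R_def using snoc.IH[of a j "z * x" y] pr by (simp add: mult.assoc)
  have 3: "T j * Ew N a (x * y) - R \<in> Iminus N"
    unfolding T_def R_def using snoc.IH[of a j z "x * y"] pr by (auto simp: mult.assoc)
  have 4: "T b * (Ew b a y * Ew N j x - Ew N j x * Ew b a y -
      ((if N = a then Ew b j (y * x) else 0) - (if b = j then Ew N a (x * y) else 0))) \<in> Iminus N"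
    if "b \<in> {1..N}" for b
    using U.I_lmult[OF Ew_bracket TC[OF that], of b a N j y x] NN that pr by (intro Iminus_ideal) simp
  have 5: "scal c * (t_poly c N i a (zs @ [z * y]) * Ew N j x - (if a = N then t_poly c N i j (zs @ [z * y * x]) else 0)) \<in> Iminus N"
    using snoc.IH[of j a "z * y" x] pr by (intro Iminus_smult)
  have "(\<Sum>b=1..N. T b * (Ew b a y * Ew N j x - Ew N j x * Ew b a y -
      ((if N = a then Ew b j (y * x) else 0) - (if b = j then Ew N a (x * y) else 0))) +
      (T b * Ew N j x - (if b = N then S else 0)) * Ew b a y) + (S * Ew N a y - R) - (T j * Ew N a (x * y) - R) +
      scal c * (t_poly c N i a (zs @ [z * y]) * Ew N j x - (if a = N then t_poly c N i j (zs @ [z * y * x]) else 0)) \<in> Iminus N"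
      (is "?s + ?u - ?v + ?w \<in> _")
    by (intro Iminus_add Iminus_diff[OF Iminus_add] Iminus_sum 1 2 3 4 5)
  also have "?s =
      (\<Sum>b=1..N. T b * Ew b a y * Ew N j x - \<delta> * (T b * Ew b j (y * x)) +
        (if j = b then T j * Ew N a (x * y) else 0) - (if b = N then S * Ew N a y else 0))"
    by (intro sum.cong) (auto simp: \<delta>_def algebra_simps)
  also have "\<dots> = (\<Sum>b=1..N. T b * Ew b a y) * Ew N j x - \<delta> * (\<Sum>b=1..N. T b * Ew b j (y * x)) +
      T j * Ew N a (x * y) - S * Ew N a y"
    using pr NN by (simp add: sum.distrib sum_subtractf sum_distrib_left sum_distrib_right)
  also have "\<dots> + ?u - ?v + ?w =
      t_poly c N i a (zs @ [z, y]) * Ew N j x - \<delta> * t_poly c N i j (zs @ [z, y * x])"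
    by (simp add: T_def[symmetric] \<delta>_def algebra_simps t_poly_snoc)
  finally show ?case by (simp add: \<delta>_def del: t_poly.simps split: if_splits)
qed

lemma t_poly_stable_Iplus:
  assumes "i \<in> {1..N - 1}" "j \<in> {1..N - 1}"
  shows "t_poly c N i j xs - t_poly (c + 1) (N - 1) i j xs \<in> Iplus N"
  using assms
proof (induction c N i j xs rule: t_poly.induct)
  case (3 c N i j x y xs)
  have N: "1 \<le> N" using 3 by auto
  have IH: "Ew i a x * (t_poly c N a j (y # xs) - t_poly (c + 1) (N - 1) a j (y # xs)) \<in> Iplus N" if "a \<in> {1..N - 1}" for a
    using "3.IH"(1)[of a] 3 that by (intro Iplus_mult) auto
  \<comment> \<open>The inner index \<open>N\<close> contributes one further copy of the merged
    term, on top of the \<open>c\<close> copies in the recursion.\<close>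
  have v: "Ew i N x * t_poly c N N j (y # xs) - t_poly c N i j (x * y # xs) \<in> Iplus N"
    using Ew_t_poly_Iplus[of j N i N x c y xs] 3 by auto
  have IH': "scal (c + 1) * (t_poly c N i j (x * y # xs) - t_poly (c + 1) (N - 1) i j (x * y # xs)) \<in> Iplus N"
    using "3.IH"(2) 3 by (intro Iplus_smult) auto
  have total: "(\<Sum>a=1..N - 1. Ew i a x * (t_poly c N a j (y # xs) - t_poly (c + 1) (N - 1) a j (y # xs))) +
     (Ew i N x * t_poly c N N j (y # xs) - t_poly c N i j (x * y # xs)) +
     scal (c + 1) * (t_poly c N i j (x * y # xs) - t_poly (c + 1) (N - 1) i j (x * y # xs)) \<in> Iplus N"
    by (intro Iplus_add Iplus_sum IH v IH')
  have e1: "t_poly c N i j (x # y # xs) = (\<Sum>a=1..N - 1. Ew i a x * t_poly c N a j (y # xs)) +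
     Ew i N x * t_poly c N N j (y # xs) + scal c * t_poly c N i j (x * y # xs)"
    unfolding t_poly.simps sum_split_last[OF N] ..
  have e2: "t_poly (c + 1) (N - 1) i j (x # y # xs) = (\<Sum>a=1..N - 1. Ew i a x * t_poly (c + 1) (N - 1) a j (y # xs)) +
     scal (c + 1) * t_poly (c + 1) (N - 1) i j (x * y # xs)"
    unfolding t_poly.simps ..
  from total show ?case
    unfolding e1 e2 right_diff_distrib sum_subtractf regroup_stable[OF scal_add_one] .
qed (auto intro: Iplus_zero)

text \<open>The induction is on the length with \<open>j\<close> varying, because splitting off the
  last letter changes the right index.\<close>

lemma t_poly_stable_Iminus:
  assumes "i \<in> {1..N - 1}" "j \<in> {1..N - 1}"
  shows "t_poly c N i j xs - t_poly (c + 1) (N - 1) i j xs \<in> Iminus N"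
  using assms
proof (induction "length xs" arbitrary: xs j rule: less_induct)
  case less
  note pr = less.prems
  consider "xs = []" | x where "xs = [x]" | zs x y where "xs = zs @ [x, y]"
    by (metis append_Cons append_assoc append_Nil rev_exhaust)
  then show ?case
  proof cases
    case 3
    have N: "1 \<le> N" using pr by auto
    have IH: "(t_poly c N i a (zs @ [x]) - t_poly (c + 1) (N - 1) i a (zs @ [x])) * Ew a j y \<in> Iminus N" if "a \<in> {1..N - 1}" for a
      using less.hyps[of "zs @ [x]" a] 3 pr that by (intro Iminus_mult) auto
    have v: "t_poly c N i N (zs @ [x]) * Ew N j y - t_poly c N i j (zs @ [x * y]) \<in> Iminus N"
      using t_poly_Ew_Iminus[of i N j N c zs x y] pr by auto
    have IH': "scal (c + 1) * (t_poly c N i j (zs @ [x * y]) - t_poly (c + 1) (N - 1) i j (zs @ [x * y])) \<in> Iminus N"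
      using less.hyps[of "zs @ [x * y]" j] 3 pr by (intro Iminus_smult) auto
    have total: "(\<Sum>a=1..N - 1. (t_poly c N i a (zs @ [x]) - t_poly (c + 1) (N - 1) i a (zs @ [x])) * Ew a j y) +
      (t_poly c N i N (zs @ [x]) * Ew N j y - t_poly c N i j (zs @ [x * y])) +
      scal (c + 1) * (t_poly c N i j (zs @ [x * y]) - t_poly (c + 1) (N - 1) i j (zs @ [x * y])) \<in> Iminus N"
      by (intro Iminus_add Iminus_sum IH v IH')
    have e1: "t_poly c N i j xs = (\<Sum>a=1..N - 1. t_poly c N i a (zs @ [x]) * Ew a j y) +
      t_poly c N i N (zs @ [x]) * Ew N j y + scal c * t_poly c N i j (zs @ [x * y])"
      unfolding 3 t_poly_snoc sum_split_last[OF N] ..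
    have e2: "t_poly (c + 1) (N - 1) i j xs = (\<Sum>a=1..N - 1. t_poly (c + 1) (N - 1) i a (zs @ [x]) * Ew a j y) +
      scal (c + 1) * t_poly (c + 1) (N - 1) i j (zs @ [x * y])"
      unfolding 3 t_poly_snoc ..
    from total show ?thesis
      unfolding e1 e2 left_diff_distrib right_diff_distrib sum_subtractf regroup_stable[OF scal_add_one] .
  qed (auto intro: Iminus_zero)
qed

end

text \<open>Keeps \<open>{1..N}\<close> and \<open>N - 1\<close> in the form in which they occur in the definitions.\<close>

declare One_nat_def [simp del]

subsection \<open>The elements \<open>t\<^sub>i\<^sub>j\<close>\<close>

lemma finite_compositions: "finite (compositions m)"
proof (rule finite_subset)
  show "compositions m \<subseteq> {\<nu>. set \<nu> \<subseteq> {..m} \<and> length \<nu> \<le> m}"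
  proof
    fix \<nu> assume "\<nu> \<in> compositions m"
    then have \<nu>: "sum_list \<nu> = m" "0 \<notin> set \<nu>" by (auto simp: compositions_def)
    have "length \<nu> \<le> sum_list \<nu>" using \<nu>(2) by (induction \<nu>) auto
    then show "\<nu> \<in> {\<nu>. set \<nu> \<subseteq> {..m} \<and> length \<nu> \<le> m}"
      using \<nu>(1) member_le_sum_list[of _ \<nu>] by auto
  qed
  show "finite {\<nu>. set \<nu> \<subseteq> {..m} \<and> length \<nu> \<le> m}"
    by (intro finite_lists_length_le) simp
qed

lemma length_coarsen: "length (coarsen xs \<nu>) = length \<nu>"
  by (induction \<nu> arbitrary: xs) auto

lemma compositions_length_le: "\<nu> \<in> compositions m \<Longrightarrow> length \<nu> \<le> m"
proof -
  have "0 \<notin> set \<nu> \<Longrightarrow> length \<nu> \<le> sum_list \<nu>" by (induction \<nu>) auto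
  then show "\<nu> \<in> compositions m \<Longrightarrow> length \<nu> \<le> m" by (auto simp: compositions_def)
qed

text \<open>A composition of n + 2 comes from a unique composition of n + 1, either by a new first
  part 1 or by raising the first part. This mirrors the two summands in the recursion of
  \<open>t_poly\<close>.\<close>

fun raise_head :: "nat list \<Rightarrow> nat list" where
  "raise_head [] = []"
| "raise_head (k # \<nu>) = Suc k # \<nu>"

lemma compositions_one: "compositions (Suc 0) = {[1]}"
proof -
  have "sum_list \<nu> = 0 \<longleftrightarrow> \<nu> = []" if "0 \<notin> set \<nu>" for \<nu> :: "nat list"
    using that by (cases \<nu>) auto
  then have "\<nu> \<in> compositions (Suc 0) \<longleftrightarrow> \<nu> = [1]" for \<nu>
    by (cases \<nu>) (auto simp: compositions_def add_eq_if split: if_splits)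
  then show ?thesis by blast
qed

lemma compositions_Suc_Suc:
  "compositions (Suc (Suc n)) = Cons 1 ` compositions (Suc n) \<union> raise_head ` compositions (Suc n)"
proof
  show "compositions (Suc (Suc n)) \<subseteq> Cons 1 ` compositions (Suc n) \<union> raise_head ` compositions (Suc n)"
  proof
    fix \<nu> assume \<nu>: "\<nu> \<in> compositions (Suc (Suc n))"
    then obtain k \<mu> where k: "\<nu> = Suc k # \<mu>"
      by (cases \<nu>) (auto simp: compositions_def gr0_conv_Suc)
    show "\<nu> \<in> Cons 1 ` compositions (Suc n) \<union> raise_head ` compositions (Suc n)"
    proof (cases k)
      case 0
      then show ?thesis using \<nu> k by (auto simp: compositions_def)
    next
      case (Suc k')
      then have "\<nu> = raise_head (k # \<mu>)" "k # \<mu> \<in> compositions (Suc n)"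
        using \<nu> k by (auto simp: compositions_def)
      then show ?thesis by blast
    qed
  qed
  show "Cons 1 ` compositions (Suc n) \<union> raise_head ` compositions (Suc n) \<subseteq> compositions (Suc (Suc n))"
  proof -
    have "raise_head \<nu> \<in> compositions (Suc (Suc n))" if "\<nu> \<in> compositions (Suc n)" for \<nu>
      using that by (cases \<nu>) (auto simp: compositions_def)
    then show ?thesis by (auto simp: compositions_def)
  qed
qed

lemma sum_compositions_Suc_Suc:
  "sum g (compositions (Suc (Suc n))) =
   (\<Sum>\<nu>\<in>compositions (Suc n). g (1 # \<nu>)) + (\<Sum>\<nu>\<in>compositions (Suc n). g (raise_head \<nu>))"
proof -
  have ne: "\<nu> \<noteq> [] \<and> hd \<nu> \<noteq> 0" if "\<nu> \<in> compositions (Suc n)" for \<nu>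
    using that by (cases \<nu>) (auto simp: compositions_def)
  have inj: "inj_on raise_head (compositions (Suc n))"
  proof (rule inj_onI)
    fix \<mu> \<nu> assume "\<mu> \<in> compositions (Suc n)" "\<nu> \<in> compositions (Suc n)" "raise_head \<mu> = raise_head \<nu>"
    then show "\<mu> = \<nu>" using ne[of \<mu>] ne[of \<nu>] by (cases \<mu>; cases \<nu>) auto
  qed
  have "1 # \<mu> \<noteq> raise_head \<nu>" if "\<nu> \<in> compositions (Suc n)" for \<mu> \<nu>
    using ne[OF that] by (cases \<nu>) auto
  then have "Cons 1 ` compositions (Suc n) \<inter> raise_head ` compositions (Suc n) = {}"
    by blast
  then show ?thesis
    unfolding compositions_Suc_Suc
    by (subst sum.union_disjoint) (auto simp: finite_compositions sum.reindex inj)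
qed

text \<open>Both sides form \<open>x * y\<close> first, since \<open>list_product\<close> associates
  to the left.\<close>

lemma coarsen_raise_head:
  assumes "\<nu> \<in> compositions (Suc n)"
  shows "coarsen (x # y # xs) (raise_head \<nu>) = coarsen (x * y # xs) \<nu>"
proof -
  obtain k \<mu> where "\<nu> = Suc k # \<mu>"
    using assms by (cases \<nu>) (auto simp: compositions_def gr0_conv_Suc)
  then show ?thesis by (simp add: list_product_def)
qed

context countable_dim_algebra
begin

text \<open>Restricted to nonempty lists: at the empty list \<open>e_elem\<close> is zero, whereas
  \<open>e_poly\<close> is a Kronecker delta.\<close>

lemma e_elem_cls:
  "xs \<noteq> [] \<Longrightarrow> i \<in> {1..N} \<Longrightarrow> j \<in> {1..N} \<Longrightarrow> e_elem scale N i j xs = U.cls N (e_poly N i j xs)"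
proof (induction N i j xs rule: e_elem.induct)
  case (2 N i j x)
  then show ?case by (simp only: e_elem.simps E_elem_cls e_poly_singleton)
next
  case (3 N i j x y xs)
  have mem: "Ew i a x * e_poly N a j (y # xs) \<in> U.C N" if "a \<in> {1..N}" for a
    using 3(3,4) that by (intro free_carrier_closed Ew_in_C e_poly_in_C)
  have eq: "E_elem scale N i a x \<otimes>\<^bsub>\<U> N\<^esub> e_elem scale N a j (y # xs) = U.cls N (Ew i a x * e_poly N a j (y # xs))"
    if "a \<in> {1..N}" for a
  proof -
    have IH: "e_elem scale N a j (y # xs) = U.cls N (e_poly N a j (y # xs))" using 3 that by blast
    show ?thesis
      unfolding IH E_elem_cls using 3(3,4) that by (intro U.Q_mult Ew_in_C e_poly_in_C)
  qed
  have "e_elem scale N i j (x # y # xs) = (\<Oplus>\<^bsub>\<U> N\<^esub>a\<in>{1..N}. U.cls N (Ew i a x * e_poly N a j (y # xs)))"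
    unfolding e_elem.simps
    by (intro abelian_monoid.finsum_cong'[OF ring.axioms(1)[OF U.ring_Q, THEN abelian_group.axioms(1)]])
       (use eq mem in \<open>auto simp del: e_poly.simps\<close>)
  also have "\<dots> = U.cls N (\<Sum>a=1..N. Ew i a x * e_poly N a j (y # xs))"
    using mem by (intro U.Q_finsum finite_atLeastAtMost)
  finally show ?case by (simp only: e_poly.simps(2)[of N i j x "y # xs"])
qed simp

lemma sum_compositions_eq_t_poly:
  "xs \<noteq> [] \<Longrightarrow> j \<in> {1..N} \<Longrightarrow>
    (\<Sum>\<nu>\<in>compositions (length xs). scal (c ^ (length xs - length (coarsen xs \<nu>))) * e_poly N i j (coarsen xs \<nu>)) =
    t_poly c N i j xs"
proof (induction c N i j xs rule: t_poly.induct)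
  case (2 c N i j x)
  then show ?case
    by (simp add: compositions_one list_product_def scal_one e_poly_singleton del: e_poly.simps(2))
next
  case (3 c N i j x y xs)
  let ?n = "length xs"
  have l: "length (x # y # xs) = Suc (Suc ?n)" by simp
  let ?g = "\<lambda>\<nu>. scal (c ^ (Suc (Suc ?n) - length (coarsen (x # y # xs) \<nu>))) * e_poly N i j (coarsen (x # y # xs) \<nu>)"
  have "(\<Sum>\<nu>\<in>compositions (Suc ?n). ?g (1 # \<nu>)) =
      (\<Sum>\<nu>\<in>compositions (Suc ?n). \<Sum>a=1..N. Ew i a x * (scal (c ^ (Suc ?n - length (coarsen (y # xs) \<nu>))) * e_poly N a j (coarsen (y # xs) \<nu>)))"
    by (intro sum.cong refl) (simp add: list_product_def sum_distrib_left mult_scal_left One_nat_def)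
  also have "\<dots> = (\<Sum>a=1..N. Ew i a x * t_poly c N a j (y # xs))"
    using "3.IH"(1) 3(3,4) by (subst sum.swap) (simp add: sum_distrib_left[symmetric])
  finally have 1: "(\<Sum>\<nu>\<in>compositions (Suc ?n). ?g (1 # \<nu>)) = (\<Sum>a=1..N. Ew i a x * t_poly c N a j (y # xs))" .
  have "(\<Sum>\<nu>\<in>compositions (Suc ?n). ?g (raise_head \<nu>)) =
      (\<Sum>\<nu>\<in>compositions (Suc ?n). scal c * (scal (c ^ (Suc ?n - length (coarsen (x * y # xs) \<nu>))) * e_poly N i j (coarsen (x * y # xs) \<nu>)))"
  proof (intro sum.cong refl)
    fix \<nu> assume \<nu>: "\<nu> \<in> compositions (Suc ?n)"
    \<comment> \<open>Raising the first part keeps the number of parts while the list is longer by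
      one, hence one more factor \<open>c\<close>.\<close>
    have "Suc (Suc ?n) - length \<nu> = Suc (Suc ?n - length \<nu>)"
      using compositions_length_le[OF \<nu>] by simp
    then show "?g (raise_head \<nu>) = scal c * (scal (c ^ (Suc ?n - length (coarsen (x * y # xs) \<nu>))) * e_poly N i j (coarsen (x * y # xs) \<nu>))"
      by (simp only: coarsen_raise_head[OF \<nu>] length_coarsen power_Suc scal_times mult.assoc)
  qed
  also have "\<dots> = scal c * t_poly c N i j (x * y # xs)"
    using "3.IH"(2) 3(3,4) by (simp add: sum_distrib_left[symmetric])
  finally have 2: "(\<Sum>\<nu>\<in>compositions (Suc ?n). ?g (raise_head \<nu>)) = scal c * t_poly c N i j (x * y # xs)" .
  show ?case
    unfolding l sum_compositions_Suc_Suc 1 2 t_poly.simps ..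
qed simp

lemma t_term_cls:
  assumes "xs \<noteq> []" "i \<in> {1..N}" "j \<in> {1..N}"
  shows "t_term scale N s i j xs = U.cls N (t_poly (- of_nat N - s) N i j xs)"
proof -
  let ?c = "- of_nat N - s"
  have ne: "coarsen xs \<nu> \<noteq> []" if "\<nu> \<in> compositions (length xs)" for \<nu>
  proof -
    have "\<nu> \<noteq> []" using that assms(1) by (auto simp: compositions_def)
    then show ?thesis using length_coarsen[of xs \<nu>] by auto
  qed
  have "t_term scale N s i j xs = (\<Oplus>\<^bsub>\<U> N\<^esub>\<nu>\<in>compositions (length xs).
      U.cls N (scal (?c ^ (length xs - length (coarsen xs \<nu>))) * e_poly N i j (coarsen xs \<nu>)))"
    unfolding t_term_def
    by (intro abelian_monoid.finsum_cong'[OF ring.axioms(1)[OF U.ring_Q, THEN abelian_group.axioms(1)]])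
       (use assms ne in \<open>auto simp: e_elem_cls\<close>)
  also have "\<dots> = U.cls N (\<Sum>\<nu>\<in>compositions (length xs).
      scal (?c ^ (length xs - length (coarsen xs \<nu>))) * e_poly N i j (coarsen xs \<nu>))"
    using assms by (intro U.Q_finsum finite_compositions) auto
  finally show ?thesis by (simp only: sum_compositions_eq_t_poly[OF assms(1,3)])
qed

definition E_last :: "nat \<Rightarrow> nat \<Rightarrow> nat \<Rightarrow> complex" where
  "E_last N = (\<lambda>i j. if i = N \<and> j = N then 1 else 0)"

lemma E_last_gl_sub: "d < N \<Longrightarrow> E_last N \<in> gl_sub d N"
  by (auto simp: E_last_def gl_sub_def split: if_splits)

subsection \<open>The algebras \<open>A\<^sub>d(\<Omega>)\<close> and \<open>Y\<^sub>d(\<Omega>)\<close>\<close>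

definition Inv :: "nat \<Rightarrow> nat \<Rightarrow> ((nat \<Rightarrow> nat \<Rightarrow> 'a) list \<Rightarrow>\<^sub>0 complex) set" where
  "Inv d N = {f \<in> U.C N. \<forall>C\<in>gl_sub d N. gl_act N C f \<in> \<I> N}"

lemma cls_eq_zero_iff: "U.cls N f = \<zero>\<^bsub>\<U> N\<^esub> \<longleftrightarrow> f \<in> \<I> N"
  by (simp add: U.Q_zero U.cls_eq_iff)

lemma A_term_cls: "f \<in> U.C N \<Longrightarrow> U.cls N f \<in> A_term scale d N \<longleftrightarrow> f \<in> Inv d N"
  using gl_sub_mono[of 0 d N] by (auto simp: A_term_def Inv_def U_action_cls subset_iff cls_eq_zero_iff)

lemma U_last_invariants_cls:
  "f \<in> U.C N \<Longrightarrow> 0 < N \<Longrightarrow> U.cls N f \<in> U_last_invariants scale N \<longleftrightarrow> gl_act N (E_last N) f \<in> \<I> N"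
  using E_last_gl_sub[of 0 N]
  by (auto simp: U_last_invariants_def E_last_def[symmetric] U_action_cls cls_eq_zero_iff)

lemma U_filtration_cls: "f \<in> U.C N \<Longrightarrow> U.cls N f \<in> U_filtration scale N k \<longleftrightarrow> f \<in> U_filt N k"
  by (auto simp: U_filtration_def span_words_def U.cls_def[symmetric] U.cls_eq_iff U_filt_def)

lemma gl_pred_zero:
  assumes "M \<in> \<G> (N - 1)" "0 < N"
  shows "M N i = 0" "M i N = 0"
proof -
  have "N \<notin> {1..N - 1}" using assms(2) by auto
  then show "M N i = 0" "M i N = 0" using assms(1) unfolding carrier_gl by blast+
qed

text \<open>Matrices are padded with zeros, so the relations for N - 1 are among those for N: in the
  bracket the additional inner index \<open>N\<close> contributes nothing.\<close>

lemma U_ideal_pred: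
  assumes "f \<in> \<I> (N - 1)"
  shows "f \<in> \<I> N"
proof (cases "N = 0")
  case False
  then have N: "1 \<le> N" by simp
  let ?S = "linear_relations (gl scale (N - 1)) \<union> {word [x, y] - word [y, x] - word [gl_bracket (N - 1) x y] | x y.
     x \<in> \<G> (N - 1) \<and> y \<in> \<G> (N - 1)}"
  have br: "gl_bracket (N - 1) x y = gl_bracket N x y"
    if "x \<in> \<G> (N - 1)" "y \<in> \<G> (N - 1)" for x y
  proof -
    have "x i N = 0" "y i N = 0" for i using gl_pred_zero that N by auto
    then show ?thesis by (simp add: gl_bracket_def fun_eq_iff sum_split_last[OF N])
  qed
  have "genideal (free_algebra (\<G> (N - 1))) ?S \<subseteq> \<I> N \<inter> U.C (N - 1)"
  proof (rule genideal_least)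
    show "ideal (\<I> N \<inter> U.C (N - 1)) (free_algebra (\<G> (N - 1)))"
      by (rule ideal_free_algebraI) (auto dest: C_pred)
    have "linear_relations (gl scale (N - 1)) \<subseteq> linear_relations (gl scale N)"
      unfolding linear_relations_def using carrier_gl_pred by (auto simp: gl_simps) blast+
    moreover have "word [x, y] - word [y, x] - word [gl_bracket (N - 1) x y] \<in> \<I> N"
      if "x \<in> \<G> (N - 1)" "y \<in> \<G> (N - 1)" for x y
      using U_bracket[of x N y] that carrier_gl_pred by (simp add: br[OF that] word_mult)
    ultimately show "?S \<subseteq> \<I> N \<inter> U.C (N - 1)"
      using U.linear_relations_subset[of N] U_relations_subset[of "N - 1"] by blast
  qed
  then show ?thesis
    using assms by (auto simp: U_ideal_def[of _ "N - 1"] enveloping_ideal_def)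
qed (use assms in simp)

lemma U_inclusion_cls: "U_inclusion scale N (U.cls (N - 1) g) = U.cls N g"
proof -
  have "U.cls N f = U.cls N g" if "f \<in> U.cls (N - 1) g" for f
    using that U_ideal_pred[of "f - g" N] by (simp add: U.cls_conv[of "N - 1"] U.cls_eq_iff)
  then have "(\<Union>f\<in>U.cls (N - 1) g. U.cls N f) = U.cls N g"
    using U.cls_self[of g "N - 1"] by blast
  then show ?thesis by (simp add: U_inclusion_def U.cls_def)
qed

text \<open>Asks for invariance of \<open>f\<close> and \<open>g\<close>, where
  \<open>projects_to\<close> asks for that of \<open>f\<close> and \<open>f - g\<close>. By
  linearity this is the same, and in this form it passes to products.\<close>

definition projects :: "nat \<Rightarrow> ((nat \<Rightarrow> nat \<Rightarrow> 'a) list \<Rightarrow>\<^sub>0 complex) \<Rightarrow> _ \<Rightarrow> bool" where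
  "projects N f g \<longleftrightarrow> f \<in> U.C N \<and> g \<in> U.C (N - 1) \<and> gl_act N (E_last N) f \<in> \<I> N \<and>
     gl_act N (E_last N) g \<in> \<I> N \<and> f - g \<in> Iplus N \<and> f - g \<in> Iminus N"

lemma projects_to_cls:
  assumes "f \<in> U.C N" "g \<in> U.C (N - 1)" "0 < N"
  shows "projects_to scale N (U.cls N f) (U.cls (N - 1) g) \<longleftrightarrow> projects N f g"
proof -
  have g: "g \<in> U.C N" using assms(2) by (rule C_pred)
  have "gl_act N (E_last N) (f - g) \<in> \<I> N \<longleftrightarrow> gl_act N (E_last N) g \<in> \<I> N"
    if "gl_act N (E_last N) f \<in> \<I> N"
    using U.I_diff[OF that, of "gl_act N (E_last N) g"] U.I_diff[OF that, of "gl_act N (E_last N) (f - g)"]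
    by (auto simp: gl_act_diff)
  then show ?thesis
    using assms g
    by (auto simp: projects_to_def L_ideal_def U_inclusion_cls U_last_invariants_cls projects_def Iplus_def Iminus_def)
qed

lemma projects_add: "projects N f g \<Longrightarrow> projects N f' g' \<Longrightarrow> projects N (f + f') (g + g')"
  using Iplus_add[of "f - g" N "f' - g'"] Iminus_add[of "f - g" N "f' - g'"]
  by (auto simp: projects_def gl_act_add algebra_simps)

lemma projects_mult:
  assumes "projects N f g" "projects N f' g'"
  shows "projects N (f * f') (g * g')"
proof -
  have c: "f \<in> U.C N" "f' \<in> U.C N" "g \<in> U.C (N - 1)" "g' \<in> U.C (N - 1)" "g \<in> U.C N" "g' \<in> U.C N"
    using assms C_pred by (auto simp: projects_def)
  \<comment> \<open>Two telescopings, one for each ideal: in the first the right factor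
    \<open>g'\<close> comes from gl(N-1, \<Omega>), as \<open>Iplus_rmult\<close> requires, in the
    second the left factor \<open>g\<close>, as \<open>Iminus_lmult\<close> requires.\<close>
  have eq: "f * f' - g * g' = f * (f' - g') + (f - g) * g'" "f * f' - g * g' = (f - g) * f' + g * (f' - g')"
    by (simp_all add: algebra_simps)
  have "f * f' - g * g' \<in> Iplus N"
    unfolding eq(1) using assms c by (intro Iplus_add Iplus_mult Iplus_rmult) (auto simp: projects_def)
  moreover have "f * f' - g * g' \<in> Iminus N"
    unfolding eq(2) using assms c by (intro Iminus_add Iminus_mult Iminus_lmult) (auto simp: projects_def)
  ultimately show ?thesis
    using assms c by (auto simp: projects_def gl_act_mult)
qed

lemma projects_smult:
  assumes "projects N f g"
  shows "projects N (scal c * f) (scal c * g)"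
proof -
  have "scal c * (f - g) \<in> Iplus N" "scal c * (f - g) \<in> Iminus N"
    using assms by (auto simp: projects_def intro: Iplus_smult Iminus_smult)
  then show ?thesis
    using assms by (auto simp: projects_def gl_act_mult gl_act_const right_diff_distrib)
qed

lemma projects_one: "projects N 1 1"
  by (auto simp: projects_def gl_act_def free_derivation_one Iplus_zero Iminus_zero)

lemma Inv_ops:
  shows Inv_add: "f \<in> Inv d N \<Longrightarrow> g \<in> Inv d N \<Longrightarrow> f + g \<in> Inv d N"
    and Inv_mult: "f \<in> Inv d N \<Longrightarrow> g \<in> Inv d N \<Longrightarrow> f * g \<in> Inv d N"
    and Inv_smult: "f \<in> Inv d N \<Longrightarrow> scal c * f \<in> Inv d N"
    and Inv_one: "1 \<in> Inv d N"
  by (auto simp: Inv_def gl_act_add gl_act_mult gl_act_const) (auto simp: gl_act_def free_derivation_one)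

text \<open>ad E_NN annihilates every letter from gl(N-1, \<Omega>). A word containing the zero
  matrix as a letter is not the zero polynomial, but it lies in the ideal.\<close>

lemma gl_act_E_last_pred:
  assumes "g \<in> U.C (N - 1)" "0 < N"
  shows "gl_act N (E_last N) g \<in> \<I> N"
  using assms(1)
proof (induction rule: free_words_induct)
  case (word w)
  have zero: "gl_ad scale N (E_last N) M = (\<lambda>i j. 0)" if "M \<in> \<G> (N - 1)" for M
  proof -
    have "M N i = 0" "M i N = 0" for i using gl_pred_zero that assms(2) by auto
    then have "scale (E_last N i a) (M a j) = 0" "scale (E_last N a j) (M i a) = 0" for i j a
      by (auto simp: E_last_def)
    then show ?thesis unfolding gl_ad_def by (simp del: scale_eq_0_iff)
  qed
  have "word (w[k := gl_ad scale N (E_last N) (w ! k)]) \<in> \<I> N" if k: "k < length w" for k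
  proof -
    have "w ! k \<in> \<G> (N - 1)" using word nth_mem[OF k] by blast
    then have "word (w[k := gl_ad scale N (E_last N) (w ! k)]) =
        word (take k w) * word [\<lambda>i j. 0] * word (drop (Suc k) w)"
      by (simp add: zero word_mult upd_conv_take_nth_drop[OF k])
    moreover have "set (take k w) \<subseteq> \<G> N" "set (drop (Suc k) w) \<subseteq> \<G> N"
      using word set_take_subset[of k w] set_drop_subset[of "Suc k" w] carrier_gl_pred by blast+
    ultimately show ?thesis
      by (simp add: U.I_rmult U.I_lmult word_gl_zero)
  qed
  then show ?case by (auto simp: gl_act_def free_derivation_word intro!: U.I_sum)
qed (auto simp: gl_act_add gl_act_mult gl_act_const)

lemma t_poly_projects:
  assumes "i \<in> {1..d}" "j \<in> {1..d}" "d < N"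
  shows "projects N (t_poly c N i j xs) (t_poly (c + 1) (N - 1) i j xs)"
proof -
  have "gl_act N (E_last N) (t_poly c N i j xs) \<in> \<I> N"
    using assms by (intro gl_act_t_poly_invariant[OF E_last_gl_sub[OF assms(3)]]) auto
  moreover have "gl_act N (E_last N) (t_poly (c + 1) (N - 1) i j xs) \<in> \<I> N"
    using assms by (intro gl_act_E_last_pred t_poly_in_C) auto
  ultimately show ?thesis
    using assms t_poly_stable_Iplus[of i N j c xs] t_poly_stable_Iminus[of i N j c xs] t_poly_in_C[of i N j c xs]
      t_poly_in_C[of i "N - 1" j "c + 1" xs]
    by (auto simp: projects_def)
qed

definition A_seq :: "nat \<Rightarrow> (nat \<Rightarrow> (nat \<Rightarrow> nat \<Rightarrow> 'a) list \<Rightarrow>\<^sub>0 complex) \<Rightarrow> _" where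
  "A_seq d f = (\<lambda>N\<in>{d..}. U.cls N (f N))"

text \<open>
  Lifts to the free algebras of the elements of \<open>A\<^sub>d(\<Omega>)\<close> of degree at most \<open>k\<close>.
\<close>

definition A_polys :: "nat \<Rightarrow> int \<Rightarrow> (nat \<Rightarrow> (nat \<Rightarrow> nat \<Rightarrow> 'a) list \<Rightarrow>\<^sub>0 complex) set" where
  "A_polys d k = {f. (\<forall>N\<ge>d. f N \<in> Inv d N \<and> f N \<in> U_filt N k) \<and> (\<forall>N>d. projects N (f N) (f (N - 1)))}"

lemma A_polys_add: "f \<in> A_polys d k \<Longrightarrow> g \<in> A_polys d k \<Longrightarrow> (\<lambda>N. f N + g N) \<in> A_polys d k"
  by (auto simp: A_polys_def intro: Inv_add U_filt_add projects_add)

lemma A_polys_mult: "f \<in> A_polys d k \<Longrightarrow> g \<in> A_polys d l \<Longrightarrow> (\<lambda>N. f N * g N) \<in> A_polys d (k + l)"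
  by (auto simp: A_polys_def intro: Inv_mult U_filt_mult projects_mult)

lemma A_polys_smult: "f \<in> A_polys d k \<Longrightarrow> (\<lambda>N. scal c * f N) \<in> A_polys d k"
  by (auto simp: A_polys_def intro: Inv_smult U_filt_smult projects_smult)

lemma A_polys_one: "0 \<le> k \<Longrightarrow> (\<lambda>N. 1) \<in> A_polys d k"
  by (auto simp: A_polys_def intro: Inv_one U_filt_one projects_one)

lemma A_polys_mono: "f \<in> A_polys d k \<Longrightarrow> k \<le> l \<Longrightarrow> f \<in> A_polys d l"
  by (auto simp: A_polys_def intro: U_filt_mono)

lemma A_polys_diff: "f \<in> A_polys d k \<Longrightarrow> g \<in> A_polys d k \<Longrightarrow> (\<lambda>N. f N - g N) \<in> A_polys d k"
  using A_polys_add[of f d k "\<lambda>N. scal (- 1) * g N"] A_polys_smult[of g d k "- 1"] by (simp add: scal_minus_one)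

lemma A_polys_zero: "(\<lambda>N. 0) \<in> A_polys d k"
proof -
  have "projects N 0 0" for N
    using projects_smult[OF projects_one, of N 0] by simp
  then show ?thesis using Inv_smult[OF Inv_one, of 0] by (auto simp: A_polys_def U_filt_zero)
qed

lemma A_polys_commute:
  assumes "f \<in> A_polys d k" "g \<in> A_polys d l"
  shows "(\<lambda>N. f N * g N - g N * f N) \<in> A_polys d (k + l - 1)"
proof -
  have "(\<lambda>N. f N * g N - g N * f N) \<in> A_polys d (k + l)"
    using A_polys_diff[OF A_polys_mult[OF assms]] A_polys_mult[OF assms(2,1)] by (simp add: add.commute)
  moreover have "f N * g N - g N * f N \<in> U_filt N (k + l - 1)" if "d \<le> N" for N
    using assms that by (intro U_filt_commute[of _ _ k _ l]) (auto simp: A_polys_def)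
  ultimately show ?thesis by (auto simp: A_polys_def)
qed

lemma A_polys_C: "f \<in> A_polys d k \<Longrightarrow> d \<le> N \<Longrightarrow> f N \<in> U.C N"
  by (auto simp: A_polys_def Inv_def)

lemma A_filtration_eq: "A_filtration scale d k = A_seq d ` A_polys d k"
proof
  show "A_seq d ` A_polys d k \<subseteq> A_filtration scale d k"
  proof
    fix a assume "a \<in> A_seq d ` A_polys d k"
    then obtain f where f: "f \<in> A_polys d k" "a = A_seq d f" by blast
    have "f N \<in> U.C N" if "d \<le> N" for N using A_polys_C[OF f(1) that] .
    then have "projects_to scale N (U.cls N (f N)) (U.cls (N - 1) (f (N - 1)))" if "d < N" for N
      using that f(1) by (subst projects_to_cls) (auto simp: A_polys_def)
    moreover have "U.cls N (f N) \<in> A_term scale d N" "U.cls N (f N) \<in> U_filtration scale N k"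
      if "d \<le> N" for N
      using that f(1) A_polys_C[OF f(1) that] A_term_cls U_filtration_cls by (auto simp: A_polys_def)
    ultimately show "a \<in> A_filtration scale d k"
      by (auto simp: f(2) A_filtration_def A_algebra_def A_seq_def)
  qed
  show "A_filtration scale d k \<subseteq> A_seq d ` A_polys d k"
  proof
    fix a assume a: "a \<in> A_filtration scale d k"
    \<comment> \<open>Lifts may be chosen separately for each \<open>N\<close>: compatibility with
      the projections is a condition on classes and holds for any choice.\<close>
    have "\<forall>N. \<exists>f. d \<le> N \<longrightarrow> f \<in> U.C N \<and> a N = U.cls N f"
    proof
      fix N
      show "\<exists>f. d \<le> N \<longrightarrow> f \<in> U.C N \<and> a N = U.cls N f"
      proof (cases "d \<le> N")
        case True
        then have "a N \<in> carrier (\<U> N)"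
          using a by (auto simp: A_filtration_def A_algebra_def A_term_def PiE_iff)
        then show ?thesis by (auto elim!: U.Q_cases)
      qed simp
    qed
    then obtain f where f: "\<And>N. d \<le> N \<Longrightarrow> f N \<in> U.C N \<and> a N = U.cls N (f N)" by metis
    have "a = A_seq d f"
    proof
      fix N
      show "a N = A_seq d f N"
        using f[of N] a by (auto simp: A_seq_def A_filtration_def A_algebra_def PiE_iff extensional_def)
    qed
    moreover have "f \<in> A_polys d k"
    proof -
      have "projects N (f N) (f (N - 1))" if "d < N" for N
        using f[of N] f[of "N - 1"] that a projects_to_cls[of "f N" N "f (N - 1)"]
        by (auto simp: A_filtration_def A_algebra_def)
      moreover have "f N \<in> Inv d N" "f N \<in> U_filt N k" if "d \<le> N" for N
      proof -
        have "a N \<in> A_term scale d N" "a N \<in> U_filtration scale N k"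
          using a that by (auto simp: A_filtration_def A_algebra_def PiE_iff)
        then show "f N \<in> Inv d N" "f N \<in> U_filt N k"
          using f[OF that] A_term_cls U_filtration_cls by auto
      qed
      ultimately show ?thesis by (simp add: A_polys_def)
    qed
    ultimately show "a \<in> A_seq d ` A_polys d k" by blast
  qed
qed

text \<open>Products of classes are computed on representatives in the free algebra over gl(N,
  \<Omega>), so \<open>A_mult\<close> needs this condition.\<close>

definition C_seqs :: "nat \<Rightarrow> (nat \<Rightarrow> (nat \<Rightarrow> nat \<Rightarrow> 'a) list \<Rightarrow>\<^sub>0 complex) set" where
  "C_seqs d = {f. \<forall>N\<ge>d. f N \<in> U.C N}"

lemma A_polys_C_seqs: "f \<in> A_polys d k \<Longrightarrow> f \<in> C_seqs d"
  by (auto simp: C_seqs_def A_polys_C)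

lemma C_seqs_closed [intro]:
  "f \<in> C_seqs d \<Longrightarrow> g \<in> C_seqs d \<Longrightarrow> (\<lambda>N. f N + g N) \<in> C_seqs d"
  "f \<in> C_seqs d \<Longrightarrow> g \<in> C_seqs d \<Longrightarrow> (\<lambda>N. f N * g N) \<in> C_seqs d"
  "f \<in> C_seqs d \<Longrightarrow> g \<in> C_seqs d \<Longrightarrow> (\<lambda>N. f N - g N) \<in> C_seqs d"
  "f \<in> C_seqs d \<Longrightarrow> (\<lambda>N. scal c * f N) \<in> C_seqs d"
  "f \<in> C_seqs d \<Longrightarrow> (\<lambda>N. - f N) \<in> C_seqs d"
  "(\<lambda>N. 0) \<in> C_seqs d" "(\<lambda>N. 1) \<in> C_seqs d"
  by (auto simp: C_seqs_def)

lemma A_ops: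
  shows A_add: "add (\<A> d) (A_seq d f) (A_seq d g) = A_seq d (\<lambda>N. f N + g N)"
    and A_mult: "f \<in> C_seqs d \<Longrightarrow> g \<in> C_seqs d \<Longrightarrow> mult (\<A> d) (A_seq d f) (A_seq d g) = A_seq d (\<lambda>N. f N * g N)"
    and A_smult: "smult (\<A> d) c (A_seq d f) = A_seq d (\<lambda>N. scal c * f N)"
    and A_zero: "zero (\<A> d) = A_seq d (\<lambda>N. 0)"
    and A_one: "one (\<A> d) = A_seq d (\<lambda>N. 1)"
  by (auto simp: A_algebra_def A_seq_def C_seqs_def U.Q_zero U.Q_one fun_eq_iff)

section \<open>The ring structure of \<open>Y\<^sub>d(\<Omega>)\<close>\<close>

definition Y_generators :: "nat \<Rightarrow> complex \<Rightarrow> _" where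
  "Y_generators d s = {t_elem scale d s i j xs | i j xs. i \<in> {1..d} \<and> j \<in> {1..d} \<and> xs \<noteq> []}"

definition t_seq :: "complex \<Rightarrow> nat \<Rightarrow> nat \<Rightarrow> 'a list \<Rightarrow> nat \<Rightarrow> ((nat \<Rightarrow> nat \<Rightarrow> 'a) list \<Rightarrow>\<^sub>0 complex)" where
  "t_seq s i j xs N = t_poly (- of_nat N - s) N i j xs"

lemma t_elem_A_seq:
  "i \<in> {1..d} \<Longrightarrow> j \<in> {1..d} \<Longrightarrow> xs \<noteq> [] \<Longrightarrow> t_elem scale d s i j xs = A_seq d (t_seq s i j xs)"
  unfolding t_elem_def A_seq_def by (intro restrict_ext) (auto simp: t_seq_def t_term_cls)

lemma t_seq_A_polys:
  assumes "i \<in> {1..d}" "j \<in> {1..d}"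
  shows "t_seq s i j xs \<in> A_polys d (int (length xs))"
proof -
  have "projects N (t_seq s i j xs N) (t_seq s i j xs (N - 1))" if "d < N" for N
  proof -
    \<comment> \<open>Passing from \<open>N\<close> to \<open>N - 1\<close> raises the parameter by
      one, exactly the shift in \<open>t_poly_projects\<close>.\<close>
    have "- of_nat (N - 1) - s = (- of_nat N - s) + 1" using that by (simp add: of_nat_diff)
    then show ?thesis using t_poly_projects[OF assms that, of "- of_nat N - s" xs] by (simp only: t_seq_def)
  qed
  moreover have "t_seq s i j xs N \<in> Inv d N \<and> t_seq s i j xs N \<in> U_filt N (int (length xs))" if "d \<le> N" for N
    using assms that gl_act_t_poly_invariant[OF _ assms that] t_poly_in_U_filt[of i N j] t_poly_in_C[of i N j]
    by (auto simp: t_seq_def Inv_def)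
  ultimately show ?thesis by (simp add: A_polys_def)
qed

lemma carrier_Y: "carrier (\<Y> d s) = subalgebra_generated (\<A> d) (Y_generators d s)"
  by (simp add: Y_algebra_def Y_generators_def)

lemma Y_A_seq: "a \<in> carrier (\<Y> d s) \<Longrightarrow> \<exists>f\<in>C_seqs d. a = A_seq d f"
  unfolding carrier_Y
proof (induction rule: subalgebra_generated.induct)
  case (gen x)
  then show ?case using t_elem_A_seq A_polys_C_seqs[OF t_seq_A_polys] unfolding Y_generators_def by blast
qed (force simp: A_ops)+

lemma Y_ops:
  "add (\<Y> d s) = add (\<A> d)" "mult (\<Y> d s) = mult (\<A> d)"
  "smult (\<Y> d s) = smult (\<A> d)" "zero (\<Y> d s) = zero (\<A> d)"
  "one (\<Y> d s) = one (\<A> d)"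
  by (simp_all add: Y_algebra_def)

lemma Y_closed:
  "one (\<A> d) \<in> carrier (\<Y> d s)"
  "a \<in> carrier (\<Y> d s) \<Longrightarrow> b \<in> carrier (\<Y> d s) \<Longrightarrow>
    add (\<A> d) a b \<in> carrier (\<Y> d s)"
  "a \<in> carrier (\<Y> d s) \<Longrightarrow> b \<in> carrier (\<Y> d s) \<Longrightarrow>
    mult (\<A> d) a b \<in> carrier (\<Y> d s)"
  "a \<in> carrier (\<Y> d s) \<Longrightarrow> smult (\<A> d) c a \<in> carrier (\<Y> d s)"
  unfolding carrier_Y by (auto intro: subalgebra_generated.intros)

lemma Y_zero_closed: "zero (\<A> d) \<in> carrier (\<Y> d s)"
  using Y_closed(4)[OF Y_closed(1), where c = 0] by (simp add: A_ops)

lemma Y_cases: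
  assumes "a \<in> carrier (\<Y> d s)"
  obtains f where "f \<in> C_seqs d" "a = A_seq d f"
  using Y_A_seq[OF assms] by blast

lemma Y_uminus_closed: "A_seq d f \<in> carrier (\<Y> d s) \<Longrightarrow> A_seq d (\<lambda>N. - f N) \<in> carrier (\<Y> d s)"
  using Y_closed(4)[of "A_seq d f" d s "- 1"] by (simp add: A_ops scal_minus_one)

lemma ring_Y: "ring (\<Y> d s)"
proof (rule ringI)
  show "abelian_group (\<Y> d s)"
  proof (rule abelian_groupI)
    fix a assume a: "a \<in> carrier (\<Y> d s)"
    then obtain f where f: "f \<in> C_seqs d" "a = A_seq d f" by (rule Y_cases)
    with Y_uminus_closed[of d f s] a show "\<exists>b\<in>carrier (\<Y> d s). b \<oplus>\<^bsub>\<Y> d s\<^esub> a = \<zero>\<^bsub>\<Y> d s\<^esub>"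
      by (intro bexI[of _ "A_seq d (\<lambda>N. - f N)"]) (auto simp: Y_ops A_ops)
  qed (auto simp: Y_ops Y_closed Y_zero_closed, auto elim!: Y_cases simp: A_ops algebra_simps)
  show "Group.monoid (\<Y> d s)"
    by (rule monoidI) (auto simp: Y_ops Y_closed, auto elim!: Y_cases simp: A_ops C_seqs_closed algebra_simps)
qed (auto simp: Y_ops, auto elim!: Y_cases simp: A_ops C_seqs_closed algebra_simps)

lemma Y_a_inv:
  assumes "A_seq d f \<in> carrier (\<Y> d s)" "f \<in> C_seqs d"
  shows "\<ominus>\<^bsub>\<Y> d s\<^esub> A_seq d f = A_seq d (\<lambda>N. - f N)"
proof -
  interpret ring "\<Y> d s" by (rule ring_Y)
  show ?thesis
    using assms Y_uminus_closed[OF assms(1)] by (intro minus_equality) (auto simp: Y_ops A_ops)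
qed

lemma Y_filtration_iff:
  "a \<in> \<F> d s k \<longleftrightarrow> a \<in> carrier (\<Y> d s) \<and> (\<exists>f\<in>A_polys d k. a = A_seq d f)"
  by (auto simp: Y_filtration_def A_filtration_eq)

end

subsection \<open>Filtered algebras with commutative associated graded algebra\<close>

text \<open>The assumption \<open>F_commutator\<close> expresses commutativity of the associated
  graded algebra and lets the commutator induce an operation of degree -1.\<close>

locale filtered_algebra = ring A for A :: "(complex, 'b) module" (structure) +
  fixes F :: "int \<Rightarrow> 'b set"
  assumes smult_closed: "a \<in> carrier A \<Longrightarrow> c \<odot> a \<in> carrier A"
    and smult_add: "a \<in> carrier A \<Longrightarrow> b \<in> carrier A \<Longrightarrow> c \<odot> (a \<oplus> b) = c \<odot> a \<oplus> c \<odot> b"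
    and smult_lmult: "a \<in> carrier A \<Longrightarrow> b \<in> carrier A \<Longrightarrow> (c \<odot> a) \<otimes> b = c \<odot> (a \<otimes> b)"
    and smult_rmult: "a \<in> carrier A \<Longrightarrow> b \<in> carrier A \<Longrightarrow> a \<otimes> (c \<odot> b) = c \<odot> (a \<otimes> b)"
    and F_carrier: "a \<in> F k \<Longrightarrow> a \<in> carrier A"
    and F_zero: "\<zero> \<in> F k"
    and F_add: "a \<in> F k \<Longrightarrow> b \<in> F k \<Longrightarrow> a \<oplus> b \<in> F k"
    and F_uminus: "a \<in> F k \<Longrightarrow> \<ominus> a \<in> F k"
    and F_smult: "a \<in> F k \<Longrightarrow> c \<odot> a \<in> F k"
    and F_mono: "a \<in> F k \<Longrightarrow> k \<le> l \<Longrightarrow> a \<in> F l"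
    and F_one: "\<one> \<in> F 0"
    and F_mult: "a \<in> F k \<Longrightarrow> b \<in> F l \<Longrightarrow> a \<otimes> b \<in> F (k + l)"
    and F_commutator: "a \<in> F k \<Longrightarrow> b \<in> F l \<Longrightarrow> commutator A a b \<in> F (k + l - 1)"
begin

abbreviation "Gr \<equiv> assoc_graded A F"

definition coset :: "int \<Rightarrow> 'b \<Rightarrow> 'b set" where
  "coset k a = F (k - 1) +> a"

lemma additive_subgroup_F: "additive_subgroup (F k) A"
  by (intro additive_subgroup.intro add.subgroupI)
     (auto simp: a_inv_def[symmetric] intro: F_carrier F_add F_uminus F_zero)

lemma abelian_subgroup_F: "abelian_subgroup (F k) A"
  by (intro abelian_subgroupI3 additive_subgroup_F abelian_group_axioms)

lemma mem_coset: "a \<in> carrier A \<Longrightarrow> x \<in> carrier A \<Longrightarrow> x \<in> coset k a \<longleftrightarrow> x \<ominus> a \<in> F (k - 1)"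
  unfolding coset_def by (rule abelian_subgroup.a_rcos_module_minus[OF abelian_subgroup_F ring_axioms])

lemma coset_carrier: "a \<in> carrier A \<Longrightarrow> x \<in> coset k a \<Longrightarrow> x \<in> carrier A"
  unfolding coset_def by (auto simp: a_r_coset_def' intro: F_carrier)

lemma coset_self: "a \<in> carrier A \<Longrightarrow> a \<in> coset k a"
  by (simp add: mem_coset r_neg[unfolded a_minus_def[symmetric]] F_zero minus_eq r_neg)

lemma coset_eqI:
  assumes "a \<in> carrier A" "b \<in> carrier A" "a \<ominus> b \<in> F (k - 1)"
  shows "coset k a = coset k b"
  using assms a_repr_independence[OF _ _ additive_subgroup.a_subgroup[OF additive_subgroup_F], of a "k - 1" b] mem_coset[of b a k]
  unfolding coset_def by simp

lemma coset_eq_iff: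
  assumes "a \<in> carrier A" "b \<in> carrier A"
  shows "coset k a = coset k b \<longleftrightarrow> a \<ominus> b \<in> F (k - 1)"
  using coset_eqI[OF assms] coset_self[OF assms(1), of k] mem_coset[OF assms(2,1), of k] by auto

lemma coset_zero: "coset k \<zero> = F (k - 1)"
proof -
  have "x \<in> coset k \<zero> \<longleftrightarrow> x \<in> F (k - 1)" for x
    using mem_coset[OF zero_closed, of x k] coset_carrier[OF zero_closed, of x k] F_carrier[of x "k - 1"]
    by (auto simp: minus_eq)
  then show ?thesis by blast
qed

lemma coset_eq_zero_iff: "a \<in> carrier A \<Longrightarrow> coset k a = F (k - 1) \<longleftrightarrow> a \<in> F (k - 1)"
  using coset_eq_iff[of a \<zero> k] by (simp add: coset_zero minus_eq)

lemma coset_add: "a \<in> carrier A \<Longrightarrow> b \<in> carrier A \<Longrightarrow> set_add A (coset k a) (coset k b) = coset k (a \<oplus> b)"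
  unfolding coset_def by (rule abelian_subgroup.a_rcos_sum[OF abelian_subgroup_F])

lemma coset_smult:
  assumes "a \<in> carrier A"
  shows "(\<Union>x\<in>coset k a. F (k - 1) +> c \<odot> x) = coset k (c \<odot> a)"
proof -
  have "coset k (c \<odot> x) = coset k (c \<odot> a)" if x: "x \<in> coset k a" for x
  proof (rule coset_eqI)
    have xc: "x \<in> carrier A" using coset_carrier[OF assms x] .
    have xa: "x \<ominus> a \<in> F (k - 1)" using x mem_coset[OF assms xc] by simp
    have "c \<odot> x = c \<odot> (x \<ominus> a) \<oplus> c \<odot> a"
      using xc assms by (simp add: smult_add[symmetric] minus_eq a_assoc l_neg)
    then have "c \<odot> x \<ominus> c \<odot> a = c \<odot> (x \<ominus> a)"
      using xc assms by (simp add: minus_eq a_assoc r_neg smult_closed)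
    then show "c \<odot> x \<ominus> c \<odot> a \<in> F (k - 1)" using F_smult[OF xa] by simp
  qed (use coset_carrier[OF assms x] assms smult_closed in auto)
  then show ?thesis
    using coset_self[OF assms] unfolding coset_def[symmetric] by blast
qed

lemma gr_piece_simps:
  "carrier (gr_piece A F k) = coset k ` F k" "zero (gr_piece A F k) = coset k \<zero>"
  "add (gr_piece A F k) = set_add A"
  by (auto simp: gr_piece_def coset_def[symmetric] coset_zero)

lemma abelian_monoid_gr_piece: "abelian_monoid (gr_piece A F k)"
  by (rule abelian_monoidI)
     (auto simp: gr_piece_simps F_carrier F_zero coset_add a_ac intro!: imageI F_add)

lemma gr_piece_finsum:
  assumes "finite S" "\<And>i. i \<in> S \<Longrightarrow> a i \<in> F k"
  shows "(\<Oplus>\<^bsub>gr_piece A F k\<^esub>i\<in>S. coset k (a i)) = coset k (\<Oplus>i\<in>S. a i) \<and> (\<Oplus>i\<in>S. a i) \<in> F k"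
  using assms
proof (induction S rule: finite_induct)
  case empty
  interpret P: abelian_monoid "gr_piece A F k" by (rule abelian_monoid_gr_piece)
  show ?case by (simp add: gr_piece_simps(2) F_zero)
next
  case (insert i S)
  interpret P: abelian_monoid "gr_piece A F k" by (rule abelian_monoid_gr_piece)
  have "(\<Oplus>\<^bsub>gr_piece A F k\<^esub>i\<in>insert i S. coset k (a i)) =
     coset k (a i) \<oplus>\<^bsub>gr_piece A F k\<^esub> (\<Oplus>\<^bsub>gr_piece A F k\<^esub>i\<in>S. coset k (a i))"
    using insert by (intro P.finsum_insert) (auto simp: gr_piece_simps(1))
  moreover have "(\<Oplus>i\<in>insert i S. a i) = a i \<oplus> (\<Oplus>i\<in>S. a i)"
    using insert by (intro finsum_insert) (auto intro: F_carrier)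
  ultimately show ?case
    using insert F_add coset_add F_carrier[of _ k] by (simp add: gr_piece_simps(3))
qed

text \<open>Families of representatives, one in each filtration step, of the elements of the graded
  algebra. Via \<open>gr_of\<close> the coset operations become operations in
  \<open>A\<close>.\<close>

definition gr_reps :: "(int \<Rightarrow> 'b) set" where
  "gr_reps = {a. (\<forall>k. a k \<in> F k) \<and> finite {k. a k \<notin> F (k - 1)}}"

definition gr_of :: "(int \<Rightarrow> 'b) \<Rightarrow> int \<Rightarrow> 'b set" where
  "gr_of a = (\<lambda>k. coset k (a k))"

lemma gr_reps_F: "a \<in> gr_reps \<Longrightarrow> a k \<in> F k"
  by (simp add: gr_reps_def)

lemma gr_reps_carrier: "a \<in> gr_reps \<Longrightarrow> a k \<in> carrier A"
  using F_carrier gr_reps_F by blast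

lemma support_gr_of: "a \<in> gr_reps \<Longrightarrow> gr_support F (gr_of a) = {k. a k \<notin> F (k - 1)}"
  by (auto simp: gr_support_def gr_of_def coset_eq_zero_iff gr_reps_carrier)

lemma carrier_Gr: "carrier Gr = gr_of ` gr_reps"
proof
  show "gr_of ` gr_reps \<subseteq> carrier Gr"
    by (auto simp: assoc_graded_def gr_piece_simps support_gr_of) (auto simp: gr_of_def gr_reps_def)
  show "carrier Gr \<subseteq> gr_of ` gr_reps"
  proof
    fix g assume g: "g \<in> carrier Gr"
    then have "\<forall>k. \<exists>a. a \<in> F k \<and> g k = coset k a"
      by (auto simp: assoc_graded_def gr_piece_simps)
    then obtain a where a: "\<And>k. a k \<in> F k" "\<And>k. g k = coset k (a k)" by metis
    then have ga: "g = gr_of a" by (auto simp: gr_of_def)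
    have "gr_support F g = {k. a k \<notin> F (k - 1)}"
      using coset_eq_zero_iff[OF F_carrier[OF a(1)]] by (simp add: gr_support_def a(2))
    then have "a \<in> gr_reps" using a g by (auto simp: gr_reps_def assoc_graded_def)
    with ga show "g \<in> gr_of ` gr_reps" by blast
  qed
qed

lemma gr_of_eqI:
  assumes "a \<in> gr_reps" "b \<in> gr_reps" "\<And>k. a k \<ominus> b k \<in> F (k - 1)"
  shows "gr_of a = gr_of b"
  unfolding gr_of_def fun_eq_iff
  using coset_eqI[OF gr_reps_carrier[OF assms(1)] gr_reps_carrier[OF assms(2)] assms(3)] by blast

lemma gr_reps_add:
  assumes "a \<in> gr_reps" "b \<in> gr_reps"
  shows "(\<lambda>k. a k \<oplus> b k) \<in> gr_reps"
proof -
  have "{k. a k \<oplus> b k \<notin> F (k - 1)} \<subseteq> {k. a k \<notin> F (k - 1)} \<union> {k. b k \<notin> F (k - 1)}"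
    using F_add by blast
  then show ?thesis
    using assms by (auto simp: gr_reps_def F_add intro: finite_subset)
qed

lemma gr_of_add: "a \<in> gr_reps \<Longrightarrow> b \<in> gr_reps \<Longrightarrow> gr_of a \<oplus>\<^bsub>Gr\<^esub> gr_of b = gr_of (\<lambda>k. a k \<oplus> b k)"
  by (simp add: assoc_graded_def gr_of_def gr_piece_simps coset_add gr_reps_carrier)

lemma gr_of_smult: "a \<in> gr_reps \<Longrightarrow> c \<odot>\<^bsub>Gr\<^esub> gr_of a = gr_of (\<lambda>k. c \<odot> a k)"
  by (simp add: assoc_graded_def gr_of_def gr_piece_def coset_smult gr_reps_carrier)

lemma single_gr_reps: "a \<in> F k \<Longrightarrow> (\<lambda>j. if j = k then a else \<zero>) \<in> gr_reps"
proof -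
  assume a: "a \<in> F k"
  have "{j. (if j = k then a else \<zero>) \<notin> F (j - 1)} \<subseteq> {k}" using F_zero by auto
  then show ?thesis using a F_zero by (auto simp: gr_reps_def intro: finite_subset)
qed

lemma gr_class_gr_of: "gr_class A F k a = gr_of (\<lambda>j. if j = k then a else \<zero>)"
  by (auto simp: gr_class_def gr_of_def coset_zero coset_def[symmetric] fun_eq_iff)

lemma gr_class_closed: "a \<in> F k \<Longrightarrow> gr_class A F k a \<in> carrier Gr"
  by (simp add: gr_class_gr_of carrier_Gr single_gr_reps)

lemma gr_class_add: "a \<in> F k \<Longrightarrow> b \<in> F k \<Longrightarrow>
    gr_class A F k a \<oplus>\<^bsub>Gr\<^esub> gr_class A F k b = gr_class A F k (a \<oplus> b)"
  by (simp add: gr_class_gr_of gr_of_add single_gr_reps) (auto intro!: arg_cong[of _ _ gr_of])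

lemma smult_zero: "c \<odot> \<zero> = \<zero>"
  using smult_add[of \<zero> \<zero> c] smult_closed[OF zero_closed, of c] by (simp add: add.r_cancel_one')

lemma gr_class_smult: "a \<in> F k \<Longrightarrow> c \<odot>\<^bsub>Gr\<^esub> gr_class A F k a = gr_class A F k (c \<odot> a)"
  by (simp add: gr_class_gr_of gr_of_smult single_gr_reps if_distrib smult_zero cong: if_cong)

lemma gr_class_eqI: "a \<in> F k \<Longrightarrow> b \<in> F k \<Longrightarrow> a \<ominus> b \<in> F (k - 1) \<Longrightarrow> gr_class A F k a = gr_class A F k b"
  using coset_eqI[of a b k] by (simp add: gr_class_def coset_def F_carrier cong: if_cong)

lemma Gr_add_closed: "g \<in> carrier Gr \<Longrightarrow> h \<in> carrier Gr \<Longrightarrow> g \<oplus>\<^bsub>Gr\<^esub> h \<in> carrier Gr"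
  by (auto simp: carrier_Gr gr_of_add gr_reps_add)

text \<open>An element of the graded algebra is the sum of its finitely many nonzero homogeneous
  components.\<close>

lemma Gr_induct [consumes 1, case_names homogeneous add]:
  assumes g: "g \<in> carrier Gr"
    and hom: "\<And>k a. a \<in> F k \<Longrightarrow> P (gr_class A F k a)"
    and add: "\<And>g h. g \<in> carrier Gr \<Longrightarrow> h \<in> carrier Gr \<Longrightarrow> P g \<Longrightarrow> P h \<Longrightarrow> P (g \<oplus>\<^bsub>Gr\<^esub> h)"
  shows "P g"
proof -
  obtain a where a: "a \<in> gr_reps" "g = gr_of a" using g carrier_Gr by blast
  \<comment> \<open>\<open>r S\<close> retains the components in the degrees of \<open>S\<close>;
    with \<open>S\<close> the support it has the same classes as \<open>a\<close>.\<close>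
  define r where "r S = (\<lambda>k. if k \<in> S then a k else \<zero>)" for S
  have rR: "r S \<in> gr_reps" if "finite S" for S
  proof -
    have "{k. r S k \<notin> F (k - 1)} \<subseteq> S" using F_zero by (auto simp: r_def)
    then show ?thesis using gr_reps_F[OF a(1)] F_zero that by (auto simp: gr_reps_def r_def intro: finite_subset)
  qed
  have "P (gr_of (r S))" if "finite S" for S
    using that
  proof (induction S rule: finite_induct)
    case empty
    have "gr_of (r {}) = gr_class A F 0 \<zero>" by (auto simp: r_def gr_class_gr_of intro!: arg_cong[of _ _ gr_of])
    then show ?case using hom[OF F_zero] by simp
  next
    case (insert k S)
    have "gr_of (r (insert k S)) = gr_class A F k (a k) \<oplus>\<^bsub>Gr\<^esub> gr_of (r S)"
      unfolding gr_class_gr_of using insert gr_reps_carrier[OF a(1)]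
      by (subst gr_of_add) (auto simp: single_gr_reps gr_reps_F[OF a(1)] rR, auto simp: r_def intro!: arg_cong[of _ _ gr_of])
    moreover have "gr_of (r S) \<in> carrier Gr" using rR insert by (auto simp: carrier_Gr)
    ultimately show ?case
      using insert add[OF gr_class_closed] hom gr_reps_F[OF a(1)] by simp
  qed
  from this[of "{k. a k \<notin> F (k - 1)}"] have "P (gr_of (r {k. a k \<notin> F (k - 1)}))"
    using a(1) by (simp add: gr_reps_def)
  moreover have "gr_of (r {k. a k \<notin> F (k - 1)}) = gr_of a"
    using a(1) gr_reps_carrier[OF a(1)] gr_reps_F[OF a(1)] F_zero
    by (intro gr_of_eqI rR) (auto simp: gr_reps_def r_def minus_eq r_neg F_uminus)
  ultimately show ?thesis using a by simp
qed

text \<open>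
  Operations that induce an operation of degree \<open>-e\<close> on the associated graded algebra: the product
  with \<open>e = 0\<close>, the commutator with \<open>e = 1\<close>.
\<close>

definition gr_op :: "int \<Rightarrow> ('b \<Rightarrow> 'b \<Rightarrow> 'b) \<Rightarrow> bool" where
  "gr_op e f \<longleftrightarrow> (\<forall>i j. \<forall>a\<in>F i. \<forall>b\<in>F j. f a b \<in> F (i + j - e)) \<and>
     (\<forall>a\<in>carrier A. \<forall>b\<in>carrier A. \<forall>c\<in>carrier A.
        f (a \<oplus> b) c = f a c \<oplus> f b c \<and> f c (a \<oplus> b) = f c a \<oplus> f c b) \<and>
     (\<forall>a\<in>carrier A. \<forall>b\<in>carrier A. f a b \<in> carrier A)"

lemma gr_op_F: "gr_op e f \<Longrightarrow> a \<in> F i \<Longrightarrow> b \<in> F j \<Longrightarrow> k = i + j - e \<Longrightarrow> f a b \<in> F k"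
  by (auto simp: gr_op_def)

lemma gr_op_carrier: "gr_op e f \<Longrightarrow> a \<in> carrier A \<Longrightarrow> b \<in> carrier A \<Longrightarrow> f a b \<in> carrier A"
  by (auto simp: gr_op_def)

lemma gr_op_add:
  "gr_op e f \<Longrightarrow> a \<in> carrier A \<Longrightarrow> b \<in> carrier A \<Longrightarrow> c \<in> carrier A \<Longrightarrow> f (a \<oplus> b) c = f a c \<oplus> f b c"
  "gr_op e f \<Longrightarrow> a \<in> carrier A \<Longrightarrow> b \<in> carrier A \<Longrightarrow> c \<in> carrier A \<Longrightarrow> f c (a \<oplus> b) = f c a \<oplus> f c b"
  by (auto simp: gr_op_def)

lemma gr_op_zero:
  assumes "gr_op e f" "a \<in> carrier A"
  shows "f a \<zero> = \<zero>" "f \<zero> a = \<zero>"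
  using gr_op_add[OF assms(1) zero_closed zero_closed assms(2)] gr_op_carrier[OF assms(1)] assms(2)
  by (simp_all add: add.r_cancel_one')

lemma gr_op_cosets:
  assumes f: "gr_op e f" and a: "a \<in> F i" and b: "b \<in> F j" and k: "k = i + j - e"
  shows "(\<Union>a'\<in>coset i a. \<Union>b'\<in>coset j b. F (k - 1) +> f a' b') = coset k (f a b)"
proof -
  note ac = F_carrier[OF a] and bc = F_carrier[OF b]
  have "coset k (f a' b') = coset k (f a b)" if a': "a' \<in> coset i a" and b': "b' \<in> coset j b" for a' b'
  proof (rule coset_eqI)
    note ac' = coset_carrier[OF ac a'] and bc' = coset_carrier[OF bc b']
    \<comment> \<open>Writing a' = u + a and b' = v + b, the difference f a' b' - f a b equals f u
      b' + f a v, and both summands have lost one degree.\<close>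
    define u where "u = a' \<ominus> a"
    define v where "v = b' \<ominus> b"
    have u: "u \<in> F (i - 1)" and v: "v \<in> F (j - 1)"
      using a' b' mem_coset[OF ac ac'] mem_coset[OF bc bc'] by (auto simp: u_def v_def)
    have a'u: "a' = u \<oplus> a" and b'v: "b' = v \<oplus> b"
      using ac ac' bc bc' by (simp_all add: u_def v_def minus_eq a_assoc l_neg)
    note uc = F_carrier[OF u] and vc = F_carrier[OF v]
    have "f a' b' = f u b' \<oplus> (f a v \<oplus> f a b)"
      using gr_op_add(1)[OF f uc ac bc'] gr_op_add(2)[OF f vc bc ac]
      by (simp add: a'u b'v[symmetric])
    then have "f a' b' \<ominus> f a b = f u b' \<oplus> f a v"
      using gr_op_carrier[OF f] uc vc ac bc bc' by (simp add: minus_eq a_assoc r_neg)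
    moreover have "b' \<in> F j" unfolding b'v using F_mono[OF v, of j] b by (simp add: F_add)
    ultimately show "f a' b' \<ominus> f a b \<in> F (k - 1)"
      using gr_op_F[OF f u, of b' j "k - 1"] gr_op_F[OF f a v, of "k - 1"] k by (simp add: F_add)
    show "f a' b' \<in> carrier A" "f a b \<in> carrier A"
      using gr_op_carrier[OF f] ac bc ac' bc' by auto
  qed
  then have "(\<Union>a'\<in>coset i a. \<Union>b'\<in>coset j b. coset k (f a' b')) =
      (\<Union>a'\<in>coset i a. \<Union>b'\<in>coset j b. coset k (f a b))"
    by (intro SUP_cong refl)
  also have "\<dots> = coset k (f a b)"
    using coset_self[OF ac, of i] coset_self[OF bc, of j] by auto
  finally show ?thesis by (simp only: coset_def[of k])
qed

text \<open>The index set \<open>S\<close> may be any finite set containing the support of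
  \<open>a\<close>, so that families with different supports can share one.\<close>

definition gr_conv :: "int \<Rightarrow> ('b \<Rightarrow> 'b \<Rightarrow> 'b) \<Rightarrow> int set \<Rightarrow> (int \<Rightarrow> 'b) \<Rightarrow> (int \<Rightarrow> 'b) \<Rightarrow> int \<Rightarrow> 'b" where
  "gr_conv e f S a b k = (\<Oplus>i\<in>S. f (a i) (b (k + e - i)))"

lemma gr_operation_gr_of:
  assumes f: "gr_op e f" and a: "a \<in> gr_reps" and b: "b \<in> gr_reps" and S: "finite S" "{k. a k \<notin> F (k - 1)} \<subseteq> S"
  shows "gr_operation A F e f (gr_of a) (gr_of b) = gr_of (gr_conv e f S a b)" "gr_conv e f S a b \<in> gr_reps"
proof -
  have ab: "f (a i) (b (k + e - i)) \<in> F k" for i k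
    using gr_op_F[OF f gr_reps_F[OF a] gr_reps_F[OF b], of k i "k + e - i"] by simp
  have coset: "(\<Union>x\<in>gr_of a i. \<Union>y\<in>gr_of b (k + e - i). F (k - 1) +> f x y) = coset k (f (a i) (b (k + e - i)))" for i k
    unfolding gr_of_def by (rule gr_op_cosets[OF f gr_reps_F[OF a] gr_reps_F[OF b]]) simp
  show "gr_operation A F e f (gr_of a) (gr_of b) = gr_of (gr_conv e f S a b)"
  proof
    fix k
    interpret P: abelian_monoid "gr_piece A F k" by (rule abelian_monoid_gr_piece)
    have "gr_operation A F e f (gr_of a) (gr_of b) k =
       (\<Oplus>\<^bsub>gr_piece A F k\<^esub>i\<in>{k. a k \<notin> F (k - 1)}. coset k (f (a i) (b (k + e - i))))"
      by (simp only: gr_operation_def coset support_gr_of[OF a])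
    also have "\<dots> = (\<Oplus>\<^bsub>gr_piece A F k\<^esub>i\<in>S. coset k (f (a i) (b (k + e - i))))"
    proof (rule P.add.finprod_mono_neutral_cong_left[OF S])
      fix i assume i: "i \<in> S - {k. a k \<notin> F (k - 1)}"
      then have "f (a i) (b (k + e - i)) \<in> F (k - 1)"
        using gr_op_F[OF f _ gr_reps_F[OF b], of "a i" "i - 1" "k - 1" "k + e - i"] by simp
      then show "coset k (f (a i) (b (k + e - i))) = \<zero>\<^bsub>gr_piece A F k\<^esub>"
        using coset_eq_zero_iff[OF F_carrier[OF ab]] by (simp add: gr_piece_simps coset_zero)
    qed (use ab in \<open>auto simp: gr_piece_simps(1)\<close>)
    also have "\<dots> = gr_of (gr_conv e f S a b) k"
      using gr_piece_finsum[OF S(1), of "\<lambda>i. f (a i) (b (k + e - i))" k] ab by (simp add: gr_of_def gr_conv_def)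
    finally show "gr_operation A F e f (gr_of a) (gr_of b) k = gr_of (gr_conv e f S a b) k" .
  qed
  have mem: "gr_conv e f S a b k \<in> F k" for k
    using gr_piece_finsum[OF S(1), of "\<lambda>i. f (a i) (b (k + e - i))" k] ab by (simp add: gr_conv_def)
  \<comment> \<open>A component of degree \<open>k\<close> needs a nonzero class of \<open>b\<close>
    in degree k + e - i for some \<open>i\<close> in \<open>S\<close>, which leaves finitely many
    \<open>k\<close>.\<close>
  have "{k. gr_conv e f S a b k \<notin> F (k - 1)} \<subseteq> (\<lambda>(i, j). i + j - e) ` (S \<times> {j. b j \<notin> F (j - 1)})"
  proof
    fix k assume k: "k \<in> {k. gr_conv e f S a b k \<notin> F (k - 1)}"
    have "\<exists>i\<in>S. b (k + e - i) \<notin> F (k + e - i - 1)"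
    proof (rule ccontr)
      assume "\<not> ?thesis"
      then have "f (a i) (b (k + e - i)) \<in> F (k - 1)" if "i \<in> S" for i
        using that gr_op_F[OF f gr_reps_F[OF a], of "b (k + e - i)" "k + e - i - 1" "k - 1" i] by auto
      then have "gr_conv e f S a b k \<in> F (k - 1)"
        using gr_piece_finsum[OF S(1), of "\<lambda>i. f (a i) (b (k + e - i))" "k - 1"] by (simp add: gr_conv_def)
      with k show False by simp
    qed
    then obtain i where "i \<in> S" "b (k + e - i) \<notin> F (k + e - i - 1)" by blast
    then show "k \<in> (\<lambda>(i, j). i + j - e) ` (S \<times> {j. b j \<notin> F (j - 1)})"
      by (intro image_eqI[of _ _ "(i, k + e - i)"]) auto
  qed
  moreover have "finite (S \<times> {j. b j \<notin> F (j - 1)})" using S(1) b by (simp add: gr_reps_def)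
  ultimately show "gr_conv e f S a b \<in> gr_reps"
    using mem by (auto simp: gr_reps_def intro: finite_subset)
qed

lemma gr_operation_closed:
  assumes "gr_op e f" "g \<in> carrier Gr" "h \<in> carrier Gr"
  shows "gr_operation A F e f g h \<in> carrier Gr"
proof -
  obtain a b where "a \<in> gr_reps" "b \<in> gr_reps" "g = gr_of a" "h = gr_of b" using assms carrier_Gr by blast
  then show ?thesis
    using gr_operation_gr_of[OF assms(1), of a b "{k. a k \<notin> F (k - 1)}"] by (auto simp: gr_reps_def carrier_Gr)
qed

lemma gr_operation_add:
  assumes f: "gr_op e f" and "g \<in> carrier Gr" "g' \<in> carrier Gr" "h \<in> carrier Gr"
  shows "gr_operation A F e f (g \<oplus>\<^bsub>Gr\<^esub> g') h = gr_operation A F e f g h \<oplus>\<^bsub>Gr\<^esub> gr_operation A F e f g' h"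
    and "gr_operation A F e f h (g \<oplus>\<^bsub>Gr\<^esub> g') = gr_operation A F e f h g \<oplus>\<^bsub>Gr\<^esub> gr_operation A F e f h g'"
proof -
  obtain a a' b where gr_reps: "a \<in> gr_reps" "a' \<in> gr_reps" "b \<in> gr_reps" and eq: "g = gr_of a" "g' = gr_of a'" "h = gr_of b"
    using assms carrier_Gr by blast
  note c = gr_reps_carrier[OF gr_reps(1)] gr_reps_carrier[OF gr_reps(2)] gr_reps_carrier[OF gr_reps(3)]
  \<comment> \<open>One index set for all the convolutions, which then add up term by term.\<close>
  define S where "S = {k. a k \<notin> F (k - 1)} \<union> {k. a' k \<notin> F (k - 1)} \<union> {k. b k \<notin> F (k - 1)}"
  have S: "finite S" using gr_reps by (simp add: S_def gr_reps_def)
  have Sa: "{k. a k \<notin> F (k - 1)} \<subseteq> S" "{k. a' k \<notin> F (k - 1)} \<subseteq> S" "{k. b k \<notin> F (k - 1)} \<subseteq> S"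
    by (auto simp: S_def)
  have Saa: "{k. a k \<oplus> a' k \<notin> F (k - 1)} \<subseteq> S" using F_add by (auto simp: S_def)
  note op = gr_operation_gr_of[OF f gr_reps(1) gr_reps(3) S Sa(1)] gr_operation_gr_of[OF f gr_reps(2) gr_reps(3) S Sa(2)]
     gr_operation_gr_of[OF f gr_reps_add[OF gr_reps(1,2)] gr_reps(3) S Saa]
     gr_operation_gr_of[OF f gr_reps(3) gr_reps(1) S Sa(3)] gr_operation_gr_of[OF f gr_reps(3) gr_reps(2) S Sa(3)]
     gr_operation_gr_of[OF f gr_reps(3) gr_reps_add[OF gr_reps(1,2)] S Sa(3)]
  show "gr_operation A F e f (g \<oplus>\<^bsub>Gr\<^esub> g') h = gr_operation A F e f g h \<oplus>\<^bsub>Gr\<^esub> gr_operation A F e f g' h"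
  proof -
    have "gr_conv e f S (\<lambda>k. a k \<oplus> a' k) b = (\<lambda>k. gr_conv e f S a b k \<oplus> gr_conv e f S a' b k)"
      using c gr_op_carrier[OF f] by (auto simp: gr_conv_def gr_op_add[OF f] finsum_addf)
    then show ?thesis using op gr_reps by (simp add: eq gr_of_add)
  qed
  show "gr_operation A F e f h (g \<oplus>\<^bsub>Gr\<^esub> g') = gr_operation A F e f h g \<oplus>\<^bsub>Gr\<^esub> gr_operation A F e f h g'"
  proof -
    have "gr_conv e f S b (\<lambda>k. a k \<oplus> a' k) = (\<lambda>k. gr_conv e f S b a k \<oplus> gr_conv e f S b a' k)"
      using c gr_op_carrier[OF f] by (auto simp: gr_conv_def gr_op_add[OF f] finsum_addf)
    then show ?thesis using op gr_reps by (simp add: eq gr_of_add)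
  qed
qed

lemma gr_operation_class:
  assumes f: "gr_op e f" and a: "a \<in> F i" and b: "b \<in> F j"
  shows "gr_operation A F e f (gr_class A F i a) (gr_class A F j b) = gr_class A F (i + j - e) (f a b)"
proof -
  let ?s = "\<lambda>i a j. if j = i then a else \<zero>"
  have "{k. ?s i a k \<notin> F (k - 1)} \<subseteq> {i}" using F_zero by auto
  from gr_operation_gr_of(1)[OF f single_gr_reps[OF a] single_gr_reps[OF b] _ this]
  have "gr_operation A F e f (gr_class A F i a) (gr_class A F j b) = gr_of (gr_conv e f {i} (?s i a) (?s j b))"
    by (simp add: gr_class_gr_of)
  also have "gr_conv e f {i} (?s i a) (?s j b) = ?s (i + j - e) (f a b)"
    using F_carrier[OF a] F_carrier[OF b] gr_op_carrier[OF f] gr_op_zero[OF f]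
    by (auto simp: gr_conv_def fun_eq_iff)
  finally show ?thesis by (simp add: gr_class_gr_of)
qed

lemma gr_op_mult: "gr_op 0 (mult A)"
  by (auto simp: gr_op_def F_mult l_distr r_distr)

lemma gr_op_commutator: "gr_op 1 (commutator A)"
proof -
  have "commutator A (a \<oplus> b) c = commutator A a c \<oplus> commutator A b c"
    if "a \<in> carrier A" "b \<in> carrier A" "c \<in> carrier A" for a b c
    unfolding commutator_def using that by algebra
  moreover have "commutator A c (a \<oplus> b) = commutator A c a \<oplus> commutator A c b"
    if "a \<in> carrier A" "b \<in> carrier A" "c \<in> carrier A" for a b c
    unfolding commutator_def using that by algebra
  moreover have "commutator A a b \<in> carrier A" if "a \<in> carrier A" "b \<in> carrier A" for a b
    unfolding commutator_def using that by simp
  ultimately show ?thesis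
    by (simp add: gr_op_def F_commutator)
qed

lemma Gr_mult: "mult Gr = gr_operation A F 0 (mult A)"
  by (simp add: assoc_graded_def)

end

subsection \<open>The induced Poisson bracket\<close>

locale graded_iso = filtered_algebra A F + S: ring S
  for A :: "(complex, 'b) module" (structure) and F :: "int \<Rightarrow> 'b set"
    and S :: "(complex, 'c) module" +
  fixes \<phi> :: "(int \<Rightarrow> 'b set) \<Rightarrow> 'c"
  assumes iso: "\<phi> \<in> ring_iso (assoc_graded A F) S"
    and iso_smult: "g \<in> carrier (assoc_graded A F) \<Longrightarrow> \<phi> (c \<odot>\<^bsub>assoc_graded A F\<^esub> g) = c \<odot>\<^bsub>S\<^esub> \<phi> g"
    and S_smult_add: "x \<in> carrier S \<Longrightarrow> y \<in> carrier S \<Longrightarrow> c \<odot>\<^bsub>S\<^esub> (x \<oplus>\<^bsub>S\<^esub> y) = c \<odot>\<^bsub>S\<^esub> x \<oplus>\<^bsub>S\<^esub> c \<odot>\<^bsub>S\<^esub> y"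
    and S_smult_closed: "x \<in> carrier S \<Longrightarrow> c \<odot>\<^bsub>S\<^esub> x \<in> carrier S"
begin

text \<open>The symbol map: the class of an element of degree at most \<open>k\<close>, viewed in
  \<open>S\<close>.\<close>

definition \<psi> :: "int \<Rightarrow> 'b \<Rightarrow> 'c" where
  "\<psi> k a = \<phi> (gr_class A F k a)"

text \<open>The commutator bracket transported along \<open>\<phi>\<close>. On symbols it is the
  symbol of a commutator in \<open>A\<close>, from which the Poisson axioms follow.\<close>

definition bracket :: "'c \<Rightarrow> 'c \<Rightarrow> 'c" where
  "bracket f g = \<phi> (gr_bracket A F (inv_into (carrier Gr) \<phi> f) (inv_into (carrier Gr) \<phi> g))"

lemma phi_bij: "bij_betw \<phi> (carrier Gr) (carrier S)"
  using iso by (simp add: ring_iso_def)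

lemma phi_closed: "g \<in> carrier Gr \<Longrightarrow> \<phi> g \<in> carrier S"
  using phi_bij by (auto simp: bij_betw_def)

lemma phi_add: "g \<in> carrier Gr \<Longrightarrow> h \<in> carrier Gr \<Longrightarrow> \<phi> (g \<oplus>\<^bsub>Gr\<^esub> h) = \<phi> g \<oplus>\<^bsub>S\<^esub> \<phi> h"
  using iso by (simp add: ring_iso_def ring_hom_def)

lemma phi_mult: "g \<in> carrier Gr \<Longrightarrow> h \<in> carrier Gr \<Longrightarrow> \<phi> (g \<otimes>\<^bsub>Gr\<^esub> h) = \<phi> g \<otimes>\<^bsub>S\<^esub> \<phi> h"
  using iso by (simp add: ring_iso_def ring_hom_def)

lemma bracket_phi:
  assumes "g \<in> carrier Gr" "h \<in> carrier Gr"
  shows "bracket (\<phi> g) (\<phi> h) = \<phi> (gr_bracket A F g h)"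
  using assms phi_bij by (simp add: bracket_def bij_betw_def inv_into_f_f)

lemma S_cases:
  assumes "f \<in> carrier S"
  obtains g where "g \<in> carrier Gr" "f = \<phi> g"
  using assms phi_bij by (auto simp: bij_betw_def)

lemma psi_closed: "a \<in> F k \<Longrightarrow> \<psi> k a \<in> carrier S"
  by (simp add: \<psi>_def phi_closed gr_class_closed)

lemma psi_add: "a \<in> F k \<Longrightarrow> b \<in> F k \<Longrightarrow> \<psi> k a \<oplus>\<^bsub>S\<^esub> \<psi> k b = \<psi> k (a \<oplus> b)"
  by (simp add: \<psi>_def phi_add[symmetric] gr_class_closed gr_class_add)

lemma psi_mult: "a \<in> F k \<Longrightarrow> b \<in> F l \<Longrightarrow> \<psi> k a \<otimes>\<^bsub>S\<^esub> \<psi> l b = \<psi> (k + l) (a \<otimes> b)"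
  using gr_operation_class[OF gr_op_mult, of a k b l]
  by (simp add: \<psi>_def phi_mult[symmetric] gr_class_closed Gr_mult)

lemma psi_smult: "a \<in> F k \<Longrightarrow> c \<odot>\<^bsub>S\<^esub> \<psi> k a = \<psi> k (c \<odot> a)"
  by (simp add: \<psi>_def iso_smult[symmetric] gr_class_closed gr_class_smult)

lemma psi_one: "\<psi> 0 \<one> = \<one>\<^bsub>S\<^esub>"
  using iso by (simp add: \<psi>_def ring_iso_def ring_hom_def assoc_graded_def)

lemma psi_zero: "\<psi> k \<zero> = \<zero>\<^bsub>S\<^esub>"
  using psi_add[OF F_zero F_zero, of k] psi_closed[OF F_zero, of k]
  by (simp add: S.add.r_cancel_one')

lemma psi_eqI: "a \<in> F k \<Longrightarrow> b \<in> F k \<Longrightarrow> a \<ominus> b \<in> F (k - 1) \<Longrightarrow> \<psi> k a = \<psi> k b"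
  unfolding \<psi>_def by (intro arg_cong[of _ _ \<phi>] gr_class_eqI)

lemma psi_uminus:
  assumes "a \<in> F k"
  shows "\<ominus>\<^bsub>S\<^esub> \<psi> k a = \<psi> k (\<ominus> a)"
  using psi_add[OF F_uminus[OF assms] assms] assms
  by (intro S.minus_equality) (auto simp: l_neg F_carrier psi_zero psi_closed F_uminus)

lemma psi_minus: "a \<in> F k \<Longrightarrow> b \<in> F k \<Longrightarrow> \<psi> k a \<ominus>\<^bsub>S\<^esub> \<psi> k b = \<psi> k (a \<ominus> b)"
  by (simp add: S.minus_eq minus_eq psi_uminus psi_add F_uminus)

text \<open>Reduces additive identities for \<open>bracket\<close> to symbols, where they become
  identities of commutators.\<close>

lemma S_induct [consumes 1, case_names homogeneous add]:
  assumes f: "f \<in> carrier S"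
    and hom: "\<And>k a. a \<in> F k \<Longrightarrow> P (\<psi> k a)"
    and add: "\<And>f g. f \<in> carrier S \<Longrightarrow> g \<in> carrier S \<Longrightarrow> P f \<Longrightarrow> P g \<Longrightarrow> P (f \<oplus>\<^bsub>S\<^esub> g)"
  shows "P f"
proof -
  obtain g where "g \<in> carrier Gr" "f = \<phi> g" using f by (rule S_cases)
  moreover have "P (\<phi> g)" if "g \<in> carrier Gr" for g
    using that by (induction rule: Gr_induct) (auto simp: hom[unfolded \<psi>_def] phi_add phi_closed add)
  ultimately show ?thesis by simp
qed

lemma bracket_psi: "a \<in> F k \<Longrightarrow> b \<in> F l \<Longrightarrow> bracket (\<psi> k a) (\<psi> l b) = \<psi> (k + l - 1) (commutator A a b)"
  using gr_operation_class[OF gr_op_commutator, of a k b l]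
  by (simp add: \<psi>_def bracket_phi gr_class_closed gr_bracket_def)

lemma bracket_closed: "f \<in> carrier S \<Longrightarrow> g \<in> carrier S \<Longrightarrow> bracket f g \<in> carrier S"
  by (auto elim!: S_cases simp: bracket_phi gr_bracket_def gr_operation_closed[OF gr_op_commutator] phi_closed)

lemma bracket_add:
  assumes "f \<in> carrier S" "g \<in> carrier S" "h \<in> carrier S"
  shows "bracket (f \<oplus>\<^bsub>S\<^esub> g) h = bracket f h \<oplus>\<^bsub>S\<^esub> bracket g h"
    "bracket h (f \<oplus>\<^bsub>S\<^esub> g) = bracket h f \<oplus>\<^bsub>S\<^esub> bracket h g"
  using assms gr_operation_add[OF gr_op_commutator] gr_operation_closed[OF gr_op_commutator]
  by (auto elim!: S_cases simp: phi_add[symmetric] bracket_phi gr_bracket_def Gr_add_closed)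

lemma smult_uminus: "a \<in> carrier A \<Longrightarrow> c \<odot> (\<ominus> a) = \<ominus> (c \<odot> a)"
  using smult_add[of "\<ominus> a" a c] by (intro minus_equality[symmetric]) (auto simp: smult_closed l_neg smult_zero)

lemma commutator_smult:
  assumes "a \<in> carrier A" "b \<in> carrier A"
  shows "commutator A (c \<odot> a) b = c \<odot> commutator A a b" "commutator A a (c \<odot> b) = c \<odot> commutator A a b"
  using assms by (simp_all add: commutator_def minus_eq smult_lmult smult_rmult smult_add smult_uminus)

lemma bracket_smult:
  assumes "f \<in> carrier S" "g \<in> carrier S"
  shows "bracket (z \<odot>\<^bsub>S\<^esub> f) g = z \<odot>\<^bsub>S\<^esub> bracket f g \<and> bracket f (z \<odot>\<^bsub>S\<^esub> g) = z \<odot>\<^bsub>S\<^esub> bracket f g"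
  using assms
proof (induction rule: S_induct)
  case (homogeneous k a)
  from homogeneous(2) show ?case
  proof (induction rule: S_induct)
    case (homogeneous l b)
    then show ?case using \<open>a \<in> F k\<close>
      by (simp add: psi_smult bracket_psi F_smult commutator_smult F_carrier F_commutator)
  next
    case (add g h)
    then show ?case using \<open>a \<in> F k\<close>
      by (simp add: bracket_add S_smult_add S_smult_closed psi_closed bracket_closed)
  qed
next
  case (add f f')
  then show ?case by (simp add: bracket_add S_smult_add S_smult_closed bracket_closed)
qed

lemma bracket_antisym:
  assumes "f \<in> carrier S" "g \<in> carrier S"
  shows "bracket g f = \<ominus>\<^bsub>S\<^esub> bracket f g"
  using assms
proof (induction rule: S_induct)
  case (homogeneous k a)
  from homogeneous(2) show ?case
  proof (induction rule: S_induct)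
    case (homogeneous l b)
    have "commutator A b a = \<ominus> commutator A a b"
      unfolding commutator_def using F_carrier[OF \<open>a \<in> F k\<close>] F_carrier[OF \<open>b \<in> F l\<close>] by algebra
    then show ?case using \<open>a \<in> F k\<close> \<open>b \<in> F l\<close>
      by (simp add: bracket_psi psi_uminus F_commutator add.commute)
  next
    case (add g h)
    then show ?case using \<open>a \<in> F k\<close>
      by (simp add: bracket_add psi_closed bracket_closed S.minus_add)
  qed
next
  case (add f f')
  then show ?case by (simp add: bracket_add bracket_closed S.minus_add)
qed

text \<open>A sum leaves two cross terms, which cancel by antisymmetry.\<close>

lemma bracket_self:
  assumes "f \<in> carrier S"
  shows "bracket f f = \<zero>\<^bsub>S\<^esub>"
  using assms
proof (induction rule: S_induct)
  case (homogeneous k a)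
  then show ?case by (simp add: bracket_psi commutator_def F_carrier minus_eq r_neg psi_zero)
next
  case (add f g)
  then show ?case
    using bracket_antisym[of f g] by (simp add: bracket_add bracket_closed S.l_neg)
qed

lemma bracket_leibniz:
  assumes "f \<in> carrier S" "g \<in> carrier S" "h \<in> carrier S"
  shows "bracket f (g \<otimes>\<^bsub>S\<^esub> h) = bracket f g \<otimes>\<^bsub>S\<^esub> h \<oplus>\<^bsub>S\<^esub> g \<otimes>\<^bsub>S\<^esub> bracket f h"
  using assms
proof (induction arbitrary: g h rule: S_induct)
  case (homogeneous k a g h)
  note a = homogeneous(1)
  from homogeneous(2,3) show ?case
  proof (induction arbitrary: h rule: S_induct)
    case (homogeneous l b h)
    note b = homogeneous(1)
    from homogeneous(2) show ?case
    proof (induction rule: S_induct)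
      case (homogeneous m c)
      note c = homogeneous(1)
      let ?K = "k + (l + m) - 1"
      have comm: "commutator A a (b \<otimes> c) = commutator A a b \<otimes> c \<oplus> b \<otimes> commutator A a c"
        unfolding commutator_def using F_carrier[OF a] F_carrier[OF b] F_carrier[OF c] by algebra
      \<comment> \<open>Symbols carry their degree, so the degrees of the two summands must be made
        literally equal before \<open>psi_add\<close> applies.\<close>
      have idx: "k + l - 1 + m = ?K" "l + (k + m - 1) = ?K" by auto
      have mem: "commutator A a b \<otimes> c \<in> F ?K" "b \<otimes> commutator A a c \<in> F ?K"
        using F_mult[OF F_commutator[OF a b] c] F_mult[OF b F_commutator[OF a c]] by (simp_all only: idx)
      show ?case
        unfolding psi_mult[OF b c] bracket_psi[OF a F_mult[OF b c]] bracket_psi[OF a b] bracket_psi[OF a c]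
          psi_mult[OF F_commutator[OF a b] c] psi_mult[OF b F_commutator[OF a c]] idx psi_add[OF mem] comm ..
    next
      case (add h h')
      then show ?case using a b
        by (simp add: S.r_distr bracket_add psi_closed bracket_closed) (simp add: S.a_ac psi_closed bracket_closed)
    qed
  next
    case (add g g' h)
    then show ?case using a
      by (simp add: S.l_distr bracket_add psi_closed bracket_closed) (simp add: S.a_ac psi_closed bracket_closed)
  qed
next
  case (add f f' g h)
  then show ?case
    by (simp add: bracket_add bracket_closed S.l_distr S.r_distr) (simp add: S.a_ac bracket_closed)
qed

lemma bracket_jacobi:
  assumes "f \<in> carrier S" "g \<in> carrier S" "h \<in> carrier S"
  shows "bracket f (bracket g h) \<oplus>\<^bsub>S\<^esub> bracket g (bracket h f) \<oplus>\<^bsub>S\<^esub> bracket h (bracket f g) = \<zero>\<^bsub>S\<^esub>"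
    (is "?J f g h = _")
proof -
  \<comment> \<open>Additivity of the cyclic sum in each argument carries the three nested
    inductions to homogeneous elements.\<close>
  have J_add: "?J (f \<oplus>\<^bsub>S\<^esub> f') g h = ?J f g h \<oplus>\<^bsub>S\<^esub> ?J f' g h" "?J g (f \<oplus>\<^bsub>S\<^esub> f') h = ?J g f h \<oplus>\<^bsub>S\<^esub> ?J g f' h"
    "?J g h (f \<oplus>\<^bsub>S\<^esub> f') = ?J g h f \<oplus>\<^bsub>S\<^esub> ?J g h f'"
    if "f \<in> carrier S" "f' \<in> carrier S" "g \<in> carrier S" "h \<in> carrier S" for f f' g h
    using that by (simp_all add: bracket_add bracket_closed S.a_ac)
  show ?thesis
    using assms
  proof (induction arbitrary: g h rule: S_induct)
    case (homogeneous k a g h)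
    note a = homogeneous(1)
    from homogeneous(2,3) show ?case
    proof (induction arbitrary: h rule: S_induct)
      case (homogeneous l b h)
      note b = homogeneous(1)
      from homogeneous(2) show ?case
      proof (induction rule: S_induct)
        case (homogeneous m c)
        note c = homogeneous(1)
        let ?K = "k + l + m - 2"
        note cc = F_carrier[OF a] F_carrier[OF b] F_carrier[OF c]
        have comm: "commutator A a (commutator A b c) \<oplus> commutator A b (commutator A c a) \<oplus>
            commutator A c (commutator A a b) = \<zero>"
          unfolding commutator_def using cc by algebra
        have idx: "k + (l + m - 1) - 1 = ?K" "l + (m + k - 1) - 1 = ?K" "m + (k + l - 1) - 1 = ?K" by auto
        have mem: "commutator A a (commutator A b c) \<in> F ?K" "commutator A b (commutator A c a) \<in> F ?K"
          "commutator A c (commutator A a b) \<in> F ?K"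
          using F_commutator[OF a F_commutator[OF b c]] F_commutator[OF b F_commutator[OF c a]]
            F_commutator[OF c F_commutator[OF a b]] by (simp_all only: idx)
        show ?case
          unfolding bracket_psi[OF a b] bracket_psi[OF b c] bracket_psi[OF c a]
            bracket_psi[OF a F_commutator[OF b c]] bracket_psi[OF b F_commutator[OF c a]]
            bracket_psi[OF c F_commutator[OF a b]] idx psi_add[OF mem(1,2)]
            psi_add[OF F_add[OF mem(1,2)] mem(3)] comm psi_zero ..
      next
        case (add h h')
        then show ?case using a b by (simp only: J_add psi_closed) simp
      qed
    next
      case (add g g' h)
      then show ?case using a by (simp only: J_add psi_closed) simp
    qed
  next
    case (add f f' g h)
    then show ?case by (simp only: J_add) simp
  qed
qed

lemma poisson_bracket_bracket: "poisson_bracket S bracket"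
  unfolding poisson_bracket_def
  by (auto simp: bracket_closed bracket_add bracket_smult bracket_self bracket_jacobi bracket_leibniz)

end

section \<open>Poisson brackets are determined by generators\<close>

lemma poisson_bracketD:
  assumes "poisson_bracket S B" "f \<in> carrier S" "g \<in> carrier S" "h \<in> carrier S"
  shows "B f g \<in> carrier S" "B (f \<oplus>\<^bsub>S\<^esub> g) h = B f h \<oplus>\<^bsub>S\<^esub> B g h" "B f (g \<oplus>\<^bsub>S\<^esub> h) = B f g \<oplus>\<^bsub>S\<^esub> B f h"
    "B f f = \<zero>\<^bsub>S\<^esub>" "B f (g \<otimes>\<^bsub>S\<^esub> h) = B f g \<otimes>\<^bsub>S\<^esub> h \<oplus>\<^bsub>S\<^esub> g \<otimes>\<^bsub>S\<^esub> B f h"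
  using assms unfolding poisson_bracket_def by blast+

text \<open>Polarisation of B x x = 0 at x = f + g.\<close>

lemma poisson_bracket_antisym:
  assumes S: "ring S" and B: "poisson_bracket S B" and f: "f \<in> carrier S" and g: "g \<in> carrier S"
  shows "B f g = \<ominus>\<^bsub>S\<^esub> B g f"
proof -
  interpret ring S by fact
  note c = poisson_bracketD(1)[OF B f g f] poisson_bracketD(1)[OF B g f f]
  have fg: "f \<oplus>\<^bsub>S\<^esub> g \<in> carrier S" using f g by simp
  have "\<zero>\<^bsub>S\<^esub> = B (f \<oplus>\<^bsub>S\<^esub> g) (f \<oplus>\<^bsub>S\<^esub> g)"
    using poisson_bracketD(4)[OF B fg fg fg] by simp
  also have "\<dots> = B f g \<oplus>\<^bsub>S\<^esub> B g f"
    using c by (simp add: poisson_bracketD(2)[OF B f g fg] poisson_bracketD(3)[OF B f f g]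
        poisson_bracketD(3)[OF B g f g] poisson_bracketD(4)[OF B f f f] poisson_bracketD(4)[OF B g f f])
  finally show ?thesis using c by (intro minus_equality[symmetric]) auto
qed

text \<open>The Leibniz rule for 1 = 1 * 1 gives the bracket as twice itself.\<close>

lemma poisson_bracket_one:
  assumes S: "ring S" and B: "poisson_bracket S B" and f: "f \<in> carrier S"
  shows "B f \<one>\<^bsub>S\<^esub> = \<zero>\<^bsub>S\<^esub>"
proof -
  interpret ring S by fact
  note c = poisson_bracketD(1)[OF B f one_closed f]
  have "B f \<one>\<^bsub>S\<^esub> = B f \<one>\<^bsub>S\<^esub> \<oplus>\<^bsub>S\<^esub> B f \<one>\<^bsub>S\<^esub>"
    using poisson_bracketD(5)[OF B f one_closed one_closed] c by simp
  then show ?thesis using c by (simp add: add.r_cancel_one')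
qed

text \<open>For fixed first argument both brackets are derivations in the second one, so agreement
  on generators spreads to all elements. Antisymmetry carries this over to the first
  argument.\<close>

lemma poisson_bracket_unique:
  assumes S: "ring S" and smult: "\<And>c f. f \<in> carrier S \<Longrightarrow> c \<odot>\<^bsub>S\<^esub> f \<in> carrier S"
    and gen: "carrier S \<subseteq> subalgebra_generated S X" and X: "X \<subseteq> carrier S"
    and B: "poisson_bracket S B" and B': "poisson_bracket S B'"
    and eq: "\<And>x y. x \<in> X \<Longrightarrow> y \<in> X \<Longrightarrow> B x y = B' x y"
    and f: "f \<in> carrier S" and g: "g \<in> carrier S"
  shows "B f g = B' f g"
proof -
  interpret ring S by fact
  have right: "B f g = B' f g"
    if f: "f \<in> carrier S" and fX: "\<And>y. y \<in> X \<Longrightarrow> B f y = B' f y" and g: "g \<in> carrier S" for f g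
  proof -
    have "g \<in> subalgebra_generated S X" using g gen by blast
    then have "g \<in> carrier S \<and> B f g = B' f g"
    proof (induction rule: subalgebra_generated.induct)
      case one
      then show ?case using poisson_bracket_one[OF S B f] poisson_bracket_one[OF S B' f] by simp
    next
      case (gen x)
      then show ?case using fX X by auto
    next
      case (add x y)
      then show ?case using B B' f by (simp add: poisson_bracket_def)
    next
      case (mult x y)
      then show ?case using B B' f by (simp add: poisson_bracket_def)
    next
      case (smult x c)
      then show ?case using B B' f assms(2) by (simp add: poisson_bracket_def)
    qed
    then show ?thesis by simp
  qed
  \<comment> \<open>The generator is moved to the first slot, and \<open>right\<close> is applied to
    it with values on generators given by \<open>eq\<close>.\<close>
  have "B f y = B' f y" if y: "y \<in> X" for y
  proof -
    have "y \<in> carrier S" using y X by blast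
    then show ?thesis
      using right[of y f] eq[OF y] f poisson_bracket_antisym[OF S B f] poisson_bracket_antisym[OF S B' f]
      by simp
  qed
  then show ?thesis using right[OF f _ g] by blast
qed

subsection \<open>The symmetric algebra\<close>

lemma matrix_space_closed:
  assumes V: "abelian_monoid V" and smult: "\<forall>c. \<forall>x\<in>carrier V. c \<odot>\<^bsub>V\<^esub> x \<in> carrier V"
    "\<forall>c. c \<odot>\<^bsub>V\<^esub> \<zero>\<^bsub>V\<^esub> = \<zero>\<^bsub>V\<^esub>"
  shows "M \<in> carrier (matrix_space n V) \<Longrightarrow> M' \<in> carrier (matrix_space n V) \<Longrightarrow>
      M \<oplus>\<^bsub>matrix_space n V\<^esub> M' \<in> carrier (matrix_space n V)"
    and "M \<in> carrier (matrix_space n V) \<Longrightarrow> c \<odot>\<^bsub>matrix_space n V\<^esub> M \<in> carrier (matrix_space n V)"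
    and "i \<in> {1..n} \<Longrightarrow> j \<in> {1..n} \<Longrightarrow> x \<in> carrier V \<Longrightarrow> unit_matrix V i j x \<in> carrier (matrix_space n V)"
    and "x \<in> carrier V \<Longrightarrow> y \<in> carrier V \<Longrightarrow> unit_matrix V i j (x \<oplus>\<^bsub>V\<^esub> y) =
      unit_matrix V i j x \<oplus>\<^bsub>matrix_space n V\<^esub> unit_matrix V i j y"
    and "unit_matrix V i j (c \<odot>\<^bsub>V\<^esub> x) = c \<odot>\<^bsub>matrix_space n V\<^esub> unit_matrix V i j x"
proof -
  interpret abelian_monoid V by fact
  show "M \<in> carrier (matrix_space n V) \<Longrightarrow> M' \<in> carrier (matrix_space n V) \<Longrightarrow>
      M \<oplus>\<^bsub>matrix_space n V\<^esub> M' \<in> carrier (matrix_space n V)"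
    by (auto simp: matrix_space_def)
  show "M \<in> carrier (matrix_space n V) \<Longrightarrow> c \<odot>\<^bsub>matrix_space n V\<^esub> M \<in> carrier (matrix_space n V)"
    by (auto simp: matrix_space_def smult)
  show "i \<in> {1..n} \<Longrightarrow> j \<in> {1..n} \<Longrightarrow> x \<in> carrier V \<Longrightarrow> unit_matrix V i j x \<in> carrier (matrix_space n V)"
    by (auto simp: matrix_space_def unit_matrix_def)
  show "x \<in> carrier V \<Longrightarrow> y \<in> carrier V \<Longrightarrow> unit_matrix V i j (x \<oplus>\<^bsub>V\<^esub> y) =
      unit_matrix V i j x \<oplus>\<^bsub>matrix_space n V\<^esub> unit_matrix V i j y"
    by (auto simp: matrix_space_def unit_matrix_def fun_eq_iff)
  show "unit_matrix V i j (c \<odot>\<^bsub>V\<^esub> x) = c \<odot>\<^bsub>matrix_space n V\<^esub> unit_matrix V i j x"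
    by (auto simp: matrix_space_def unit_matrix_def fun_eq_iff smult)
qed

context countable_dim_algebra
begin

section \<open>The tensor algebra and its part of positive degree\<close>

lemma linear_quotient_T: "linear_quotient (omega scale) (tensor_ideal (omega scale))"
proof -
  have sub: "linear_relations (omega scale) \<subseteq> carrier (free_algebra (carrier (omega scale)))"
    by (auto simp: carrier_free_algebra)
  show ?thesis
    unfolding tensor_ideal_def
    using ring.genideal_self[OF ring_free_algebra sub]
    by (intro linear_quotient.intro free_quotient.intro linear_quotient_axioms.intro
        ring.genideal_ideal[OF ring_free_algebra] sub)
qed

sublocale T: linear_quotient "omega scale" "tensor_ideal (omega scale)"
  rewrites "carrier (omega scale) = UNIV"
    and "quotient_algebra (free_algebra UNIV) (tensor_ideal (omega scale)) = tensor_algebra (omega scale)"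
  by (rule linear_quotient_T) (simp_all add: tensor_algebra_def)

definition T_plus_polys :: "('a list \<Rightarrow>\<^sub>0 complex) set" where
  "T_plus_polys = {f. [] \<notin> Poly_Mapping.keys f}"

lemma T_plus_polys_add: "f \<in> T_plus_polys \<Longrightarrow> g \<in> T_plus_polys \<Longrightarrow> f + g \<in> T_plus_polys"
  using keys_add[of f g] by (auto simp: T_plus_polys_def)

lemma T_plus_polys_smult: "f \<in> T_plus_polys \<Longrightarrow> scal c * f \<in> T_plus_polys"
  by (auto simp: T_plus_polys_def in_keys_iff lookup_scal_mult)

lemma T_plus_simps:
  "carrier (T_plus scale) = T.cls ` T_plus_polys" "zero (T_plus scale) = T.cls 0"
  "add (T_plus scale) (T.cls f) (T.cls g) = T.cls (f + g)"
  "smult (T_plus scale) c (T.cls f) = T.cls (scal c * f)"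
proof -
  show "carrier (T_plus scale) = T.cls ` T_plus_polys"
    by (auto simp: T_plus_def span_words_def T.cls_def T_plus_polys_def carrier_free_algebra)
  show "zero (T_plus scale) = T.cls 0" by (simp add: T_plus_def T.Q_zero)
  show "add (T_plus scale) (T.cls f) (T.cls g) = T.cls (f + g)"
    using T.Q_add[of f g] by (simp add: T_plus_def)
  show "smult (T_plus scale) c (T.cls f) = T.cls (scal c * f)"
    using T.Q_smult[of c f] by (simp add: T_plus_def)
qed

lemma tensor_cls: "tensor scale xs = T.cls (word xs)"
  by (simp add: tensor_def T.cls_def)

lemma abelian_monoid_T_plus: "abelian_monoid (T_plus scale)"
  by (rule abelian_monoidI) (auto simp: T_plus_simps T_plus_polys_add algebra_simps, auto simp: T_plus_polys_def)

lemma T_plus_smult: "\<forall>c. \<forall>x\<in>carrier (T_plus scale). c \<odot>\<^bsub>T_plus scale\<^esub> x \<in> carrier (T_plus scale)"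
    "\<forall>c. c \<odot>\<^bsub>T_plus scale\<^esub> \<zero>\<^bsub>T_plus scale\<^esub> = \<zero>\<^bsub>T_plus scale\<^esub>"
  by (auto simp: T_plus_simps T_plus_polys_smult)

lemmas M_closed = matrix_space_closed[OF abelian_monoid_T_plus T_plus_smult, folded M_space_def]

lemma linear_quotient_S: "linear_quotient (\<M> d) (symmetric_ideal (\<M> d))"
proof -
  have sub: "linear_relations (\<M> d) \<union>
      {word [x, y] - word [y, x] | x y. x \<in> carrier (\<M> d) \<and> y \<in> carrier (\<M> d)}
      \<subseteq> carrier (free_algebra (carrier (\<M> d)))"
    by (auto simp: linear_relations_def map_times_conv_mult M_closed intro!: free_carrier_closed)
  show ?thesis
    unfolding symmetric_ideal_def
    using ring.genideal_self[OF ring_free_algebra sub]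
    by (intro linear_quotient.intro free_quotient.intro linear_quotient_axioms.intro
        ring.genideal_ideal[OF ring_free_algebra] sub) blast
qed

sublocale S: linear_quotient "\<M> d" "symmetric_ideal (\<M> d)"
  rewrites "quotient_algebra (free_algebra (carrier (\<M> d))) (symmetric_ideal (\<M> d)) = \<S> d"
  for d
  by (rule linear_quotient_S) (simp add: S_algebra_def symmetric_algebra_def)

definition S_generators :: "nat \<Rightarrow> _" where
  "S_generators d = {p_elem scale d i j xs | i j xs. i \<in> {1..d} \<and> j \<in> {1..d} \<and> xs \<noteq> []}"

abbreviation "Salg d \<equiv> subalgebra_generated (\<S> d) (S_generators d)"

lemma p_elem_cls: "xs \<noteq> [] \<Longrightarrow> p_elem scale d i j xs = S.cls d (word [unit_matrix (T_plus scale) i j (tensor scale xs)])"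
  by (simp add: p_elem_def S.cls_def)

lemma tensor_in_T_plus: "xs \<noteq> [] \<Longrightarrow> tensor scale xs \<in> carrier (T_plus scale)"
  by (auto simp: tensor_cls T_plus_simps T_plus_polys_def word_def)

lemma p_elem_in_S: "i \<in> {1..d} \<Longrightarrow> j \<in> {1..d} \<Longrightarrow> p_elem scale d i j xs \<in> carrier (\<S> d)"
  using M_closed(3)[of i d j "tensor scale xs"] tensor_in_T_plus[of xs]
  by (cases "xs = []") (auto simp: p_elem_cls, auto simp: p_elem_def S.Q_zero S.Q_one)

lemma Salg_zero: "\<zero>\<^bsub>\<S> d\<^esub> \<in> Salg d"
  using subalgebra_generated.smult[OF subalgebra_generated.one, where c = 0 and A = "\<S> d" and S = "S_generators d"]
  by (simp add: S.Q_one S.Q_zero)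

text \<open>The generators involve decomposable tensors only. A general entry is a linear
  combination of these, and placing an entry at position (i, j) is linear.\<close>

lemma cls_unit_in_Salg:
  assumes h: "h \<in> T_plus_polys" and ij: "i \<in> {1..d}" "j \<in> {1..d}"
  shows "S.cls d (word [unit_matrix (T_plus scale) i j (T.cls h)]) \<in> Salg d"
proof -
  let ?u = "\<lambda>f. S.cls d (word [unit_matrix (T_plus scale) i j (T.cls f)])"
  have add: "?u (f + g) = ?u f \<oplus>\<^bsub>\<S> d\<^esub> ?u g" if "f \<in> T_plus_polys" "g \<in> T_plus_polys" for f g
  proof -
    have c: "T.cls f \<in> carrier (T_plus scale)" "T.cls g \<in> carrier (T_plus scale)"
      using that by (auto simp: T_plus_simps)
    have "unit_matrix (T_plus scale) i j (T.cls (f + g)) =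
        unit_matrix (T_plus scale) i j (T.cls f) \<oplus>\<^bsub>\<M> d\<^esub> unit_matrix (T_plus scale) i j (T.cls g)"
      using M_closed(4)[OF c] by (simp add: T_plus_simps)
    then show ?thesis
      using S.word_add[OF M_closed(3)[OF ij c(1)] M_closed(3)[OF ij c(2)]] by (simp add: S.cls_eq_iff)
  qed
  have smult: "?u (scal c * f) = c \<odot>\<^bsub>\<S> d\<^esub> ?u f" if "f \<in> T_plus_polys" for c f
  proof -
    have cl: "T.cls f \<in> carrier (T_plus scale)"
      using that by (auto simp: T_plus_simps)
    have "unit_matrix (T_plus scale) i j (T.cls (scal c * f)) =
        c \<odot>\<^bsub>\<M> d\<^esub> unit_matrix (T_plus scale) i j (T.cls f)"
      using M_closed(5)[of i j c "T.cls f" d] by (simp add: T_plus_simps)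
    then show ?thesis
      using S.word_smult[OF M_closed(3)[OF ij cl], of c] by (simp add: S.cls_eq_iff)
  qed
  have wordne: "word w \<in> T_plus_polys" if "w \<noteq> []" for w using that by (auto simp: T_plus_polys_def word_def)
  \<comment> \<open>Membership in \<open>T_plus_polys\<close> is carried along because additivity of
    the placement is available only there.\<close>
  have "?u (\<Sum>w\<in>A. scal (c w) * word w) \<in> Salg d \<and>
     (\<Sum>w\<in>A. scal (c w) * word w) \<in> T_plus_polys"
    if "finite A" "[] \<notin> A" for A c
    using that
  proof (induction A rule: finite_induct)
    case empty
    have "0 \<in> T_plus_polys" by (simp add: T_plus_polys_def)
    moreover have "?u 0 = \<zero>\<^bsub>\<S> d\<^esub>"
      using smult[OF \<open>0 \<in> T_plus_polys\<close>, of 0] by (simp add: S.Q_zero)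
    ultimately show ?case using Salg_zero by simp
  next
    case (insert w A)
    have w: "w \<noteq> []" using insert by auto
    have "?u (word w) \<in> Salg d"
      unfolding tensor_cls[symmetric] p_elem_cls[OF w, symmetric]
      using ij w by (intro subalgebra_generated.gen) (auto simp: S_generators_def)
    then have "?u (scal (c w) * word w) \<in> Salg d"
      unfolding smult[OF wordne[OF w]] by (rule subalgebra_generated.smult)
    moreover have t: "scal (c w) * word w \<in> T_plus_polys"
      by (rule T_plus_polys_smult[OF wordne[OF w]])
    moreover have r: "?u (\<Sum>w\<in>A. scal (c w) * word w) \<in> Salg d"
        "(\<Sum>w\<in>A. scal (c w) * word w) \<in> T_plus_polys"
      using insert by auto
    ultimately show ?case
      unfolding sum.insert[OF insert(1,2)] add[OF t r(2)]
      by (intro conjI subalgebra_generated.add T_plus_polys_add)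
  qed
  from this[of "Poly_Mapping.keys h" "Poly_Mapping.lookup h"] show ?thesis
    using h poly_mapping_eq_sum_words[of h] by (simp add: T_plus_polys_def)
qed

lemma S_generated: "carrier (\<S> d) \<subseteq> Salg d"
proof
  fix f assume "f \<in> carrier (\<S> d)"
  then obtain g where g: "g \<in> S.C d" "f = S.cls d g" by (rule S.Q_cases)
  have sum: "S.cls d (sum h A) \<in> Salg d" if "\<And>i. i \<in> A \<Longrightarrow> S.cls d (h i) \<in> Salg d" for h and A :: "nat set"
    using that
  proof (induction A rule: infinite_finite_induct)
    case (insert x A)
    then have "S.cls d (h x) \<oplus>\<^bsub>\<S> d\<^esub> S.cls d (sum h A) \<in> Salg d"
      by (intro subalgebra_generated.add) auto
    with insert show ?case by simp
  qed (use Salg_zero in \<open>auto simp: S.Q_zero\<close>)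
  \<comment> \<open>A letter is a matrix over the tensor algebra: it is split into its entries, and
    each entry is covered by \<open>cls_unit_in_Salg\<close>.\<close>
  have one: "S.cls d (word [M]) \<in> Salg d" if M: "M \<in> carrier (\<M> d)" for M
  proof -
    have "word [M] - (\<Sum>i=1..d. \<Sum>j=1..d. word [unit_matrix (T_plus scale) i j (M i j)]) \<in> symmetric_ideal (\<M> d)"
      unfolding M_space_def
      using linear_quotient_S[of d] M
      by (intro word_matrix_decomp abelian_monoid_T_plus) (simp_all add: M_space_def)
    then have "S.cls d (word [M]) = S.cls d (\<Sum>i=1..d. \<Sum>j=1..d. word [unit_matrix (T_plus scale) i j (M i j)])"
      by (simp add: S.cls_eq_iff)
    moreover have "S.cls d (word [unit_matrix (T_plus scale) i j (M i j)]) \<in> Salg d" if "i \<in> {1..d}" "j \<in> {1..d}" for i j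
    proof -
      have "M i j \<in> carrier (T_plus scale)" using M by (simp add: M_space_def matrix_space_def)
      then obtain h where "h \<in> T_plus_polys" "M i j = T.cls h" by (auto simp: T_plus_simps)
      then show ?thesis using cls_unit_in_Salg that by simp
    qed
    ultimately show ?thesis by (simp only:) (intro sum)
  qed
  show "f \<in> Salg d"
    unfolding g(2) using g(1)
  proof (induction rule: free_words_induct)
    case (word w)
    then show ?case
    proof (induction w)
      case Nil
      show ?case using subalgebra_generated.one[of "\<S> d"] by (simp add: word_Nil S.Q_one)
    next
      case (Cons M w)
      then have "S.cls d (word [M]) \<otimes>\<^bsub>\<S> d\<^esub> S.cls d (word w) \<in> Salg d"
        by (intro subalgebra_generated.mult one) auto
      with Cons.prems show ?case by (simp add: word_mult)
    qed
  next
    case (add f g)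
    then show ?case using subalgebra_generated.add[OF add(3,4)] by simp
  next
    case (smult c f)
    then show ?case using subalgebra_generated.smult[OF smult(2), of c] by simp
  qed
qed

lemma S_smult:
  "x \<in> carrier (\<S> d) \<Longrightarrow> c \<odot>\<^bsub>\<S> d\<^esub> x \<in> carrier (\<S> d)"
  "x \<in> carrier (\<S> d) \<Longrightarrow> y \<in> carrier (\<S> d) \<Longrightarrow>
    c \<odot>\<^bsub>\<S> d\<^esub> (x \<oplus>\<^bsub>\<S> d\<^esub> y) =
    c \<odot>\<^bsub>\<S> d\<^esub> x \<oplus>\<^bsub>\<S> d\<^esub> c \<odot>\<^bsub>\<S> d\<^esub> y"
  by (auto elim!: S.Q_cases simp: distrib_left)

section \<open>Lifts of the filtration of \<open>Y\<^sub>d(\<Omega>)\<close>\<close>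

definition Y_polys :: "nat \<Rightarrow> complex \<Rightarrow> int \<Rightarrow> _" where
  "Y_polys d s k = {f \<in> A_polys d k. A_seq d f \<in> carrier (\<Y> d s)}"

lemma Y_polys_C_seqs: "f \<in> Y_polys d s k \<Longrightarrow> f \<in> C_seqs d"
  by (auto simp: Y_polys_def A_polys_C_seqs)

lemma Y_filtration_eq: "\<F> d s k = A_seq d ` Y_polys d s k"
  by (auto simp: Y_filtration_iff Y_polys_def)

lemma Y_polys_ops:
  shows Y_polys_add: "f \<in> Y_polys d s k \<Longrightarrow> g \<in> Y_polys d s k \<Longrightarrow> (\<lambda>N. f N + g N) \<in> Y_polys d s k"
    and Y_polys_mult: "f \<in> Y_polys d s k \<Longrightarrow> g \<in> Y_polys d s l \<Longrightarrow> (\<lambda>N. f N * g N) \<in> Y_polys d s (k + l)"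
    and Y_polys_smult: "f \<in> Y_polys d s k \<Longrightarrow> (\<lambda>N. scal c * f N) \<in> Y_polys d s k"
    and Y_polys_one: "0 \<le> k \<Longrightarrow> (\<lambda>N. 1) \<in> Y_polys d s k"
    and Y_polys_zero: "(\<lambda>N. 0) \<in> Y_polys d s k"
  using Y_closed(1)[of d s] Y_closed(2)[of "A_seq d f" d s "A_seq d g"] Y_closed(3)[of "A_seq d f" d s "A_seq d g"]
    Y_closed(4)[of "A_seq d f" d s c] Y_zero_closed[of d s]
  by (auto simp: Y_polys_def A_polys_add A_polys_mult A_polys_smult A_polys_one A_polys_zero A_ops A_polys_C_seqs)

lemma Y_polys_uminus: "f \<in> Y_polys d s k \<Longrightarrow> (\<lambda>N. - f N) \<in> Y_polys d s k"
  using Y_polys_smult[of f d s k "- 1"] by (simp add: scal_minus_one)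

lemma Y_polys_diff: "f \<in> Y_polys d s k \<Longrightarrow> g \<in> Y_polys d s k \<Longrightarrow> (\<lambda>N. f N - g N) \<in> Y_polys d s k"
  using Y_polys_add[OF _ Y_polys_uminus, of f d s k g] by simp

lemma Y_polys_mono: "f \<in> Y_polys d s k \<Longrightarrow> k \<le> l \<Longrightarrow> f \<in> Y_polys d s l"
  by (auto simp: Y_polys_def intro: A_polys_mono)

lemma Y_polys_sum: "(\<And>i. i \<in> A \<Longrightarrow> f i \<in> Y_polys d s k) \<Longrightarrow> (\<lambda>N. \<Sum>i\<in>A. f i N) \<in> Y_polys d s k"
  by (induction A rule: infinite_finite_induct) (simp_all add: Y_polys_zero Y_polys_add)

lemma Y_polys_commute:
  assumes "f \<in> Y_polys d s k" "g \<in> Y_polys d s l"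
  shows "(\<lambda>N. f N * g N - g N * f N) \<in> Y_polys d s (k + l - 1)"
proof -
  have "(\<lambda>N. f N * g N - g N * f N) \<in> Y_polys d s (k + l)"
    using Y_polys_diff[OF Y_polys_mult[OF assms]] Y_polys_mult[OF assms(2,1)] by (simp add: add.commute)
  then show ?thesis using A_polys_commute[of f d k g l] assms by (auto simp: Y_polys_def)
qed

lemma Y_minus:
  assumes "f \<in> Y_polys d s k" "g \<in> Y_polys d s l"
  shows "A_seq d f \<ominus>\<^bsub>\<Y> d s\<^esub> A_seq d g = A_seq d (\<lambda>N. f N - g N)"
  using Y_a_inv[OF _ Y_polys_C_seqs[OF assms(2)], of s] assms(2) by (simp add: a_minus_def Y_polys_def Y_ops A_ops)

lemma Y_commutator:
  assumes "f \<in> Y_polys d s k" "g \<in> Y_polys d s l"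
  shows "commutator (\<Y> d s) (A_seq d f) (A_seq d g) = A_seq d (\<lambda>N. f N * g N - g N * f N)"
  using Y_minus[OF Y_polys_mult[OF assms] Y_polys_mult[OF assms(2,1)]] assms
  by (simp add: commutator_def Y_ops A_ops Y_polys_C_seqs)

text \<open>The empty list is included, with the Kronecker delta as value, since the factors of the
  bracket formula may be empty words.\<close>

lemma t_seq_Y_polys:
  assumes "i \<in> {1..d}" "j \<in> {1..d}"
  shows "t_seq s i j xs \<in> Y_polys d s (int (length xs))"
proof (cases "xs = []")
  case True
  then have "t_seq s i j xs = (\<lambda>N. if i = j then 1 else 0)" by (auto simp: t_seq_def)
  then show ?thesis using True Y_polys_one Y_polys_zero by simp
next
  case False
  then have "A_seq d (t_seq s i j xs) \<in> carrier (\<Y> d s)"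
    using assms unfolding carrier_Y t_elem_A_seq[OF assms False, symmetric]
    by (intro subalgebra_generated.gen) (auto simp: Y_generators_def)
  then show ?thesis using t_seq_A_polys[OF assms] by (simp add: Y_polys_def)
qed

lemma filtered_algebra_Y: "filtered_algebra (\<Y> d s) (\<F> d s)"
proof (intro filtered_algebra.intro ring_Y filtered_algebra_axioms.intro)
  let ?Y = "\<Y> d s"
  fix a b c k l
  show "c \<odot>\<^bsub>?Y\<^esub> a \<in> carrier ?Y" if "a \<in> carrier ?Y" using that by (simp add: Y_ops Y_closed)
  show "c \<odot>\<^bsub>?Y\<^esub> (a \<oplus>\<^bsub>?Y\<^esub> b) = c \<odot>\<^bsub>?Y\<^esub> a \<oplus>\<^bsub>?Y\<^esub> c \<odot>\<^bsub>?Y\<^esub> b" if "a \<in> carrier ?Y" "b \<in> carrier ?Y"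
    using that by (auto elim!: Y_cases simp: Y_ops A_ops distrib_left)
  show "(c \<odot>\<^bsub>?Y\<^esub> a) \<otimes>\<^bsub>?Y\<^esub> b = c \<odot>\<^bsub>?Y\<^esub> (a \<otimes>\<^bsub>?Y\<^esub> b)" if "a \<in> carrier ?Y" "b \<in> carrier ?Y"
    using that by (auto elim!: Y_cases simp: Y_ops A_ops C_seqs_closed mult.assoc)
  show "a \<otimes>\<^bsub>?Y\<^esub> (c \<odot>\<^bsub>?Y\<^esub> b) = c \<odot>\<^bsub>?Y\<^esub> (a \<otimes>\<^bsub>?Y\<^esub> b)" if "a \<in> carrier ?Y" "b \<in> carrier ?Y"
    using that by (auto elim!: Y_cases simp: Y_ops A_ops C_seqs_closed mult_scal_left)
  show "a \<in> carrier ?Y" if "a \<in> \<F> d s k" using that by (simp add: Y_filtration_def)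
  show "\<zero>\<^bsub>?Y\<^esub> \<in> \<F> d s k"
    using Y_polys_zero by (auto simp: Y_filtration_eq Y_ops A_ops)
  show "a \<oplus>\<^bsub>?Y\<^esub> b \<in> \<F> d s k" if "a \<in> \<F> d s k" "b \<in> \<F> d s k"
    using that by (auto simp: Y_filtration_eq Y_ops A_ops intro!: imageI Y_polys_add)
  show "\<ominus>\<^bsub>?Y\<^esub> a \<in> \<F> d s k" if "a \<in> \<F> d s k"
    using that by (auto simp: Y_filtration_eq Y_polys_def Y_a_inv A_polys_C_seqs intro!: imageI Y_polys_uminus[unfolded Y_polys_def])
  show "c \<odot>\<^bsub>?Y\<^esub> a \<in> \<F> d s k" if "a \<in> \<F> d s k"
    using that by (auto simp: Y_filtration_eq Y_ops A_ops intro!: imageI Y_polys_smult)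
  show "a \<in> \<F> d s l" if "a \<in> \<F> d s k" "k \<le> l"
    using that Y_polys_mono by (auto simp: Y_filtration_eq)
  show "\<one>\<^bsub>?Y\<^esub> \<in> \<F> d s 0"
    using Y_polys_one by (auto simp: Y_filtration_eq Y_ops A_ops)
  show "a \<otimes>\<^bsub>?Y\<^esub> b \<in> \<F> d s (k + l)" if "a \<in> \<F> d s k" "b \<in> \<F> d s l"
    using that by (auto simp: Y_filtration_eq Y_ops A_ops Y_polys_C_seqs intro!: imageI Y_polys_mult)
  show "commutator ?Y a b \<in> \<F> d s (k + l - 1)" if "a \<in> \<F> d s k" "b \<in> \<F> d s l"
    using that by (auto simp: Y_filtration_eq Y_commutator intro!: imageI Y_polys_commute)
qed

subsection \<open>The bracket formula\<close>

lemma leading_bracket_conv: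
  "leading_bracket f i j k l xs ys =
   (\<Sum>r=1..length xs. \<Sum>q=1..length ys. f k j (take (q - 1) ys @ drop r xs) *
      f i l (take (r - 1) xs @ [xs ! (r - 1) * ys ! (q - 1)] @ drop q ys)) -
   (\<Sum>r=1..length xs. \<Sum>q=1..length ys. f k j (take (q - 1) ys @ [ys ! (q - 1) * xs ! (r - 1)] @ drop r xs) *
      f i l (take (r - 1) xs @ drop q ys))"
  by (simp add: leading_bracket_def One_nat_def sum.atLeast1_atMost_eq sum_subtractf)

end

theorem proposition5p3:
  fixes scale :: "complex \<Rightarrow> 'a::ring \<Rightarrow> 'a"
    and d :: nat
    and s :: complex
  assumes "countable_dim_algebra scale"
    and "1 \<le> d"
    and "graded_algebra_iso
        (assoc_graded (Y_algebra scale d s) (Y_filtration scale d s))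
        (gr_component (Y_algebra scale d s) (Y_filtration scale d s))
        (S_algebra scale d) (S_component scale d) \<phi>"
    and "\<And>i j xs. i \<in> {1..d} \<Longrightarrow> j \<in> {1..d} \<Longrightarrow> xs \<noteq> [] \<Longrightarrow>
        \<phi> (gr_class (Y_algebra scale d s) (Y_filtration scale d s) (int (length xs))
             (t_elem scale d s i j xs)) = p_elem scale d i j xs"
  shows "\<exists>B. poisson_bracket (S_algebra scale d) B \<and>
      satisfies_bracket_formula scale d B \<and>
      (\<forall>B'. poisson_bracket (S_algebra scale d) B' \<and> satisfies_bracket_formula scale d B' \<longrightarrow>
         (\<forall>f\<in>carrier (S_algebra scale d). \<forall>g\<in>carrier (S_algebra scale d). B' f g = B f g)) \<and>
      (\<forall>g\<in>carrier (assoc_graded (Y_algebra scale d s) (Y_filtration scale d s)).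
       \<forall>h\<in>carrier (assoc_graded (Y_algebra scale d s) (Y_filtration scale d s)).
         \<phi> (gr_bracket (Y_algebra scale d s) (Y_filtration scale d s) g h) = B (\<phi> g) (\<phi> h))"
proof -
  let ?Y = "Y_algebra scale d s" and ?F = "Y_filtration scale d s" and ?S = "S_algebra scale d"
  interpret countable_dim_algebra scale by fact
  interpret gi: graded_iso ?Y ?F ?S \<phi>
    using assms(3) S_smult
    by (intro graded_iso.intro graded_iso_axioms.intro filtered_algebra_Y S.ring_Q)
       (auto simp: graded_algebra_iso_def)
  \<comment> \<open>Symbols of sequences of lifts, so that congruences found in the free algebras
    can be applied to them.\<close>
  define \<psi> where "\<psi> k f = gi.\<psi> k (A_seq d f)" for k f
  have F: "f \<in> Y_polys d s k \<Longrightarrow> A_seq d f \<in> ?F k" for f k by (simp add: Y_filtration_eq)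
  have psi_add: "\<psi> k f \<oplus>\<^bsub>?S\<^esub> \<psi> k g = \<psi> k (\<lambda>N. f N + g N)" if "f \<in> Y_polys d s k" "g \<in> Y_polys d s k" for f g k
    using gi.psi_add[OF F F, OF that] by (simp add: \<psi>_def Y_ops A_ops)
  have psi_minus: "\<psi> k f \<ominus>\<^bsub>?S\<^esub> \<psi> k g = \<psi> k (\<lambda>N. f N - g N)" if "f \<in> Y_polys d s k" "g \<in> Y_polys d s k" for f g k
    using gi.psi_minus[OF F F, OF that] by (simp add: \<psi>_def Y_minus[OF that])
  have psi_mult: "\<psi> k f \<otimes>\<^bsub>?S\<^esub> \<psi> l g = \<psi> (k + l) (\<lambda>N. f N * g N)" if "f \<in> Y_polys d s k" "g \<in> Y_polys d s l" for f g k l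
    using gi.psi_mult[OF F F, OF that] that by (simp add: \<psi>_def Y_ops A_ops Y_polys_C_seqs)
  have psi_closed: "\<psi> k f \<in> carrier ?S" if "f \<in> Y_polys d s k" for f k
    using gi.psi_closed[OF F[OF that]] by (simp add: \<psi>_def)
  have psi_sum: "(\<Oplus>\<^bsub>?S\<^esub>x\<in>X. \<psi> k (f x)) = \<psi> k (\<lambda>N. \<Sum>x\<in>X. f x N)"
    if "finite X" "\<And>x. x \<in> X \<Longrightarrow> f x \<in> Y_polys d s k" for X :: "nat set" and f k
    using that
  proof (induction X rule: finite_induct)
    case empty
    show ?case using gi.psi_zero[of k] by (simp add: \<psi>_def Y_ops A_ops)
  next
    case (insert x X)
    then have "(\<Oplus>\<^bsub>?S\<^esub>x\<in>insert x X. \<psi> k (f x)) = \<psi> k (f x) \<oplus>\<^bsub>?S\<^esub> (\<Oplus>\<^bsub>?S\<^esub>x\<in>X. \<psi> k (f x))"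
      by (intro gi.S.finsum_insert) (auto intro: psi_closed)
    then show ?case using insert by (simp add: psi_add Y_polys_sum)
  qed
  \<comment> \<open>Extends the hypothesis on \<open>\<phi>\<close> to the empty list, where both
    sides are Kronecker deltas in degree 0.\<close>
  have p_psi: "p_elem scale d i j xs = \<psi> (int (length xs)) (t_seq s i j xs)"
    if ij: "i \<in> {1..d}" "j \<in> {1..d}" for i j xs
  proof (cases "xs = []")
    case True
    then have "t_seq s i j xs = (if i = j then (\<lambda>N. 1) else (\<lambda>N. 0))" by (auto simp: t_seq_def)
    then show ?thesis
      using True gi.psi_one gi.psi_zero[of 0] by (simp add: \<psi>_def p_elem_def Y_ops A_ops)
  next
    case False
    then show ?thesis
      using assms(4)[OF ij False] by (simp add: \<psi>_def gi.\<psi>_def t_elem_A_seq[OF ij False])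
  qed
  have formula: "satisfies_bracket_formula scale d gi.bracket"
    unfolding satisfies_bracket_formula_def
  proof (intro ballI allI impI)
    fix i j k l and xs ys :: "'a list"
    assume ijkl: "i \<in> {1..d}" "j \<in> {1..d}" "k \<in> {1..d}" "l \<in> {1..d}"
    let ?m = "length xs" and ?n = "length ys"
    \<comment> \<open>The degrees of the two symbols add up and the bracket lowers the sum by one;
      every product on the right-hand side has this degree too.\<close>
    define K where "K = int ?m + int ?n - 1"
    let ?x = "t_seq s i j xs" and ?y = "t_seq s k l ys"
    define P where "P r q = (\<lambda>N. t_seq s k j (take (q - 1) ys @ drop r xs) N *
        t_seq s i l (take (r - 1) xs @ [xs ! (r - 1) * ys ! (q - 1)] @ drop q ys) N)" for r q
    define P' where "P' r q = (\<lambda>N. t_seq s k j (take (q - 1) ys @ [ys ! (q - 1) * xs ! (r - 1)] @ drop r xs) N *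
        t_seq s i l (take (r - 1) xs @ drop q ys) N)" for r q
    define L where "L = (\<lambda>N. (\<Sum>r=1..?m. \<Sum>q=1..?n. P r q N) - (\<Sum>r=1..?m. \<Sum>q=1..?n. P' r q N))"
    have prod: "(\<lambda>N. t_seq s k j u N * t_seq s i l v N) \<in> Y_polys d s K \<and>
        p_elem scale d k j u \<otimes>\<^bsub>?S\<^esub> p_elem scale d i l v = \<psi> K (\<lambda>N. t_seq s k j u N * t_seq s i l v N)"
      if "length u + length v + 1 = ?m + ?n" for u v
    proof -
      have idx: "int (length u) + int (length v) = K" using that by (simp add: K_def)
      show ?thesis
        using Y_polys_mult[OF t_seq_Y_polys[OF ijkl(3,2), of s u] t_seq_Y_polys[OF ijkl(1,4), of s v]]
          psi_mult[OF t_seq_Y_polys[OF ijkl(3,2), of s u] t_seq_Y_polys[OF ijkl(1,4), of s v]]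
        unfolding p_psi[OF ijkl(3,2)] p_psi[OF ijkl(1,4)] idx by simp
    qed
    have P: "P r q \<in> Y_polys d s K" "p_elem scale d k j (take (q - 1) ys @ drop r xs) \<otimes>\<^bsub>?S\<^esub>
        p_elem scale d i l (take (r - 1) xs @ [xs ! (r - 1) * ys ! (q - 1)] @ drop q ys) = \<psi> K (P r q)"
      and P': "P' r q \<in> Y_polys d s K" "p_elem scale d k j (take (q - 1) ys @ [ys ! (q - 1) * xs ! (r - 1)] @ drop r xs) \<otimes>\<^bsub>?S\<^esub>
        p_elem scale d i l (take (r - 1) xs @ drop q ys) = \<psi> K (P' r q)"
      if "r \<in> {1..?m}" "q \<in> {1..?n}" for r q
      unfolding P_def P'_def using that
      by (auto intro!: prod[THEN conjunct1] prod[THEN conjunct2] simp del: append.simps)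
    have sum1: "(\<Oplus>\<^bsub>?S\<^esub>r\<in>{1..?m}. \<Oplus>\<^bsub>?S\<^esub>q\<in>{1..?n}. g r q) = \<psi> K (\<lambda>N. \<Sum>r=1..?m. \<Sum>q=1..?n. f r q N)"
      if f: "\<And>r q. r \<in> {1..?m} \<Longrightarrow> q \<in> {1..?n} \<Longrightarrow> f r q \<in> Y_polys d s K"
        "\<And>r q. r \<in> {1..?m} \<Longrightarrow> q \<in> {1..?n} \<Longrightarrow> g r q = \<psi> K (f r q)" for f g
    proof -
      have "(\<Oplus>\<^bsub>?S\<^esub>q\<in>{1..?n}. g r q) = \<psi> K (\<lambda>N. \<Sum>q=1..?n. f r q N)" if r: "r \<in> {1..?m}" for r
      proof -
        have "(\<Oplus>\<^bsub>?S\<^esub>q\<in>{1..?n}. g r q) = (\<Oplus>\<^bsub>?S\<^esub>q\<in>{1..?n}. \<psi> K (f r q))"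
          using f r by (intro gi.S.finsum_cong') (auto intro: psi_closed)
        then show ?thesis using psi_sum[of "{1..?n}" "f r" K] f(1)[OF r] by simp
      qed
      moreover have inner: "(\<lambda>N. \<Sum>q=1..?n. f r q N) \<in> Y_polys d s K" if "r \<in> {1..?m}" for r
        using f(1)[OF that] by (rule Y_polys_sum)
      ultimately have "(\<Oplus>\<^bsub>?S\<^esub>r\<in>{1..?m}. \<Oplus>\<^bsub>?S\<^esub>q\<in>{1..?n}. g r q) = (\<Oplus>\<^bsub>?S\<^esub>r\<in>{1..?m}. \<psi> K (\<lambda>N. \<Sum>q=1..?n. f r q N))"
        by (intro gi.S.finsum_cong') (auto intro!: psi_closed)
      then show ?thesis
        using psi_sum[of "{1..?m}" "\<lambda>r N. \<Sum>q=1..?n. f r q N" K, OF finite_atLeastAtMost inner] by simp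
    qed
    have sum_mem: "(\<lambda>N. \<Sum>r=1..?m. \<Sum>q=1..?n. P r q N) \<in> Y_polys d s K" "(\<lambda>N. \<Sum>r=1..?m. \<Sum>q=1..?n. P' r q N) \<in> Y_polys d s K"
      by (intro Y_polys_sum P(1) P'(1); assumption)+
    have L: "L \<in> Y_polys d s K" unfolding L_def by (rule Y_polys_diff[OF sum_mem])
    have rhs: "bracket_formula scale d i j k l xs ys = \<psi> K L"
    proof -
      have "(\<Oplus>\<^bsub>?S\<^esub>r\<in>{1..?m}. \<Oplus>\<^bsub>?S\<^esub>q\<in>{1..?n}. p_elem scale d k j (take (q - 1) ys @ drop r xs) \<otimes>\<^bsub>?S\<^esub>
          p_elem scale d i l (take (r - 1) xs @ [xs ! (r - 1) * ys ! (q - 1)] @ drop q ys)) =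
          \<psi> K (\<lambda>N. \<Sum>r=1..?m. \<Sum>q=1..?n. P r q N)"
        by (rule sum1; rule P; assumption)
      moreover have "(\<Oplus>\<^bsub>?S\<^esub>r\<in>{1..?m}. \<Oplus>\<^bsub>?S\<^esub>q\<in>{1..?n}.
          p_elem scale d k j (take (q - 1) ys @ [ys ! (q - 1) * xs ! (r - 1)] @ drop r xs) \<otimes>\<^bsub>?S\<^esub>
          p_elem scale d i l (take (r - 1) xs @ drop q ys)) =
          \<psi> K (\<lambda>N. \<Sum>r=1..?m. \<Sum>q=1..?n. P' r q N)"
        by (rule sum1; rule P'; assumption)
      ultimately show ?thesis
        unfolding bracket_formula_def L_def psi_minus[OF sum_mem, symmetric] by (simp only:)
    qed
    have x: "?x \<in> Y_polys d s (int ?m)" and y: "?y \<in> Y_polys d s (int ?n)"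
      using ijkl by (auto intro!: t_seq_Y_polys)
    have lhs: "gi.bracket (p_elem scale d i j xs) (p_elem scale d k l ys) = \<psi> K (\<lambda>N. ?x N * ?y N - ?y N * ?x N)"
      unfolding p_psi[OF ijkl(1,2)] p_psi[OF ijkl(3,4)] \<psi>_def gi.bracket_psi[OF F[OF x] F[OF y]]
        Y_commutator[OF x y] K_def ..
    have c: "(\<lambda>N. ?x N * ?y N - ?y N * ?x N) \<in> Y_polys d s K"
      using Y_polys_commute[OF x y] by (simp add: K_def)
    \<comment> \<open>Both sequences have degree \<open>K\<close> and differ in degree
      \<open>K - 1\<close> at every \<open>N\<close>. As this bound does not depend on
      \<open>N\<close>, the difference lies in the smaller filtration step of the algebra of
      sequences, and the symbols agree.\<close>
    have "(\<lambda>N. ?x N * ?y N - ?y N * ?x N - L N) \<in> Y_polys d s (K - 1)"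
    proof -
      have "?x N * ?y N - ?y N * ?x N - L N \<in> U_filt N (K - 1)" if "d \<le> N" for N
      proof -
        have "L N = leading_bracket (t_poly (- of_nat N - s) N) i j k l xs ys"
          by (simp only: L_def P_def P'_def leading_bracket_conv t_seq_def)
        then show ?thesis
          using t_poly_commutator[of i N j k l "- of_nat N - s" xs ys] ijkl that by (simp add: t_seq_def K_def)
      qed
      then show ?thesis using Y_polys_diff[OF c L] by (auto simp: Y_polys_def A_polys_def)
    qed
    then have "\<psi> K (\<lambda>N. ?x N * ?y N - ?y N * ?x N) = \<psi> K L"
      unfolding \<psi>_def using Y_minus[OF c L] by (intro gi.psi_eqI F c L) (simp add: F)
    then show "gi.bracket (p_elem scale d i j xs) (p_elem scale d k l ys) = bracket_formula scale d i j k l xs ys"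
      by (simp only: lhs rhs)
  qed
  have unique: "B' f g = gi.bracket f g"
    if "poisson_bracket ?S B'" "satisfies_bracket_formula scale d B'" "f \<in> carrier ?S" "g \<in> carrier ?S" for B' f g
  proof (rule poisson_bracket_unique[OF S.ring_Q S_smult(1) S_generated _ that(1) gi.poisson_bracket_bracket _ that(3,4)])
    show "S_generators d \<subseteq> carrier ?S" using p_elem_in_S by (auto simp: S_generators_def)
    show "B' x y = gi.bracket x y" if "x \<in> S_generators d" "y \<in> S_generators d" for x y
      using that formula \<open>satisfies_bracket_formula scale d B'\<close>
      by (auto simp: S_generators_def satisfies_bracket_formula_def)
  qed
  show ?thesis
  proof (intro exI[of _ gi.bracket] conjI allI impI ballI)
    show "B' f g = gi.bracket f g"
      if "poisson_bracket ?S B' \<and> satisfies_bracket_formula scale d B'" "f \<in> carrier ?S" "g \<in> carrier ?S"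
      for B' f g
      using that by (intro unique) auto
  qed (use gi.poisson_bracket_bracket formula gi.bracket_phi in simp_all)
qed

end
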